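(* Let $P=[v_1,\dots,v_n]$ be a generic closed polygon in $\mathbb{R}^3$ with $n\ge 4$ vertices. If $P$ is a Segre polygon (i.e. its tangent indicatrix has no self-intersections), then $P$ has at least 4 flattenings.
   Context: Indices are taken modulo $n$. A polygon $P=[v_1,\dots,v_n]$ in $\mathbb{R}^3$ is a closed polygonal line with vertices $v_1,\dots,v_n$ in this cyclic order. It is generic if no 4 of its vertices (four distinct indices) lie on a common plane. Let $u_i=\dfrac{v_{i+1}-v_i}{|v_{i+1}-v_i|}\in\mathbb{S}^2$. The (discrete) tangent indicatrix of $P$ is the closed spherical polygon $Q=[u_1,\dots,u_n]$ on the unit sphere $\mathbb{S}^2$, whose edges are the minimal-length great-circle segments joining $u_i$ to $u_{i+1}$ (for generic $P$, $u_i$ and $u_{i+1}$ are neither equal nor antipodal, so the segment is unique). $Q$ has no self-intersections if its vertices are pairwise distinct, non-adjacent edges are disjoint, and adjacent edges meet only at their common vertex. $P$ is a Segre polygon if its tangent indicatrix has no self-intersections. A flattening of $P$ is a triple of consecutive vertices $\{v_i,v_{i+1},v_{i+2}\}$ ($i$ modulo $n$) such that $v_{i-1}$ and $v_{i+3}$ lie on the same (open) side of the plane through $v_i,v_{i+1},v_{i+2}$. (When $n=4$, $v_{i-1}=v_{i+3}$, so every such triple is a flattening.) *)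

theory Defs
  imports "HOL-Analysis.Analysis"
begin

text \<open>A closed polygon (Euclidean or spherical) is the list of its vertices in cyclic order.
  \<open>vertex P\<close> reads the indices modulo the number of vertices, so that \<open>vertex P (- 1)\<close> is the
  last vertex.\<close>

definition vertex :: "(real ^ 3) list \<Rightarrow> int \<Rightarrow> real ^ 3" where
  "vertex P i = P ! nat (i mod int (length P))"

definition generic_polygon :: "(real ^ 3) list \<Rightarrow> bool" where
  "generic_polygon P \<longleftrightarrow>
     (\<forall>i j k l. i < length P \<and> j < length P \<and> k < length P \<and> l < length P \<and> distinct [i, j, k, l]
        \<longrightarrow> \<not> coplanar {P ! i, P ! j, P ! k, P ! l})"

definition tangent :: "(real ^ 3) list \<Rightarrow> int \<Rightarrow> real ^ 3" where
  "tangent P i = (vertex P (i + 1) - vertex P i) /\<^sub>R norm (vertex P (i + 1) - vertex P i)"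

definition tangent_indicatrix :: "(real ^ 3) list \<Rightarrow> (real ^ 3) list" where
  "tangent_indicatrix P = map (tangent P) [0..int (length P) - 1]"

text \<open>The minimal great-circle segment joining two non-antipodal points of the unit sphere:
  the part of the great circle (the sphere intersected with the plane spanned by \<open>a\<close> and \<open>b\<close>) that lies
  in the cone over \<open>a\<close> and \<open>b\<close>. Lemma \<open>great_arc_eq_geodesic\<close> below shows that it is the shortest path
  between \<open>a\<close> and \<open>b\<close> for the angular distance on the sphere. For antipodal points, where there is no
  unique minimal segment, the value is just \<open>{a, b}\<close>; consecutive tangents of a generic polygon
  with at least four vertices are never antipodal.\<close>

definition great_arc :: "real ^ 3 \<Rightarrow> real ^ 3 \<Rightarrow> (real ^ 3) set" where
  "great_arc a b = {s *\<^sub>R a + t *\<^sub>R b | s t. 0 \<le> s \<and> 0 \<le> t} \<inter> sphere 0 1"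

definition spherical_edge :: "(real ^ 3) list \<Rightarrow> int \<Rightarrow> (real ^ 3) set" where
  "spherical_edge Q i = great_arc (vertex Q i) (vertex Q (i + 1))"

text \<open>Edges \<open>i\<close> and \<open>j\<close> coincide or are adjacent iff \<open>j - i\<close> is \<open>0\<close>, \<open>1\<close> or \<open>- 1\<close> modulo the number
  of edges.\<close>

definition no_self_intersections :: "(real ^ 3) list \<Rightarrow> bool" where
  "no_self_intersections Q \<longleftrightarrow>
     distinct Q \<and>
     (\<forall>i. spherical_edge Q i \<inter> spherical_edge Q (i + 1) = {vertex Q (i + 1)}) \<and>
     (\<forall>i j. (j - i) mod int (length Q) \<notin> {0, 1, int (length Q) - 1}
        \<longrightarrow> spherical_edge Q i \<inter> spherical_edge Q j = {})"

definition segre_polygon :: "(real ^ 3) list \<Rightarrow> bool" where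
  "segre_polygon P \<longleftrightarrow> no_self_intersections (tangent_indicatrix P)"

text \<open>\<open>p\<close> and \<open>q\<close> lie in the same open half-space bounded by the plane through \<open>a\<close>, \<open>b\<close>, \<open>c\<close>
  (which forces \<open>a\<close>, \<open>b\<close>, \<open>c\<close> not to be collinear).\<close>

definition same_side_of_plane ::
    "real ^ 3 \<Rightarrow> real ^ 3 \<Rightarrow> real ^ 3 \<Rightarrow> real ^ 3 \<Rightarrow> real ^ 3 \<Rightarrow> bool" where
  "same_side_of_plane a b c p q \<longleftrightarrow>
     (\<exists>m d. affine hull {a, b, c} = {x. m \<bullet> x = d} \<and> m \<bullet> p > d \<and> m \<bullet> q > d)"

definition flattenings :: "(real ^ 3) list \<Rightarrow> (real ^ 3) set set" where
  "flattenings P =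
     {{vertex P i, vertex P (i + 1), vertex P (i + 2)} | i.
        same_side_of_plane (vertex P i) (vertex P (i + 1)) (vertex P (i + 2))
          (vertex P (i - 1)) (vertex P (i + 3))}"

lemma great_arc_eq_geodesic:
  fixes a b :: "real ^ 3"
  assumes a: "norm a = 1" and b: "norm b = 1" and ab: "b \<noteq> - a"
  shows "great_arc a b =
    {x \<in> sphere 0 1. arccos (a \<bullet> x) + arccos (x \<bullet> b) = arccos (a \<bullet> b)}"
proof -
  define c where "c = a \<bullet> b"
  have aa: "a \<bullet> a = 1" and bb: "b \<bullet> b = 1"
    using a b by (simp_all add: norm_eq_1)
  have bnd: "- 1 \<le> y \<bullet> z \<and> y \<bullet> z \<le> 1" if "norm y = 1" "norm z = 1" for y z :: "real ^ 3"
    using Cauchy_Schwarz_ineq2[of y z] that by auto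
  have c: "- 1 \<le> c" "c \<le> 1" using bnd a b by (auto simp: c_def)
  have arcI: "x \<in> great_arc a b" if "x = s *\<^sub>R a + t *\<^sub>R b" "0 \<le> s" "0 \<le> t" "norm x = 1" for x s t
    using that by (auto simp: great_arc_def)
  have ba: "b \<bullet> a = c" by (simp add: c_def inner_commute)
  have "c \<noteq> - 1"
  proof
    assume "c = - 1"
    then have "(a + b) \<bullet> (a + b) = 0"
      by (simp add: inner_add_left inner_add_right aa bb ba c_def)
    then show False using ab by (simp add: eq_neg_iff_add_eq_0 add.commute)
  qed
  show ?thesis
  proof (cases "c = 1")
    case True
    then have "(a - b) \<bullet> (a - b) = 0"
      by (simp add: inner_diff_left inner_diff_right aa bb ba c_def)
    then have eq: "b = a" by simp
    have "x = a" if x: "x \<in> great_arc a b" for x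
    proof -
      obtain s t where st: "x = s *\<^sub>R a + t *\<^sub>R b" "0 \<le> s" "0 \<le> t" "norm x = 1"
        using x by (auto simp: great_arc_def)
      then have x': "x = (s + t) *\<^sub>R a" by (simp add: eq scaleR_left_distrib)
      then have "s + t = 1" using st a by (metis abs_of_nonneg add_nonneg_nonneg mult.right_neutral norm_scaleR)
      with x' show ?thesis by simp
    qed
    moreover have "a \<in> great_arc a b"
      using arcI[of a 1 0] a by simp
    moreover have "x = a"
      if x: "norm x = 1" "arccos (a \<bullet> x) + arccos (x \<bullet> b) = arccos (a \<bullet> b)" for x
    proof -
      have "arccos (a \<bullet> x) = 0" using x by (simp add: eq aa inner_commute)
      then have "a \<bullet> x = 1" using bnd[OF a x(1)] by (metis cos_arccos cos_zero)
      then have "(a - x) \<bullet> (a - x) = 0"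
        using x(1) by (simp add: inner_diff_left inner_diff_right aa norm_eq_1 inner_commute)
      then show ?thesis by simp
    qed
    ultimately have "great_arc a b = {a}"
      and "{x \<in> sphere 0 1. arccos (a \<bullet> x) + arccos (x \<bullet> b) = arccos (a \<bullet> b)} = {a}"
      using a by (auto simp: eq aa)
    then show ?thesis by simp
  next
    case False
    with c \<open>c \<noteq> - 1\<close> have c': "- 1 < c" "c < 1" by auto
    define r where "r = sqrt (1 - c\<^sup>2)"
    have c2: "c\<^sup>2 < 1" using c' by (simp add: abs_square_less_1 abs_less_iff)
    then have r: "0 < r" "r\<^sup>2 = 1 - c\<^sup>2" by (simp_all add: r_def)
    have sinc: "sin (arccos c) = r" using c by (simp add: sin_arccos r_def)
    have sub: "arccos (a \<bullet> x) + arccos (x \<bullet> b) = arccos c" if x: "x \<in> great_arc a b" for x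
    proof -
      obtain s t where st: "x = s *\<^sub>R a + t *\<^sub>R b" "0 \<le> s" "0 \<le> t" "norm x = 1"
        using x by (auto simp: great_arc_def)
      have ax: "a \<bullet> x = s + t * c" and xb: "x \<bullet> b = s * c + t"
        by (simp_all add: st(1) inner_add_left inner_add_right aa bb c_def)
      have "x \<bullet> x = 1" using st(4) by (simp add: norm_eq_1)
      then have one: "s\<^sup>2 + t\<^sup>2 + 2 * s * t * c = 1"
        by (simp add: st(1) inner_add_left inner_add_right aa bb ba flip: c_def)
          (simp add: power2_eq_square algebra_simps)
      have bx: "- 1 \<le> s + t * c" "s + t * c \<le> 1" "- 1 \<le> s * c + t" "s * c + t \<le> 1"
        using bnd[OF a st(4)] bnd[OF st(4) b] by (simp_all add: ax xb)
      have "1 - (s + t * c)\<^sup>2 = (t * r)\<^sup>2"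
        using one by (simp add: power_mult_distrib r(2)) (simp add: power2_eq_square algebra_simps)
      then have s1: "sin (arccos (s + t * c)) = t * r"
        using bx st r by (simp add: sin_arccos)
      have "1 - (s * c + t)\<^sup>2 = (s * r)\<^sup>2"
        using one by (simp add: power_mult_distrib r(2)) (simp add: power2_eq_square algebra_simps)
      then have s2: "sin (arccos (s * c + t)) = s * r"
        using bx st r by (simp add: sin_arccos)
      let ?g = "arccos (s + t * c) + arccos (s * c + t)"
      have "cos ?g = (s + t * c) * (s * c + t) - s * t * r\<^sup>2"
        using bx by (simp add: cos_add s1 s2 power2_eq_square)
      also have "\<dots> = c * (s\<^sup>2 + t\<^sup>2 + 2 * s * t * c)"
        unfolding r(2) by (simp add: power2_eq_square algebra_simps)
      finally have cg: "cos ?g = c" using one by simp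
      have "sin ?g = t * r * (s * c + t) + (s + t * c) * (s * r)"
        using bx by (simp add: sin_add s1 s2)
      also have "\<dots> = r * (s\<^sup>2 + t\<^sup>2 + 2 * s * t * c)"
        by (simp add: power2_eq_square algebra_simps)
      finally have "sin ?g > 0" using one r by simp
      moreover have "0 \<le> ?g" "?g \<le> 2 * pi"
        using bx arccos_lbound[of "s + t * c"] arccos_lbound[of "s * c + t"]
          arccos_ubound[of "s + t * c"] arccos_ubound[of "s * c + t"] by linarith+
      ultimately have "?g \<le> pi"
        using sin_lt_zero[of ?g] sin_two_pi by (metis less_le not_less less_irrefl)
      with \<open>0 \<le> ?g\<close> cg have "arccos c = ?g" using arccos_cos[of ?g] by metis
      then show ?thesis by (simp add: ax xb)
    qed
    have sup: "x \<in> great_arc a b"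
      if x: "norm x = 1" and e: "arccos (a \<bullet> x) + arccos (x \<bullet> b) = arccos c" for x
    proof -
      define al be where "al = arccos (a \<bullet> x)" and "be = arccos (x \<bullet> b)"
      note bx = bnd[OF a x] bnd[OF x b]
      have pos: "0 \<le> sin al" "0 \<le> sin be"
        using bx by (auto simp: al_def be_def intro!: sin_ge_zero arccos_lbound arccos_ubound)
      have ca: "cos al = a \<bullet> x" "cos be = x \<bullet> b" using bx by (simp_all add: al_def be_def)
      have abc: "al + be = arccos c" using e by (simp add: al_def be_def)
      have cc: "c = cos (al + be)" and rr: "r = sin (al + be)"
        using c sinc by (simp_all add: abc)
      define s t where "s = sin be / r" and "t = sin al / r"
      have xx: "x \<bullet> x = 1" using x by (simp add: norm_eq_1)
      have ax: "a \<bullet> x = s + t * c"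
      proof -
        have "r * cos al = sin be + sin al * c"
        proof -
          have "sin be = sin ((al + be) - al)" by simp
          also have "\<dots> = r * cos al - c * sin al" unfolding sin_diff rr cc ..
          finally show ?thesis by simp
        qed
        then show ?thesis using r by (simp add: s_def t_def ca field_simps)
      qed
      have xb: "x \<bullet> b = s * c + t"
      proof -
        have "sin al = sin ((al + be) - be)" by simp
        also have "\<dots> = r * cos be - c * sin be" unfolding sin_diff rr cc ..
        finally show ?thesis using r by (simp add: s_def t_def ca field_simps)
      qed
      have one: "s\<^sup>2 + t\<^sup>2 + 2 * s * t * c = 1"
      proof -
        have "s * cos al + t * cos be = 1"
          using r by (simp add: s_def t_def field_simps) (simp add: rr sin_add)
        then show ?thesis
          by (simp add: ca ax xb power2_eq_square algebra_simps)
      qed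
      let ?y = "s *\<^sub>R a + t *\<^sub>R b"
      have "(x - ?y) \<bullet> (x - ?y) = x \<bullet> x - 2 * (s * (a \<bullet> x) + t * (x \<bullet> b)) + ?y \<bullet> ?y"
        by (simp add: inner_diff_left inner_diff_right inner_add_left inner_add_right
            inner_commute algebra_simps)
      also have "?y \<bullet> ?y = s\<^sup>2 + t\<^sup>2 + 2 * s * t * c"
        by (simp add: inner_add_left inner_add_right aa bb ba flip: c_def)
          (simp add: power2_eq_square algebra_simps)
      also have "s * (a \<bullet> x) + t * (x \<bullet> b) = s\<^sup>2 + t\<^sup>2 + 2 * s * t * c"
        by (simp add: ax xb power2_eq_square algebra_simps)
      finally have "(x - ?y) \<bullet> (x - ?y) = 0" using one xx by simp
      then have "x = ?y" by simp
      moreover have "0 \<le> s" "0 \<le> t" using pos r by (simp_all add: s_def t_def)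
      ultimately show ?thesis using x arcI by blast
    qed
    have "x \<in> sphere 0 1" if "x \<in> great_arc a b" for x
      using that by (simp add: great_arc_def)
    then show ?thesis
      using sub sup by (auto simp flip: c_def)
  qed
qed

end

theory Submission
  imports Defs "HOL-Computational_Algebra.Polynomial"
begin

text \<open>
  Let \<open>e\<^sub>i = v\<^sub>i\<^sub>+\<^sub>1 - v\<^sub>i\<close>. A flattening is a sign change in the cyclic sequence
  \<open>det (e\<^sub>i\<^sub>-\<^sub>1, e\<^sub>i, e\<^sub>i\<^sub>+\<^sub>1)\<close>, that is, an inflection of the spherical polygon with
  vertices \<open>e\<^sub>i\<close> (taken up to positive scaling). Since the \<open>e\<^sub>i\<close> sum to zero, four of
  them have a positive linear relation once they are perturbed into general position, and a
  quadrilateral with such a relation has four inflections. Longer polygons are reduced to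
  quadrilaterals by cutting off ears: vertices \<open>v\<close> such that the triangle spanned by \<open>v\<close> and
  its two neighbours contains no other vertex. Cutting off an ear preserves simplicity and does not
  create inflections.

  The ear must be chosen such that the remaining vertices still have a positive relation. Exchanging
  a vertex shows that there are two quadruples with a positive relation which share only three
  vertices, so that four ears suffice. Four ears exist because a maximal noncrossing set of
  geodesics that contains the \<open>n\<close> edges of the polygon triangulates the sphere into
  \<open>2 n - 4\<close> triangles, whereas the edges have \<open>2 n\<close> sides. Only one inequality in this count is
  needed, and it follows by looking at the triangles that lie north or south of each vertex with
  respect to a generic pole.
\<close>

section \<open>Vectors in general position\<close>

text \<open>Genericity of the polygon makes consecutive triples of edge vectors independent, but
  other triples may be linearly dependent. This is why a perturbation is needed, and it has to
  preserve three things at once: the signs of the consecutive determinants, disjointness of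
  nonadjacent arcs, and the zero sum. The first two are open conditions; the third restricts the
  perturbation to families that themselves sum to zero. The zero sum is lost as soon as a vertex is
  cut off. What can be carried through the induction is its trace on four vertices, a relation with
  positive coefficients, and it survives exactly as long as none of the four is removed. The same
  relation puts vertices on both sides of every great circle through two of them, which gives every
  geodesic of a maximal noncrossing set a triangle on each side. No Euler formula enters: triangles
  are compared with pairs of a vertex and a pole.\<close>

definition det3 :: "real ^ 3 \<Rightarrow> real ^ 3 \<Rightarrow> real ^ 3 \<Rightarrow> real" where
  "det3 a b c = a$1 * (b$2 * c$3 - b$3 * c$2) - a$2 * (b$1 * c$3 - b$3 * c$1)
     + a$3 * (b$1 * c$2 - b$2 * c$1)"

lemma det3_add [simp]:
  "det3 (x + y) b c = det3 x b c + det3 y b c"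
  "det3 a (x + y) c = det3 a x c + det3 a y c"
  "det3 a b (x + y) = det3 a b x + det3 a b y"
  by (simp_all add: det3_def algebra_simps)

lemma det3_diff [simp]:
  "det3 (x - y) b c = det3 x b c - det3 y b c"
  "det3 a (x - y) c = det3 a x c - det3 a y c"
  "det3 a b (x - y) = det3 a b x - det3 a b y"
  by (simp_all add: det3_def algebra_simps)

lemma det3_scaleR [simp]:
  "det3 (r *\<^sub>R x) b c = r * det3 x b c"
  "det3 a (r *\<^sub>R x) c = r * det3 a x c"
  "det3 a b (r *\<^sub>R x) = r * det3 a b x"
  by (simp_all add: det3_def algebra_simps)

lemma det3_minus [simp]:
  "det3 (- x) b c = - det3 x b c" "det3 a (- x) c = - det3 a x c" "det3 a b (- x) = - det3 a b x"
  by (simp_all add: det3_def algebra_simps)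

lemma det3_zero [simp]:
  "det3 0 b c = 0" "det3 a 0 c = 0" "det3 a b 0 = 0"
  by (simp_all add: det3_def)

lemma det3_same [simp]:
  "det3 a a c = 0" "det3 a b a = 0" "det3 a b b = 0"
  by (simp_all add: det3_def algebra_simps)

lemma det3_rotate: "det3 b c a = det3 a b c"
  by (simp add: det3_def algebra_simps)

lemma det3_swap:
  "det3 b a c = - det3 a b c" "det3 a c b = - det3 a b c" "det3 c b a = - det3 a b c"
  by (simp_all add: det3_def algebra_simps)

text \<open>Each identity expands a vanishing 4x4 determinant in which one coordinate row occurs
  twice. Over plain reals it is an identity of commutative rings.\<close>

lemma cramer3_real:
  fixes a1 a2 a3 b1 b2 b3 c1 c2 c3 x1 x2 x3 :: real
  shows
  "(a1 * (b2 * c3 - b3 * c2) - a2 * (b1 * c3 - b3 * c1) + a3 * (b1 * c2 - b2 * c1)) * x1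
    = (x1 * (b2 * c3 - b3 * c2) - x2 * (b1 * c3 - b3 * c1) + x3 * (b1 * c2 - b2 * c1)) * a1
    + (a1 * (x2 * c3 - x3 * c2) - a2 * (x1 * c3 - x3 * c1) + a3 * (x1 * c2 - x2 * c1)) * b1
    + (a1 * (b2 * x3 - b3 * x2) - a2 * (b1 * x3 - b3 * x1) + a3 * (b1 * x2 - b2 * x1)) * c1"
  "(a1 * (b2 * c3 - b3 * c2) - a2 * (b1 * c3 - b3 * c1) + a3 * (b1 * c2 - b2 * c1)) * x2
    = (x1 * (b2 * c3 - b3 * c2) - x2 * (b1 * c3 - b3 * c1) + x3 * (b1 * c2 - b2 * c1)) * a2
    + (a1 * (x2 * c3 - x3 * c2) - a2 * (x1 * c3 - x3 * c1) + a3 * (x1 * c2 - x2 * c1)) * b2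
    + (a1 * (b2 * x3 - b3 * x2) - a2 * (b1 * x3 - b3 * x1) + a3 * (b1 * x2 - b2 * x1)) * c2"
  "(a1 * (b2 * c3 - b3 * c2) - a2 * (b1 * c3 - b3 * c1) + a3 * (b1 * c2 - b2 * c1)) * x3
    = (x1 * (b2 * c3 - b3 * c2) - x2 * (b1 * c3 - b3 * c1) + x3 * (b1 * c2 - b2 * c1)) * a3
    + (a1 * (x2 * c3 - x3 * c2) - a2 * (x1 * c3 - x3 * c1) + a3 * (x1 * c2 - x2 * c1)) * b3
    + (a1 * (b2 * x3 - b3 * x2) - a2 * (b1 * x3 - b3 * x1) + a3 * (b1 * x2 - b2 * x1)) * c3"
  by (simp_all add: algebra_simps)

lemma cramer3: "det3 a b c *\<^sub>R x = det3 x b c *\<^sub>R a + det3 a x c *\<^sub>R b + det3 a b x *\<^sub>R c"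
proof (rule vec_eq_iff[THEN iffD2], rule allI)
  fix i :: 3
  note * = cramer3_real[where
      ?a1.0 = "a $ 1" and ?a2.0 = "a $ 2" and ?a3.0 = "a $ 3"
      and ?b1.0 = "b $ 1" and ?b2.0 = "b $ 2" and ?b3.0 = "b $ 3"
      and ?c1.0 = "c $ 1" and ?c2.0 = "c $ 2" and ?c3.0 = "c $ 3"
      and ?x1.0 = "x $ 1" and ?x2.0 = "x $ 2" and ?x3.0 = "x $ 3",
      folded det3_def]
  have "det3 a b c * x$i = det3 x b c * a$i + det3 a x c * b$i + det3 a b x * c$i"
    using exhaust_3[of i] by (elim disjE) (simp_all only: *)
  then show "(det3 a b c *\<^sub>R x) $ i = (det3 x b c *\<^sub>R a + det3 a x c *\<^sub>R b + det3 a b x *\<^sub>R c) $ i"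
    by simp
qed

lemma coordinates:
  assumes "det3 a b c \<noteq> 0"
  shows "x = (det3 x b c / det3 a b c) *\<^sub>R a + (det3 a x c / det3 a b c) *\<^sub>R b
    + (det3 a b x / det3 a b c) *\<^sub>R c"
proof -
  have "x = (1 / det3 a b c) *\<^sub>R (det3 a b c *\<^sub>R x)" using assms by simp
  also have "\<dots> = (1 / det3 a b c) *\<^sub>R
      (det3 x b c *\<^sub>R a + det3 a x c *\<^sub>R b + det3 a b x *\<^sub>R c)"
    by (simp only: cramer3[of a b c x])
  also have "\<dots> = (det3 x b c / det3 a b c) *\<^sub>R a + (det3 a x c / det3 a b c) *\<^sub>R b
      + (det3 a b x / det3 a b c) *\<^sub>R c"
    by (simp add: scaleR_add_right)
  finally show ?thesis .
qed

lemma coordinates_obtain: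
  assumes "det3 a b c \<noteq> 0"
  obtains \<alpha> \<beta> \<gamma> where "x = \<alpha> *\<^sub>R a + \<beta> *\<^sub>R b + \<gamma> *\<^sub>R c"
  using coordinates[OF assms] by blast

text \<open>Linear rather than affine general position: no great circle contains three of the
  points.\<close>

definition general_position :: "(real ^ 3) set \<Rightarrow> bool" where
  "general_position V \<longleftrightarrow> (\<forall>a\<in>V. \<forall>b\<in>V. \<forall>c\<in>V. distinct [a, b, c] \<longrightarrow> det3 a b c \<noteq> 0)"

lemma general_positionD:
  "general_position V \<Longrightarrow> a \<in> V \<Longrightarrow> b \<in> V \<Longrightarrow> c \<in> V \<Longrightarrow> distinct [a, b, c] \<Longrightarrow> det3 a b c \<noteq> 0"
  unfolding general_position_def by blast

lemma general_position_subset: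
  "general_position V \<Longrightarrow> W \<subseteq> V \<Longrightarrow> general_position W"
  unfolding general_position_def by blast

section \<open>Crossing arcs and open triangles\<close>

text \<open>Arcs are handled as cones over unnormalised vectors, so lengths never matter. Strict
  positivity means that the interiors of the arcs meet.\<close>

definition crossing :: "real ^ 3 \<Rightarrow> real ^ 3 \<Rightarrow> real ^ 3 \<Rightarrow> real ^ 3 \<Rightarrow> bool" where
  "crossing a b c d \<longleftrightarrow> (\<exists>s t p q. 0 < s \<and> 0 < t \<and> 0 < p \<and> 0 < q \<and>
     s *\<^sub>R a + t *\<^sub>R b = p *\<^sub>R c + q *\<^sub>R d)"

lemma crossingI:
  "s *\<^sub>R a + t *\<^sub>R b = p *\<^sub>R c + q *\<^sub>R d \<Longrightarrow> 0 < s \<Longrightarrow> 0 < t \<Longrightarrow> 0 < p \<Longrightarrow> 0 < q \<Longrightarrow> crossing a b c d"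
  unfolding crossing_def by blast

lemma crossing_symD: "crossing a b c d \<Longrightarrow> crossing c d a b"
  unfolding crossing_def by (elim exE conjE, drule sym) blast

lemma crossing_sym: "crossing c d a b \<longleftrightarrow> crossing a b c d"
  using crossing_symD by blast

lemma crossing_commuteD: "crossing a b c d \<Longrightarrow> crossing b a c d"
  unfolding crossing_def by (elim exE conjE, subst (asm) add.commute) blast

lemma crossing_commute: "crossing b a c d \<longleftrightarrow> crossing a b c d"
  using crossing_commuteD by blast

lemma crossing_commute2: "crossing a b d c \<longleftrightarrow> crossing a b c d"
  using crossing_commute[of d c a b] by (simp add: crossing_sym)

text \<open>The open triangle suffices to test emptiness: in general position no further vertex lies
  on its boundary.\<close>

definition in_triangle :: "real ^ 3 \<Rightarrow> real ^ 3 \<Rightarrow> real ^ 3 \<Rightarrow> real ^ 3 \<Rightarrow> bool" where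
  "in_triangle x a b c \<longleftrightarrow> (\<exists>\<alpha> \<beta> \<gamma>. 0 < \<alpha> \<and> 0 < \<beta> \<and> 0 < \<gamma> \<and> x = \<alpha> *\<^sub>R a + \<beta> *\<^sub>R b + \<gamma> *\<^sub>R c)"

lemma in_triangle_perm:
  "in_triangle x b a c \<longleftrightarrow> in_triangle x a b c"
  "in_triangle x a c b \<longleftrightarrow> in_triangle x a b c"
proof -
  have "in_triangle x b a c" if "in_triangle x a b c" for a b c
    using that unfolding in_triangle_def
    by (elim exE conjE, subst (asm) add.commute[of "_ *\<^sub>R a"]) blast
  then show "in_triangle x b a c \<longleftrightarrow> in_triangle x a b c" by blast
  have "in_triangle x a c b" if "in_triangle x a b c" for a b c
    using that unfolding in_triangle_def add.assoc
    by (elim exE conjE, subst (asm) add.commute[of "_ *\<^sub>R b"]) blast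
  then show "in_triangle x a c b \<longleftrightarrow> in_triangle x a b c" by blast
qed

text \<open>A segment \<open>y z\<close> that meets the triangle \<open>a b c\<close> above the level \<open>\<kappa>\<close> (measured from the side
  \<open>a c\<close>) and heads upwards towards \<open>z\<close> can leave the triangle only through \<open>a b\<close> or \<open>b c\<close>.\<close>

lemma segment_exit:
  assumes w: "s *\<^sub>R y + t *\<^sub>R z = \<alpha> *\<^sub>R a + \<beta> *\<^sub>R b + \<gamma> *\<^sub>R c"
    and z: "z = \<alpha>' *\<^sub>R a + \<beta>' *\<^sub>R b + \<gamma>' *\<^sub>R c"
    and pos: "0 < s" "0 < t" "0 < \<alpha>" "0 < \<gamma>" "0 \<le> \<kappa>"
    and up: "\<kappa> * (\<alpha> + \<gamma>) \<le> \<beta>" "\<kappa> * (\<alpha>' + \<gamma>') < \<beta>'"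
    and nz: "\<alpha>' \<noteq> 0" "\<gamma>' \<noteq> 0" "det3 b y z \<noteq> 0"
    and nc: "\<not> crossing y z a b" "\<not> crossing y z b c"
  shows "0 < \<alpha>' \<and> 0 < \<gamma>'"
proof (rule ccontr)
  assume neg: "\<not> (0 < \<alpha>' \<and> 0 < \<gamma>')"
  \<comment> \<open>Walk from the common point of segment and triangle towards \<open>z\<close>; all
    three coordinates are affine in \<open>r\<close>.\<close>
  have move: "s *\<^sub>R y + (t + r) *\<^sub>R z
      = (\<alpha> + r * \<alpha>') *\<^sub>R a + (\<beta> + r * \<beta>') *\<^sub>R b + (\<gamma> + r * \<gamma>') *\<^sub>R c" for r
  proof -
    have "s *\<^sub>R y + (t + r) *\<^sub>R z = (s *\<^sub>R y + t *\<^sub>R z) + r *\<^sub>R z"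
      by (simp add: scaleR_add_left)
    also have "r *\<^sub>R z = r *\<^sub>R (\<alpha>' *\<^sub>R a + \<beta>' *\<^sub>R b + \<gamma>' *\<^sub>R c)" by (simp only: z[symmetric])
    finally show ?thesis unfolding w by (simp add: algebra_simps)
  qed
  have up': "\<kappa> * ((\<alpha> + r * \<alpha>') + (\<gamma> + r * \<gamma>')) < \<beta> + r * \<beta>'" if "0 < r" for r
  proof -
    have "r * (\<kappa> * (\<alpha>' + \<gamma>')) < r * \<beta>'" using up(2) that by simp
    then show ?thesis using up(1) by (simp add: algebra_simps)
  qed
  \<comment> \<open>Above the level \<kappa> the middle coordinate stays positive as long as the
    outer two are nonnegative, so the side \<open>a c\<close> is never the exit.\<close>
  have bpos: "0 < \<beta> + r * \<beta>'" if "0 < r" "0 \<le> \<alpha> + r * \<alpha>'" "0 \<le> \<gamma> + r * \<gamma>'" for r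
    using up'[OF that(1)] that pos(5) by (meson add_nonneg_nonneg le_less_trans mult_nonneg_nonneg)
  have A: False if r: "0 < r" "\<alpha> + r * \<alpha>' = 0" "0 < \<gamma> + r * \<gamma>'" for r
  proof -
    have "crossing y z b c"
      using move[of r] r bpos[of r] pos by (intro crossingI[of s _ "t + r" _ "\<beta> + r * \<beta>'" _ "\<gamma> + r * \<gamma>'"]) auto
    then show False using nc by blast
  qed
  have C: False if r: "0 < r" "\<gamma> + r * \<gamma>' = 0" "0 < \<alpha> + r * \<alpha>'" for r
  proof -
    have "crossing y z a b"
      using move[of r] r bpos[of r] pos by (intro crossingI[of s _ "t + r" _ "\<alpha> + r * \<alpha>'" _ "\<beta> + r * \<beta>'"]) auto
    then show False using nc by blast
  qed
  \<comment> \<open>An exit through the corner \<open>b\<close> would put \<open>b\<close> on the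
    great circle of \<open>y\<close> and \<open>z\<close>.\<close>
  have B: False if r: "0 < r" "\<gamma> + r * \<gamma>' = 0" "\<alpha> + r * \<alpha>' = 0" for r
  proof -
    have "s *\<^sub>R y + (t + r) *\<^sub>R z = (\<beta> + r * \<beta>') *\<^sub>R b" using move[of r] r by simp
    then have "det3 b y z * (\<beta> + r * \<beta>') = det3 (s *\<^sub>R y + (t + r) *\<^sub>R z) y z" by simp
    also have "\<dots> = 0" by (simp add: det3_def algebra_simps)
    finally show False using nz bpos[of r] r by simp
  qed
  \<comment> \<open>Times at which the walk reaches the great circles of \<open>b c\<close> and
    \<open>a b\<close>; if both are positive, the smaller one is the exit.\<close>
  define ra rc where "ra = - \<alpha> / \<alpha>'" and "rc = - \<gamma> / \<gamma>'"
  have ra: "\<alpha> + ra * \<alpha>' = 0" "\<alpha>' < 0 \<Longrightarrow> 0 < ra" using nz pos by (auto simp: ra_def divide_pos_neg)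
  have rc: "\<gamma> + rc * \<gamma>' = 0" "\<gamma>' < 0 \<Longrightarrow> 0 < rc" using nz pos by (auto simp: rc_def divide_pos_neg)
  consider "\<alpha>' < 0" "0 < \<gamma>'" | "0 < \<alpha>'" "\<gamma>' < 0" | "\<alpha>' < 0" "\<gamma>' < 0" using neg nz by linarith
  then show False
  proof cases
    case 1
    then show False using A[of ra] ra pos by (simp add: add_pos_pos)
  next
    case 2
    then show False using C[of rc] rc pos by (simp add: add_pos_pos)
  next
    case 3
    consider "ra < rc" | "rc < ra" | "ra = rc" by linarith
    then show False
    proof cases
      case 1
      then have "rc * \<gamma>' < ra * \<gamma>'" using 3 by simp
      then show False using A[of ra] ra rc 3 by linarith
    next
      case 2
      then have "ra * \<alpha>' < rc * \<alpha>'" using 3 by simp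
      then show False using C[of rc] ra rc 3 by linarith
    next
      case r: 3
      then show False using B[of ra] ra rc 3 by simp
    qed
  qed
qed

section \<open>Triangulations of the sphere\<close>

text \<open>\<open>spanning\<close>, applied to both orders of a pair, puts vertices on either side
  of each great circle through two of them. Restricting the last two assumptions to four distinct
  endpoints loses nothing, since general position rules out crossings of two different edges with a
  common endpoint.\<close>

locale maximal_noncrossing =
  fixes V :: "(real ^ 3) set" and M :: "(real ^ 3) set set"
  assumes finite_V: "finite V"
    and general: "general_position V"
    and spanning: "\<And>a b. a \<in> V \<Longrightarrow> b \<in> V \<Longrightarrow> a \<noteq> b \<Longrightarrow> \<exists>x\<in>V. 0 < det3 a b x"
    and edges: "\<And>e. e \<in> M \<Longrightarrow> \<exists>a b. e = {a, b}"
    and edgeD: "\<And>a b. {a, b} \<in> M \<Longrightarrow> a \<in> V \<and> b \<in> V \<and> a \<noteq> b"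
    and noncrossing_distinct:
      "\<And>a b c d. {a, b} \<in> M \<Longrightarrow> {c, d} \<in> M \<Longrightarrow> distinct [a, b, c, d] \<Longrightarrow> \<not> crossing a b c d"
    and maximal: "\<And>a b. a \<in> V \<Longrightarrow> b \<in> V \<Longrightarrow> a \<noteq> b \<Longrightarrow>
      (\<And>c d. {c, d} \<in> M \<Longrightarrow> distinct [a, b, c, d] \<Longrightarrow> \<not> crossing a b c d) \<Longrightarrow> {a, b} \<in> M"
begin

lemma edge_commute: "{a, b} \<in> M \<Longrightarrow> {b, a} \<in> M"
  by (simp add: insert_commute)

lemma general_nz: "a \<in> V \<Longrightarrow> b \<in> V \<Longrightarrow> c \<in> V \<Longrightarrow> a \<noteq> b \<Longrightarrow> a \<noteq> c \<Longrightarrow> b \<noteq> c \<Longrightarrow> det3 a b c \<noteq> 0"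
  using general_positionD[OF general, of a b c] by simp

text \<open>The relation puts \<open>q\<close> into the plane of \<open>y\<close> and
  \<open>z\<close>, where general position allows no third vertex.\<close>

lemma span_edge:
  assumes "p \<in> V" "q \<in> V" "y \<in> V" "z \<in> V" "y \<noteq> z" "p \<noteq> q" "p \<in> {y, z}"
    and "s *\<^sub>R p + t *\<^sub>R q = g *\<^sub>R y + h *\<^sub>R z" "t \<noteq> 0"
  shows "q \<in> {y, z}"
proof (rule ccontr)
  assume q: "q \<notin> {y, z}"
  have "det3 y z (s *\<^sub>R p + t *\<^sub>R q) = 0" unfolding assms(8) by simp
  moreover have "det3 y z (s *\<^sub>R p) = 0" using assms(7) by auto
  ultimately have "det3 y z q = 0" using assms(9) by (simp del: det3_scaleR) simp
  then show False using q general_nz[of y z q] assms by auto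
qed

lemma span_edge':
  assumes "p \<in> V" "q \<in> V" "y \<in> V" "z \<in> V" "y \<noteq> z" "p \<noteq> q" "p \<in> {y, z} \<or> q \<in> {y, z}"
    and "s *\<^sub>R p + t *\<^sub>R q = g *\<^sub>R y + h *\<^sub>R z" "s \<noteq> 0" "t \<noteq> 0"
  shows "{p, q} = {y, z}"
proof -
  have "t *\<^sub>R q + s *\<^sub>R p = g *\<^sub>R y + h *\<^sub>R z" using assms(8) by (simp add: add.commute)
  then have "p \<in> {y, z} \<and> q \<in> {y, z}"
    using span_edge[of p q y z s t g h] span_edge[of q p y z t s g h] assms by auto
  then show ?thesis using assms by auto
qed

lemma noncrossing:
  assumes "{a, b} \<in> M" "{c, d} \<in> M" "{a, b} \<noteq> {c, d}"
  shows "\<not> crossing a b c d"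
proof (cases "distinct [a, b, c, d]")
  case True
  then show ?thesis using noncrossing_distinct assms by blast
next
  case False
  note e = edgeD[OF assms(1)] edgeD[OF assms(2)]
  have sh: "a \<in> {c, d} \<or> b \<in> {c, d}" using False e by auto
  show ?thesis
  proof
    assume "crossing a b c d"
    then obtain s t p q where "s *\<^sub>R a + t *\<^sub>R b = p *\<^sub>R c + q *\<^sub>R d" "0 < s" "0 < t"
      unfolding crossing_def by blast
    then show False using span_edge'[of a b c d s t p q] sh e assms(3) by simp
  qed
qed

section \<open>The empty triangle on the left of an edge\<close>

text \<open>If the geodesic from \<open>b\<close> to some \<open>x\<close> on the left is missing,
  maximality provides edges that cross it. Let \<open>y z\<close> be the first one met from
  \<open>b\<close>, at the point \<open>w\<close>, with \<open>z\<close> on the left of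
  \<open>a b\<close>. Among the vertices in the triangle \<open>b w z\<close>, the one seen from
  \<open>b\<close> in the direction nearest to \<open>w\<close> can be joined to \<open>b\<close>
  without crossings.\<close>

lemma neighbour_left:
  assumes ab: "{a, b} \<in> M"
  shows "\<exists>c. {b, c} \<in> M \<and> 0 < det3 a b c"
proof -
  have abV: "a \<in> V" "b \<in> V" "a \<noteq> b" using edgeD[OF ab] by auto
  obtain x where x: "x \<in> V" "0 < det3 a b x" using spanning[OF abV] by blast
  then have xn: "x \<noteq> a" "x \<noteq> b" by auto
  show ?thesis
  proof (cases "{b, x} \<in> M")
    case True
    then show ?thesis using x by blast
  next
    case False
    define C where "C = {(y, z). {y, z} \<in> M \<and> distinct [b, x, y, z] \<and> crossing b x y z}"
    \<comment> \<open>The crossing point is \<open>b + \<tau> x\<close> up to scaling, and \<tau>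
      solves \<open>det3 (b + \<tau> x) y z = 0\<close>. \<open>C\<close> contains both orders of
      each pair, which leaves the choice of \<open>z\<close> open.\<close>
    define \<tau> where "\<tau> = (\<lambda>(y, z). - det3 b y z / det3 x y z)"
    have "C \<subseteq> V \<times> V" unfolding C_def using edgeD by auto
    then have finC: "finite C" using finite_V by (simp add: finite_subset)
    have \<tau>I: "\<tau> (y, z) = Q / P" if "(y, z) \<in> C" "P *\<^sub>R b + Q *\<^sub>R x = s *\<^sub>R y + t *\<^sub>R z" "0 < P" for y z P Q s t
    proof -
      have "det3 x y z \<noteq> 0" using that x edgeD[of y z] general_nz[of x y z] unfolding C_def by auto
      moreover have "det3 (P *\<^sub>R b + Q *\<^sub>R x) y z = 0" unfolding that(2) by (simp add: det3_rotate)
      ultimately show ?thesis using that(3) by (simp add: \<tau>_def field_simps)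
    qed
    have CI: "\<exists>s t. 0 < s \<and> 0 < t \<and> 0 < \<tau> (y, z) \<and> b + \<tau> (y, z) *\<^sub>R x = s *\<^sub>R y + t *\<^sub>R z"
      if yz: "(y, z) \<in> C" for y z
    proof -
      obtain P Q s t where *: "0 < P" "0 < Q" "0 < s" "0 < t" "P *\<^sub>R b + Q *\<^sub>R x = s *\<^sub>R y + t *\<^sub>R z"
        using yz unfolding C_def crossing_def by blast
      have "b + (Q / P) *\<^sub>R x = (1 / P) *\<^sub>R (P *\<^sub>R b + Q *\<^sub>R x)" using *(1) by (simp add: scaleR_add_right)
      also have "\<dots> = (s / P) *\<^sub>R y + (t / P) *\<^sub>R z" unfolding *(5) by (simp add: scaleR_add_right)
      finally show ?thesis using * \<tau>I[OF yz *(5,1)] by (intro exI[of _ "s / P"] exI[of _ "t / P"]) simp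
    qed
    have "C \<noteq> {}" using maximal[of b x] False abV x xn unfolding C_def by blast
    then obtain yz0 where yz0: "yz0 \<in> C" "\<And>e. e \<in> C \<Longrightarrow> \<tau> yz0 \<le> \<tau> e"
      using finC by (metis (no_types, lifting) arg_min_if_finite(1) arg_min_least)
    obtain y0 z0 where yz0': "yz0 = (y0, z0)" by (cases yz0)
    \<comment> \<open>The crossing point lies on the left of \<open>a b\<close>, hence so does at
      least one endpoint of the first crossing edge.\<close>
    obtain y z where yz: "(y, z) \<in> C" "\<And>e. e \<in> C \<Longrightarrow> \<tau> (y, z) \<le> \<tau> e" "0 < det3 a b z"
    proof -
      obtain s t where st: "0 < s" "0 < t" "0 < \<tau> (y0, z0)" "b + \<tau> (y0, z0) *\<^sub>R x = s *\<^sub>R y0 + t *\<^sub>R z0"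
        using CI yz0 yz0' by blast
      have "s * det3 a b y0 + t * det3 a b z0 = \<tau> (y0, z0) * det3 a b x"
        using arg_cong[OF st(4), of "det3 a b"] by simp
      then have "0 < s * det3 a b y0 + t * det3 a b z0" using st(3) x by simp
      then have "0 < det3 a b y0 \<or> 0 < det3 a b z0"
        using st mult_nonneg_nonpos[of s "det3 a b y0"] mult_nonneg_nonpos[of t "det3 a b z0"] by linarith
      moreover have "(z0, y0) \<in> C"
        using yz0(1) unfolding yz0' C_def by (auto simp: crossing_commute2 insert_commute)
      moreover have "\<tau> (z0, y0) = \<tau> (y0, z0)"
        unfolding \<tau>_def by (simp add: det3_swap(2)[of _ y0 z0])
      ultimately show ?thesis using that[of y0 z0] that[of z0 y0] yz0 unfolding yz0' by auto
    qed
    define \<tau>0 where "\<tau>0 = \<tau> (y, z)"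
    define w where "w = b + \<tau>0 *\<^sub>R x"
    obtain s0 t0 where w0: "0 < s0" "0 < t0" "0 < \<tau>0" "w = s0 *\<^sub>R y + t0 *\<^sub>R z"
      using CI[OF yz(1)] unfolding w_def \<tau>0_def by blast
    have yzM: "{y, z} \<in> M" and dist: "distinct [b, x, y, z]" using yz unfolding C_def by auto
    have yzV: "y \<in> V" "z \<in> V" using edgeD[OF yzM] by auto
    define \<Delta> where "\<Delta> = det3 b w z"
    have \<Delta>: "\<Delta> \<noteq> 0" unfolding \<Delta>_def w_def using w0 general_nz[of b x z] abV x yzV dist by simp
    define \<beta> \<omega> \<zeta> where "\<beta> = (\<lambda>v. det3 v w z / \<Delta>)" and "\<omega> = (\<lambda>v. det3 b v z / \<Delta>)"
      and "\<zeta> = (\<lambda>v. det3 b w v / \<Delta>)"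
    have coord: "v = \<beta> v *\<^sub>R b + \<omega> v *\<^sub>R w + \<zeta> v *\<^sub>R z" for v
      unfolding \<beta>_def \<omega>_def \<zeta>_def \<Delta>_def using coordinates \<Delta> \<Delta>_def by blast
    have lin: "\<beta> (g *\<^sub>R u + h *\<^sub>R v) = g * \<beta> u + h * \<beta> v" "\<omega> (g *\<^sub>R u + h *\<^sub>R v) = g * \<omega> u + h * \<omega> v"
      "\<zeta> (g *\<^sub>R u + h *\<^sub>R v) = g * \<zeta> u + h * \<zeta> v" for g h u v
      unfolding \<beta>_def \<omega>_def \<zeta>_def by (simp_all add: add_divide_distrib)
    have base: "\<beta> b = 1" "\<omega> b = 0" "\<zeta> b = 0" "\<beta> w = 0" "\<omega> w = 1" "\<zeta> w = 0" "\<beta> z = 0" "\<omega> z = 0" "\<zeta> z = 1"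
      unfolding \<beta>_def \<omega>_def \<zeta>_def \<Delta>_def using \<Delta>[unfolded \<Delta>_def] by simp_all
    \<comment> \<open>The triangle \<open>b w z\<close> without its side \<open>b w\<close>; the
      vertex \<open>z\<close> shows that it is inhabited.\<close>
    define X where "X = {v \<in> V. 0 \<le> \<beta> v \<and> 0 \<le> \<omega> v \<and> 0 < \<zeta> v}"
    have "finite X" "z \<in> X" unfolding X_def using finite_V yzV base by auto
    \<comment> \<open>Modulo \<open>b\<close>, the ratio \<omega>/\<zeta> is the slope of the
      direction at \<open>b\<close>, increasing from \<open>b z\<close> towards
      \<open>b w\<close>.\<close>
    then obtain v where v: "v \<in> X" "\<And>u. u \<in> X \<Longrightarrow> \<omega> u / \<zeta> u \<le> \<omega> v / \<zeta> v"
    proof -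
      have "Max ((\<lambda>u. \<omega> u / \<zeta> u) ` X) \<in> (\<lambda>u. \<omega> u / \<zeta> u) ` X"
        using \<open>finite X\<close> \<open>z \<in> X\<close> by (intro Max_in) auto
      then obtain v where "v \<in> X" "\<omega> v / \<zeta> v = Max ((\<lambda>u. \<omega> u / \<zeta> u) ` X)" by auto
      then show ?thesis using that \<open>finite X\<close> by simp
    qed
    define \<kappa> where "\<kappa> = \<omega> v / \<zeta> v"
    have vp: "v \<in> V" "0 \<le> \<beta> v" "0 \<le> \<omega> v" "0 < \<zeta> v" using v unfolding X_def by auto
    have \<kappa>: "0 \<le> \<kappa>" "\<omega> v = \<kappa> * \<zeta> v" using vp by (auto simp: \<kappa>_def)
    have vb: "v \<noteq> b" using vp base by auto
    have "det3 a b v = \<omega> v * (\<tau>0 * det3 a b x) + \<zeta> v * det3 a b z"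
      by (subst coord[of v]) (simp add: w_def)
    then have lv: "0 < det3 a b v" using vp w0 x yz by (simp add: add_nonneg_pos)
    \<comment> \<open>An edge across \<open>b v\<close> has an endpoint \<open>p\<close> on the side
      of \<open>w\<close>. Followed from the crossing towards \<open>p\<close>, it leaves the region
      between \<open>b v\<close> and \<open>b w\<close> through \<open>b w\<close>
      (\<open>i\<close>), through \<open>w z\<close> (\<open>ii\<close>), or ends in it,
      contradicting in turn the choice of the first crossing, the noncrossing property, and the
      choice of \<open>v\<close>.\<close>
    have key: False
      if pq: "{p, q} \<in> M" "distinct [b, v, p, q]" and pos: "0 < s" "0 < t" "0 < P" "0 < Q"
        and eq: "s *\<^sub>R p + t *\<^sub>R q = P *\<^sub>R b + Q *\<^sub>R v" and up: "\<kappa> * \<zeta> p < \<omega> p" for p q s t P Q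
    proof -
      have pqV: "p \<in> V" "q \<in> V" "p \<noteq> q" using edgeD[OF pq(1)] by auto
      define m where "m = P *\<^sub>R b + Q *\<^sub>R v"
      have m: "0 < \<beta> m" "\<omega> m = \<kappa> * \<zeta> m" "0 < \<zeta> m"
        unfolding m_def lin using base vp pos \<kappa> by (auto simp: add_pos_nonneg)
      have move: "(s + r) *\<^sub>R p + t *\<^sub>R q =
          (\<beta> m + r * \<beta> p) *\<^sub>R b + (\<omega> m + r * \<omega> p) *\<^sub>R w + (\<zeta> m + r * \<zeta> p) *\<^sub>R z" for r
      proof -
        have "(s + r) *\<^sub>R p + t *\<^sub>R q = m + r *\<^sub>R p" using eq by (simp add: m_def scaleR_add_left)
        also have "\<dots> = (\<beta> m *\<^sub>R b + \<omega> m *\<^sub>R w + \<zeta> m *\<^sub>R z) + r *\<^sub>R (\<beta> p *\<^sub>R b + \<omega> p *\<^sub>R w + \<zeta> p *\<^sub>R z)"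
          using coord[of m] coord[of p] by simp
        finally show ?thesis by (simp add: algebra_simps)
      qed
      have up': "\<kappa> * (\<zeta> m + r * \<zeta> p) < \<omega> m + r * \<omega> p" if "0 < r" for r
      proof -
        have "r * (\<kappa> * \<zeta> p) < r * \<omega> p" using up that by simp
        then show ?thesis using m by (simp add: algebra_simps)
      qed
      \<comment> \<open>The edge would cross \<open>b x\<close> at the parameter
        \<open>W \<tau>0 / (B + W)\<close>, which is smaller than \<tau>0.\<close>
      have i: False if r: "0 < r" "\<zeta> m + r * \<zeta> p = 0" "0 < \<beta> m + r * \<beta> p" for r
      proof -
        define B W where "B = \<beta> m + r * \<beta> p" and "W = \<omega> m + r * \<omega> p"
        have BW: "0 < B" "0 < W" using r up'[of r] by (auto simp: B_def W_def)
        have e: "(s + r) *\<^sub>R p + t *\<^sub>R q = (B + W) *\<^sub>R b + (W * \<tau>0) *\<^sub>R x"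
          using move[of r] r by (simp add: B_def W_def w_def algebra_simps)
        have "{p, q} \<noteq> {b, x}" using pq by auto
        then have "p \<notin> {b, x} \<and> q \<notin> {b, x}"
          using span_edge'[of p q b x, OF _ _ _ _ _ _ _ e] pqV abV x xn pos r by auto
        moreover have "crossing b x p q"
          using BW pos r w0 by (intro crossingI[OF e[symmetric]]) auto
        ultimately have "(p, q) \<in> C" unfolding C_def using pq(1) pqV xn by auto
        from \<tau>I[OF this e[symmetric]] yz(2)[OF this] BW
        have "\<tau>0 \<le> W * \<tau>0 / (B + W)" by (simp add: \<tau>0_def)
        then have "\<tau>0 * B \<le> 0" using BW by (simp add: field_simps)
        then show False using BW w0 by (simp add: mult_le_0_iff)
      qed
      \<comment> \<open>\<open>w z\<close> is part of the edge \<open>y z\<close>, so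
        \<open>p q\<close> must be that edge itself; but \<beta> vanishes on \<open>y z\<close> and
        is positive at \<open>m\<close>.\<close>
      have ii: False if r: "0 < r" "\<beta> m + r * \<beta> p = 0" "0 \<le> \<zeta> m + r * \<zeta> p" for r
      proof -
        define Z W where "Z = \<zeta> m + r * \<zeta> p" and "W = \<omega> m + r * \<omega> p"
        have ZW: "0 \<le> Z" "0 < W"
          using r up'[of r] mult_nonneg_nonneg[OF \<kappa>(1) r(3)] by (simp_all add: Z_def W_def)
        have e: "(s + r) *\<^sub>R p + t *\<^sub>R q = (W * s0) *\<^sub>R y + (W * t0 + Z) *\<^sub>R z"
          using move[of r] r by (simp add: Z_def W_def w0(4) algebra_simps)
        have "crossing p q y z"
          using ZW w0 pos r by (intro crossingI[OF e]) (auto simp: add_pos_nonneg)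
        then have "{p, q} = {y, z}" using noncrossing[OF pq(1) yzM] by blast
        moreover have "\<beta> y = 0"
          using lin(1)[of s0 y t0 z, folded w0(4)] w0(1) base(4,7) by simp
        ultimately have "\<beta> p = 0" "\<beta> q = 0" using base by (auto simp: doubleton_eq_iff)
        then have "\<beta> (s *\<^sub>R p + t *\<^sub>R q) = 0" by (simp add: lin)
        then show False using m unfolding eq m_def by simp
      qed
      define r\<zeta> where "r\<zeta> = - \<zeta> m / \<zeta> p"
      show False
      proof (cases "0 \<le> \<beta> p")
        case True
        consider "0 < \<zeta> p" | "\<zeta> p = 0" | "\<zeta> p < 0" by linarith
        then show False
        proof cases
          case 1
          then have "0 \<le> \<omega> p" using up \<kappa> mult_nonneg_nonneg[of \<kappa> "\<zeta> p"] by linarith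
          then have "p \<in> X" using 1 True pqV unfolding X_def by auto
          from v(2)[OF this] 1 up show False by (simp add: \<kappa>_def[symmetric] field_simps)
        next
          case 2
          \<comment> \<open>Here \<open>p\<close> lies on the great circle of \<open>b\<close> and
            \<open>x\<close>, so it is \<open>x\<close>. But \<open>x\<close> lies beyond
            \<open>w\<close>, where \<beta> is negative.\<close>
          then have "det3 b w p = 0" using \<Delta> by (simp add: \<zeta>_def)
          then have "det3 b x p = 0" using w0 by (simp add: w_def)
          then have "p = x" using general_nz[of b x p] abV x pqV xn pq by auto
          then have "0 \<le> \<tau>0 * \<beta> x" using True w0(3) by simp
          have "0 = \<beta> w" using base by simp
          also have "\<dots> = 1 + \<tau>0 * \<beta> x" using lin(1)[of 1 b \<tau>0 x] base by (simp add: w_def)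
          finally show False using \<open>0 \<le> \<tau>0 * \<beta> x\<close> by linarith
        next
          case 3
          then have "0 < r\<zeta>" "\<zeta> m + r\<zeta> * \<zeta> p = 0" using m by (auto simp: r\<zeta>_def divide_pos_neg)
          then show False using i[of r\<zeta>] m True by (simp add: add_pos_nonneg)
        qed
      next
        case False
        define r\<beta> where "r\<beta> = - \<beta> m / \<beta> p"
        have r\<beta>: "0 < r\<beta>" "\<beta> m + r\<beta> * \<beta> p = 0" using m False by (auto simp: r\<beta>_def divide_pos_neg)
        show False
        proof (cases "0 \<le> \<zeta> m + r\<beta> * \<zeta> p")
          case True
          then show False using ii[of r\<beta>] r\<beta> by blast
        next
          case f: False
          then have z: "\<zeta> p < 0" using m r\<beta> by (smt (verit) mult_nonneg_nonneg)
          then have r\<zeta>: "0 < r\<zeta>" "\<zeta> m + r\<zeta> * \<zeta> p = 0" using m by (auto simp: r\<zeta>_def divide_pos_neg)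
          have "r\<beta> * \<zeta> p < r\<zeta> * \<zeta> p" using r\<zeta> f by linarith
          then have "r\<zeta> < r\<beta>" using z by simp
          then have "r\<beta> * \<beta> p < r\<zeta> * \<beta> p" using False by simp
          then show False using i[of r\<zeta>] r\<zeta> r\<beta> by linarith
        qed
      qed
    qed
    have "\<not> crossing b v p q" if pq: "{p, q} \<in> M" "distinct [b, v, p, q]" for p q
    proof
      assume "crossing b v p q"
      then obtain P Q s t where *: "0 < P" "0 < Q" "0 < s" "0 < t" "P *\<^sub>R b + Q *\<^sub>R v = s *\<^sub>R p + t *\<^sub>R q"
        unfolding crossing_def by blast
      have pqV: "p \<in> V" "q \<in> V" using edgeD[OF pq(1)] by auto
      have "\<omega> (P *\<^sub>R b + Q *\<^sub>R v) - \<kappa> * \<zeta> (P *\<^sub>R b + Q *\<^sub>R v) = 0" unfolding lin using base \<kappa> by simp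
      then have sum: "s * (\<omega> p - \<kappa> * \<zeta> p) + t * (\<omega> q - \<kappa> * \<zeta> q) = 0"
        unfolding *(5) lin by (simp add: algebra_simps)
      have "det3 b v p = (\<omega> v * \<zeta> p - \<zeta> v * \<omega> p) * \<Delta>"
        by (subst coord[of v], subst coord[of p]) (simp add: \<Delta>_def det3_swap(2)[of b w z] algebra_simps)
      also have "\<dots> = - \<zeta> v * \<Delta> * (\<omega> p - \<kappa> * \<zeta> p)" unfolding \<kappa>(2) by (simp add: algebra_simps)
      finally have "\<omega> p - \<kappa> * \<zeta> p \<noteq> 0"
        using general_nz[of b v p] abV vp pqV pq by auto
      then consider "\<kappa> * \<zeta> p < \<omega> p" | "\<omega> p < \<kappa> * \<zeta> p" by linarith
      then show False
      proof cases
        case 1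
        then show False using key[of p q s t P Q] pq * by auto
      next
        case 2
        then have "s * (\<omega> p - \<kappa> * \<zeta> p) < 0" using * by (simp add: mult_pos_neg)
        then have "0 < t * (\<omega> q - \<kappa> * \<zeta> q)" using sum by linarith
        then have "\<kappa> * \<zeta> q < \<omega> q" using * by (simp add: zero_less_mult_iff)
        moreover have "t *\<^sub>R q + s *\<^sub>R p = P *\<^sub>R b + Q *\<^sub>R v" using * by (simp add: add.commute)
        ultimately show False using key[of q p t s P Q] pq * by (auto simp: insert_commute)
      qed
    qed
    then have "{b, v} \<in> M" using maximal[of b v] abV vp vb by blast
    then show ?thesis using lv by blast
  qed
qed

text \<open>The third corner is the neighbour of \<open>b\<close> on the left whose direction at
  \<open>b\<close> is nearest to that of \<open>a\<close>. If vertices lay inside the triangle, the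
  one closest to \<open>b\<close> could be joined to \<open>b\<close>, giving a nearer neighbour.
  Once the triangle is empty, nothing can cross \<open>a c\<close>, so maximality supplies the third
  side.\<close>

lemma triangle_left:
  assumes ab: "{a, b} \<in> M"
  shows "\<exists>c. 0 < det3 a b c \<and> {a, c} \<in> M \<and> {b, c} \<in> M \<and> (\<forall>x\<in>V. \<not> in_triangle x a b c)"
proof -
  have abV: "a \<in> V" "b \<in> V" "a \<noteq> b" using edgeD[OF ab] by auto
  define Nb where "Nb = {c. {b, c} \<in> M \<and> 0 < det3 a b c}"
  have "Nb \<subseteq> V" using edgeD unfolding Nb_def by blast
  then have finN: "finite Nb" using finite_V finite_subset by blast
  obtain c0 where c0: "c0 \<in> Nb" using neighbour_left[OF ab] unfolding Nb_def by blast
  \<comment> \<open>Modulo \<open>b\<close>, write \<open>c = x a + y c0\<close> with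
    \<open>y > 0\<close>; then \<open>g c = x / y\<close>, which is largest for the direction
    nearest to \<open>a\<close>. The neighbour \<open>c0\<close> only serves as a second basis
    vector.\<close>
  define g where "g = (\<lambda>c. det3 c b c0 / det3 a b c)"
  have "Max (g ` Nb) \<in> g ` Nb" using finN c0 by (intro Max_in) auto
  then obtain c where c: "c \<in> Nb" "g c = Max (g ` Nb)" by auto
  have gmax: "g u \<le> g c" if "u \<in> Nb" for u using that finN c(2) by simp
  define \<Delta> where "\<Delta> = det3 a b c"
  have \<Delta>: "0 < \<Delta>" and bc: "{b, c} \<in> M" using c(1) unfolding Nb_def \<Delta>_def by auto
  have cV: "c \<in> V" "c \<noteq> b" "c \<noteq> a" using edgeD[OF bc] \<Delta> unfolding \<Delta>_def by auto
  have sector: False if "{b, u} \<in> M" "u = \<alpha> *\<^sub>R a + \<beta> *\<^sub>R b + \<gamma> *\<^sub>R c" "0 < \<alpha>" "0 < \<gamma>" for u \<alpha> \<beta> \<gamma>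
  proof -
    have 1: "det3 a b u = \<gamma> * \<Delta>" unfolding that(2) by (simp add: \<Delta>_def)
    then have "0 < det3 a b u" using that \<Delta> by simp
    then have "u \<in> Nb" using that unfolding Nb_def by simp
    have 2: "det3 u b c0 = \<alpha> * det3 a b c0 + \<gamma> * det3 c b c0" unfolding that(2) by simp
    have "g u = \<alpha> * det3 a b c0 / (\<gamma> * \<Delta>) + g c"
      using that(4) \<Delta> unfolding g_def 1 2 by (simp add: \<Delta>_def[symmetric] add_divide_distrib)
    moreover have "0 < \<alpha> * det3 a b c0 / (\<gamma> * \<Delta>)" using that \<Delta> c0 unfolding Nb_def by simp
    ultimately show False using gmax[OF \<open>u \<in> Nb\<close>] by simp
  qed
  define A B C where "A = (\<lambda>v. det3 v b c / \<Delta>)" and "B = (\<lambda>v. det3 a v c / \<Delta>)"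
    and "C = (\<lambda>v. det3 a b v / \<Delta>)"
  have coord: "v = A v *\<^sub>R a + B v *\<^sub>R b + C v *\<^sub>R c" for v
    unfolding A_def B_def C_def \<Delta>_def using coordinates \<Delta> \<Delta>_def by (metis less_irrefl)
  have lin: "A (g *\<^sub>R u + h *\<^sub>R v) = g * A u + h * A v" "B (g *\<^sub>R u + h *\<^sub>R v) = g * B u + h * B v"
    "C (g *\<^sub>R u + h *\<^sub>R v) = g * C u + h * C v" for g h u v
    unfolding A_def B_def C_def by (simp_all add: add_divide_distrib)
  have base: "A a = 1" "A b = 0" "A c = 0" "B a = 0" "B b = 1" "B c = 0" "C a = 0" "C b = 0" "C c = 1"
    unfolding A_def B_def C_def using \<Delta> unfolding \<Delta>_def by simp_all
  have nz: "A v \<noteq> 0" "B v \<noteq> 0" "C v \<noteq> 0" if "v \<in> V" "v \<noteq> a" "v \<noteq> b" "v \<noteq> c" for v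
    unfolding A_def B_def C_def using \<Delta> that abV cV general_nz by auto
  have intri: "in_triangle x a b c \<longleftrightarrow> 0 < A x \<and> 0 < B x \<and> 0 < C x" for x
  proof
    assume "in_triangle x a b c"
    then obtain \<alpha> \<beta> \<gamma> where *: "0 < \<alpha>" "0 < \<beta>" "0 < \<gamma>" "x = \<alpha> *\<^sub>R a + \<beta> *\<^sub>R b + \<gamma> *\<^sub>R c"
      unfolding in_triangle_def by blast
    have "A x = \<alpha>" "B x = \<beta>" "C x = \<gamma>"
      unfolding * using lin[of 1 "\<alpha> *\<^sub>R a + \<beta> *\<^sub>R b" \<gamma> c] lin[of \<alpha> a \<beta> b] base by simp_all
    then show "0 < A x \<and> 0 < B x \<and> 0 < C x" using * by simp
  next
    assume "0 < A x \<and> 0 < B x \<and> 0 < C x"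
    then show "in_triangle x a b c" using coord[of x] unfolding in_triangle_def by blast
  qed
  have empty: "\<forall>x\<in>V. \<not> in_triangle x a b c"
  proof (rule ccontr)
    assume ne: "\<not> ?thesis"
    define X where "X = {x \<in> V. in_triangle x a b c}"
    \<comment> \<open>The height over the side \<open>a c\<close>, growing without bound towards
      \<open>b\<close>. Its level lines are great circles.\<close>
    define h where "h = (\<lambda>x. B x / (A x + C x))"
    have X: "finite X" "X \<noteq> {}" using finite_V ne unfolding X_def by auto
    then have "Max (h ` X) \<in> h ` X" by (intro Max_in) auto
    then obtain v where v: "v \<in> X" "h v = Max (h ` X)" by auto
    have hmax: "h u \<le> h v" if "u \<in> X" for u using that X v(2) by simp
    define \<kappa> where "\<kappa> = h v"
    have vp: "v \<in> V" "0 < A v" "0 < B v" "0 < C v" using v(1) unfolding X_def intri by auto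
    have vn: "v \<noteq> a" "v \<noteq> b" "v \<noteq> c" using vp base by auto
    have \<kappa>: "0 \<le> \<kappa>" "B v = \<kappa> * (A v + C v)" using vp unfolding \<kappa>_def h_def by auto
    have key: False
      if yz: "{y, z} \<in> M" "distinct [b, v, y, z]" and pos: "0 < s" "0 < t" "0 < P" "0 < Q"
        and eq: "s *\<^sub>R y + t *\<^sub>R z = P *\<^sub>R b + Q *\<^sub>R v" and up: "\<kappa> * (A z + C z) < B z" for y z s t P Q
    proof -
      have yzV: "y \<in> V" "z \<in> V" "y \<noteq> z" using edgeD[OF yz(1)] by auto
      have zn: "z \<noteq> a" "z \<noteq> c" "z \<noteq> b" using up \<kappa> base yz by auto
      have eq': "s *\<^sub>R y + t *\<^sub>R z = (Q * A v) *\<^sub>R a + (P + Q * B v) *\<^sub>R b + (Q * C v) *\<^sub>R c"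
        using coord[of "P *\<^sub>R b + Q *\<^sub>R v"] unfolding eq lin base by simp
      have "0 < A z \<and> 0 < C z"
      proof (rule segment_exit[OF eq' coord pos(1,2) _ _ \<kappa>(1) _ up])
        show "0 < Q * A v" "0 < Q * C v" using pos vp by auto
        show "\<kappa> * (Q * A v + Q * C v) \<le> P + Q * B v" using pos unfolding \<kappa>(2) by (simp add: algebra_simps)
        show "A z \<noteq> 0" "C z \<noteq> 0" using nz yzV zn by auto
        show "det3 b y z \<noteq> 0" using general_nz abV yzV yz by auto
        show "\<not> crossing y z a b" "\<not> crossing y z b c"
          using noncrossing[OF yz(1) ab] noncrossing[OF yz(1) bc] zn by auto
      qed
      moreover from this have "0 < B z" using up mult_nonneg_nonneg[OF \<kappa>(1), of "A z + C z"] by linarith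
      ultimately have "z \<in> X" using yzV unfolding X_def intri by simp
      from hmax[OF this] have "B z / (A z + C z) \<le> \<kappa>" by (simp add: \<kappa>_def h_def)
      then have "B z \<le> \<kappa> * (A z + C z)"
        using \<open>0 < A z \<and> 0 < C z\<close> by (simp add: pos_divide_le_eq)
      then show False using up by simp
    qed
    have "\<not> crossing b v y z" if yz: "{y, z} \<in> M" "distinct [b, v, y, z]" for y z
    proof
      assume "crossing b v y z"
      then obtain P Q s t where *: "0 < P" "0 < Q" "0 < s" "0 < t" "P *\<^sub>R b + Q *\<^sub>R v = s *\<^sub>R y + t *\<^sub>R z"
        unfolding crossing_def by blast
      \<comment> \<open>The functional \<open>B - \<kappa> (A + C)\<close> is 0 at \<open>v\<close>
        and 1 at \<open>b\<close>. It is therefore positive at the crossing point, hence at one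
        endpoint of the crossing edge.\<close>
      have "B (P *\<^sub>R b + Q *\<^sub>R v) - \<kappa> * (A (P *\<^sub>R b + Q *\<^sub>R v) + C (P *\<^sub>R b + Q *\<^sub>R v)) = P"
        unfolding lin using base \<kappa> by (simp add: algebra_simps)
      then have sum: "s * (B y - \<kappa> * (A y + C y)) + t * (B z - \<kappa> * (A z + C z)) = P"
        unfolding *(5) lin by (simp add: algebra_simps)
      show False
      proof (cases "\<kappa> * (A z + C z) < B z")
        case True
        then show False using key[OF yz *(3,4,1,2)] * by simp
      next
        case False
        then have "t * (B z - \<kappa> * (A z + C z)) \<le> 0" using * by (simp add: mult_le_0_iff)
        then have "0 < s * (B y - \<kappa> * (A y + C y))" using sum * by linarith
        then have "\<kappa> * (A y + C y) < B y" using * by (simp add: zero_less_mult_iff)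
        moreover have "t *\<^sub>R z + s *\<^sub>R y = P *\<^sub>R b + Q *\<^sub>R v" using * by (simp add: add.commute)
        ultimately show False using key[of z y t s P Q] yz * by (auto simp: insert_commute)
      qed
    qed
    then have "{b, v} \<in> M" using maximal[of b v] abV vp vn by blast
    then show False using sector[OF _ coord] vp by blast
  qed
  \<comment> \<open>An edge across \<open>a c\<close> has an endpoint \<open>z\<close> on the side
    of \<open>b\<close>. If \<open>z = b\<close>, its other endpoint lies in the forbidden sector at
    \<open>b\<close>; otherwise \<open>segment_exit\<close> at level 0 puts \<open>z\<close> inside
    the empty triangle.\<close>
  have key: False
    if yz: "{y, z} \<in> M" "distinct [a, c, y, z]" and pos: "0 < s" "0 < t" "0 < P" "0 < Q"
      and eq: "s *\<^sub>R y + t *\<^sub>R z = P *\<^sub>R a + Q *\<^sub>R c" and up: "0 < B z" for y z s t P Q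
  proof -
    have yzV: "y \<in> V" "z \<in> V" "y \<noteq> z" using edgeD[OF yz(1)] by auto
    have eqc: "s * A y + t * A z = P" "s * B y + t * B z = 0" "s * C y + t * C z = Q"
      using arg_cong[OF eq, of A] arg_cong[OF eq, of B] arg_cong[OF eq, of C] unfolding lin base by auto
    show False
    proof (cases "z = b")
      case True
      then have "0 < A y" "0 < C y" using eqc pos base by (auto simp: zero_less_mult_iff)
      moreover have "{b, y} \<in> M" using edge_commute[OF yz(1)] True by simp
      ultimately show False using sector[OF _ coord] by blast
    next
      case False
      have "y \<noteq> b"
      proof
        assume "y = b"
        then have "0 < s * B y + t * B z" using pos up base by (simp add: add_pos_pos)
        then show False using eqc by simp
      qed
      have zn: "z \<noteq> a" "z \<noteq> c" using yz by auto
      have eq': "s *\<^sub>R y + t *\<^sub>R z = P *\<^sub>R a + 0 *\<^sub>R b + Q *\<^sub>R c" using eq by simp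
      have "0 < A z \<and> 0 < C z"
      proof (rule segment_exit[where \<kappa> = 0, OF eq' coord pos])
        show "A z \<noteq> 0" "C z \<noteq> 0" using nz yzV zn False by auto
        show "det3 b y z \<noteq> 0" using general_nz abV yzV \<open>y \<noteq> b\<close> False by auto
        show "\<not> crossing y z a b" "\<not> crossing y z b c"
          using noncrossing[OF yz(1) ab] noncrossing[OF yz(1) bc] zn False by auto
      qed (use up in auto)
      then show False using empty yzV up intri by blast
    qed
  qed
  have "\<not> crossing a c y z" if yz: "{y, z} \<in> M" "distinct [a, c, y, z]" for y z
  proof
    assume "crossing a c y z"
    then obtain P Q s t where *: "0 < P" "0 < Q" "0 < s" "0 < t" "P *\<^sub>R a + Q *\<^sub>R c = s *\<^sub>R y + t *\<^sub>R z"
      unfolding crossing_def by blast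
    have sum: "s * B y + t * B z = 0"
      using arg_cong[OF *(5), of B] unfolding lin base by auto
    have "z \<in> V" using edgeD[OF yz(1)] by auto
    then have "B z \<noteq> 0" using nz(2)[of z] yz base by (cases "z = b") auto
    show False
    proof (cases "0 < B z")
      case True
      then show False using key[OF yz *(3,4,1,2)] * by simp
    next
      case False
      then have "t * B z < 0" using * \<open>B z \<noteq> 0\<close> by (simp add: mult_less_0_iff)
      then have "0 < s * B y" using sum * by linarith
      then have "0 < B y" using * by (simp add: zero_less_mult_iff)
      moreover have "t *\<^sub>R z + s *\<^sub>R y = P *\<^sub>R a + Q *\<^sub>R c" using * by (simp add: add.commute)
      ultimately show False using key[of z y t s P Q] yz * by (auto simp: insert_commute)
    qed
  qed
  then have "{a, c} \<in> M" using maximal[of a c] abV cV by blast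
  then show ?thesis using empty bc \<Delta> unfolding \<Delta>_def by blast
qed

section \<open>Incidence of edges, triangles and directions at a vertex\<close>

definition triangle :: "real ^ 3 \<Rightarrow> real ^ 3 \<Rightarrow> real ^ 3 \<Rightarrow> bool" where
  "triangle a b c \<longleftrightarrow> {a, b} \<in> M \<and> {a, c} \<in> M \<and> {b, c} \<in> M \<and> (\<forall>x\<in>V. \<not> in_triangle x a b c)"

lemma triangle_perm:
  "triangle b a c \<longleftrightarrow> triangle a b c"
  "triangle a c b \<longleftrightarrow> triangle a b c"
  unfolding triangle_def by (auto simp: in_triangle_perm insert_commute)

lemma triangle_V: "triangle a b c \<Longrightarrow> a \<in> V \<and> b \<in> V \<and> c \<in> V \<and> a \<noteq> b \<and> a \<noteq> c \<and> b \<noteq> c"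
  unfolding triangle_def using edgeD by blast

text \<open>In the basis \<open>a\<close>, \<open>b\<close>, \<open>c\<close> the vertex
  \<open>d\<close> has \<gamma> > 0. The signs of \<alpha> and \<beta> leave four cases:
  \<open>d\<close> inside \<open>a b c\<close>, \<open>d b\<close> across \<open>a c\<close>,
  \<open>d a\<close> across \<open>b c\<close>, or \<open>c\<close> inside
  \<open>a b d\<close>.\<close>

lemma triangle_unique:
  assumes t: "triangle a b c" "triangle a b d" and pos: "0 < det3 a b c" "0 < det3 a b d"
  shows "c = d"
proof (rule ccontr)
  assume "c \<noteq> d"
  note V = triangle_V[OF t(1)] triangle_V[OF t(2)]
  define \<alpha> \<beta> \<gamma> where "\<alpha> = det3 d b c / det3 a b c" and "\<beta> = det3 a d c / det3 a b c"
    and "\<gamma> = det3 a b d / det3 a b c"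
  have d: "d = \<alpha> *\<^sub>R a + \<beta> *\<^sub>R b + \<gamma> *\<^sub>R c"
    using coordinates[of a b c d] pos unfolding \<alpha>_def \<beta>_def \<gamma>_def by simp
  have \<gamma>: "0 < \<gamma>" using pos unfolding \<gamma>_def by simp
  have nz: "\<alpha> \<noteq> 0" "\<beta> \<noteq> 0"
    using V \<open>c \<noteq> d\<close> pos general_nz[of d b c] general_nz[of a d c] unfolding \<alpha>_def \<beta>_def by auto
  have e: "{a, b} \<in> M" "{a, c} \<in> M" "{b, c} \<in> M" "{d, a} \<in> M" "{d, b} \<in> M"
    using t unfolding triangle_def by (auto simp: insert_commute)
  consider "0 < \<alpha>" "0 < \<beta>" | "0 < \<alpha>" "\<beta> < 0" | "\<alpha> < 0" "0 < \<beta>" | "\<alpha> < 0" "\<beta> < 0" using nz by linarith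
  then show False
  proof cases
    case 1
    then have "in_triangle d a b c" unfolding in_triangle_def using d \<gamma> by blast
    then show False using t V unfolding triangle_def by blast
  next
    case 2
    have "1 *\<^sub>R d + (- \<beta>) *\<^sub>R b = \<alpha> *\<^sub>R a + \<gamma> *\<^sub>R c" using d by (simp add: algebra_simps)
    then have "crossing d b a c" by (rule crossingI) (use 2 \<gamma> in auto)
    then show False using noncrossing[OF e(5,2)] V \<open>c \<noteq> d\<close> by (auto simp: doubleton_eq_iff)
  next
    case 3
    have "1 *\<^sub>R d + (- \<alpha>) *\<^sub>R a = \<beta> *\<^sub>R b + \<gamma> *\<^sub>R c" using d by (simp add: algebra_simps)
    then have "crossing d a b c" by (rule crossingI) (use 3 \<gamma> in auto)
    then show False using noncrossing[OF e(4,3)] V \<open>c \<noteq> d\<close> by (auto simp: doubleton_eq_iff)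
  next
    case 4
    have "\<gamma> *\<^sub>R c = (- \<alpha>) *\<^sub>R a + (- \<beta>) *\<^sub>R b + 1 *\<^sub>R d" using d by (simp add: algebra_simps)
    then have "(1 / \<gamma>) *\<^sub>R \<gamma> *\<^sub>R c = (1 / \<gamma>) *\<^sub>R ((- \<alpha>) *\<^sub>R a + (- \<beta>) *\<^sub>R b + 1 *\<^sub>R d)" by simp
    then have "c = (- \<alpha> / \<gamma>) *\<^sub>R a + (- \<beta> / \<gamma>) *\<^sub>R b + (1 / \<gamma>) *\<^sub>R d"
      using \<gamma> by (simp add: scaleR_add_right scaleR_diff_right)
    moreover have "0 < - \<alpha> / \<gamma>" "0 < - \<beta> / \<gamma>" "0 < 1 / \<gamma>" using 4 \<gamma> by (simp_all add: divide_neg_pos)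
    ultimately have "in_triangle c a b d" unfolding in_triangle_def by blast
    then show False using t V unfolding triangle_def by blast
  qed
qed

text \<open>Unordered vertex sets, so that the six orders of the corners count as one
  triangle.\<close>

definition triangles :: "(real ^ 3) set set" where
  "triangles = {{a, b, c} | a b c. triangle a b c}"

lemma triangles_edge:
  assumes "t \<in> triangles" "a \<in> t" "b \<in> t" "a \<noteq> b"
  shows "\<exists>c. t = {a, b, c} \<and> triangle a b c"
proof -
  obtain x y z where t: "t = {x, y, z}" "triangle x y z" using assms unfolding triangles_def by blast
  have p: "triangle x z y" "triangle y x z" "triangle y z x" "triangle z x y" "triangle z y x"
    using t(2) triangle_perm by blast+
  have "(a, b) \<in> {(x, y), (x, z), (y, x), (y, z), (z, x), (z, y)}"
    using assms unfolding t(1) by auto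
  then show ?thesis
    by (elim insertE emptyE) (use t p in \<open>auto simp: insert_commute intro: exI[of _ x] exI[of _ y] exI[of _ z]\<close>)
qed

lemma triangles_subset: "triangles \<subseteq> Pow V"
  unfolding triangles_def using triangle_V by blast

lemma finite_triangles: "finite triangles"
  using triangles_subset finite_V finite_subset by blast

lemma triangle_left_ex:
  assumes "{a, b} \<in> M"
  obtains c where "triangle a b c" "0 < det3 a b c"
  using triangle_left[OF assms] assms unfolding triangle_def by blast

text \<open>One triangle on the left of \<open>a b\<close> and one on the left of
  \<open>b a\<close>, each by existence and uniqueness.\<close>

lemma card_triangles_edge:
  assumes ab: "{a, b} \<in> M"
  shows "card {t \<in> triangles. {a, b} \<subseteq> t} = 2"
proof -
  obtain c where c: "triangle a b c" "0 < det3 a b c" using triangle_left_ex[OF ab] by blast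
  obtain d where d: "triangle b a d" "0 < det3 b a d" using triangle_left_ex[OF edge_commute[OF ab]] by blast
  have neg: "det3 a b d < 0" using d(2) det3_swap(1)[of a b d] by simp
  have cd: "c \<noteq> d" using neg c by auto
  note V = triangle_V[OF c(1)] triangle_V[OF d(1)]
  have "{t \<in> triangles. {a, b} \<subseteq> t} = {{a, b, c}, {a, b, d}}"
  proof (intro set_eqI iffI)
    fix t assume "t \<in> {t \<in> triangles. {a, b} \<subseteq> t}"
    then obtain e where e: "t = {a, b, e}" "triangle a b e"
      using triangles_edge[of t a b] V by auto
    have "det3 a b e \<noteq> 0" using general_nz triangle_V[OF e(2)] by blast
    then consider "0 < det3 a b e" | "det3 a b e < 0" by linarith
    then have "e = c \<or> e = d"
    proof cases
      case 1
      then show ?thesis using triangle_unique[OF e(2) c(1)] c by simp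
    next
      case 2
      then have "0 < det3 b a e" using det3_swap(1)[of a b e] by simp
      then show ?thesis using triangle_unique[of b a e d] e(2) d triangle_perm by blast
    qed
    then show "t \<in> {{a, b, c}, {a, b, d}}" using e by blast
  next
    fix t assume "t \<in> {{a, b, c}, {a, b, d}}"
    moreover have "{a, b, c} \<in> triangles" using c unfolding triangles_def by blast
    moreover have "{a, b, d} \<in> triangles" using d triangle_perm unfolding triangles_def by blast
    ultimately show "t \<in> {t \<in> triangles. {a, b} \<subseteq> t}" by auto
  qed
  moreover have "{a, b, c} \<noteq> {a, b, d}" using cd V by auto
  ultimately show ?thesis by simp
qed

text \<open>\<open>germ N v t\<close>: moving from the vertex \<open>v\<close> of \<open>t\<close> a little in direction \<open>N\<close> leads into \<open>t\<close>.\<close>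

definition germ :: "real ^ 3 \<Rightarrow> real ^ 3 \<Rightarrow> (real ^ 3) set \<Rightarrow> bool" where
  "germ N v t \<longleftrightarrow> (\<exists>a b \<rho> \<alpha> \<beta>. t = {v, a, b} \<and> triangle v a b \<and> 0 < \<alpha> \<and> 0 < \<beta>
     \<and> N = \<rho> *\<^sub>R v + \<alpha> *\<^sub>R a + \<beta> *\<^sub>R b)"

text \<open>An edge from \<open>v\<close> that starts between \<open>a\<close> and \<open>b\<close>
  either ends inside the triangle or leaves it across \<open>a b\<close>.\<close>

lemma sector_empty:
  assumes t: "triangle v a b" and c: "{v, c} \<in> M" and pos: "0 < det3 v a b" "0 < det3 v a c" "0 < det3 v c b"
  shows False
proof -
  define \<rho> \<alpha> \<beta> where "\<rho> = det3 c a b / det3 v a b" and "\<alpha> = det3 v c b / det3 v a b"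
    and "\<beta> = det3 v a c / det3 v a b"
  have ceq: "c = \<rho> *\<^sub>R v + \<alpha> *\<^sub>R a + \<beta> *\<^sub>R b"
    using coordinates[of v a b c] pos unfolding \<rho>_def \<alpha>_def \<beta>_def by simp
  have p: "0 < \<alpha>" "0 < \<beta>" unfolding \<alpha>_def \<beta>_def using pos by auto
  have V: "v \<in> V" "a \<in> V" "b \<in> V" "c \<in> V" "v \<noteq> a" "v \<noteq> b" "a \<noteq> b" "v \<noteq> c"
    using triangle_V[OF t] edgeD[OF c] by auto
  have n: "c \<noteq> a" "c \<noteq> b" using pos by auto
  have "\<rho> \<noteq> 0" unfolding \<rho>_def using general_nz[of c a b] V n pos by simp
  then consider "0 < \<rho>" | "\<rho> < 0" by linarith
  then show False
  proof cases
    case 1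
    then have "in_triangle c v a b" unfolding in_triangle_def using ceq p by blast
    then show False using t V unfolding triangle_def by blast
  next
    case 2
    have "(- \<rho>) *\<^sub>R v + 1 *\<^sub>R c = \<alpha> *\<^sub>R a + \<beta> *\<^sub>R b" using ceq by (simp add: algebra_simps)
    then have "crossing v c a b" by (rule crossingI) (use 2 p in auto)
    then show False using noncrossing[OF c, of a b] t V n unfolding triangle_def by (auto simp: doubleton_eq_iff)
  qed
qed

lemma germ_oriented:
  assumes "germ N v t"
  obtains a b where "t = {v, a, b}" "triangle v a b" "0 < det3 v a b" "0 < det3 v a N" "0 < det3 v N b"
proof -
  obtain a b \<rho> \<alpha> \<beta> where *: "t = {v, a, b}" "triangle v a b" "0 < \<alpha>" "0 < \<beta>"
      "N = \<rho> *\<^sub>R v + \<alpha> *\<^sub>R a + \<beta> *\<^sub>R b"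
    using assms unfolding germ_def by blast
  have "det3 v a b \<noteq> 0" using triangle_V[OF *(2)] general_nz by blast
  then consider "0 < det3 v a b" | "0 < det3 v b a" using det3_swap(2)[of v a b] by linarith
  then show ?thesis
  proof cases
    case 1
    then show ?thesis using that[of a b] * by simp
  next
    case 2
    then show ?thesis using that[of b a] * triangle_perm by (simp add: insert_commute)
  qed
qed

text \<open>The three-term Pluecker relation for the directions \<open>a\<close>, \<open>N\<close>,
  \<open>c\<close>, \<open>b\<close> modulo \<open>v\<close>.\<close>

lemma plane_relation:
  "det3 v a N * det3 v c b = det3 v a c * det3 v N b + det3 v a b * det3 v c N"
proof -
  have "det3 v a (det3 v N b *\<^sub>R c) = det3 v a (det3 c N b *\<^sub>R v + det3 v c b *\<^sub>R N + det3 v N c *\<^sub>R b)"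
    by (simp only: cramer3[of v N b c])
  then show ?thesis by (simp add: det3_swap(2)[of v c N] algebra_simps)
qed

text \<open>Both triangles fill a sector at \<open>v\<close> that contains the direction
  \<open>N\<close>. If the sectors began at different neighbours, the later of these would point
  strictly into the other sector, contrary to \<open>sector_empty\<close>; with equal beginnings the
  same holds for the ends.\<close>

lemma germ_unique:
  assumes "germ N v t" "germ N v t'"
  shows "t = t'"
proof -
  obtain a b where 1: "t = {v, a, b}" "triangle v a b" "0 < det3 v a b" "0 < det3 v a N" "0 < det3 v N b"
    using germ_oriented[OF assms(1)] by blast
  obtain c d where 2: "t' = {v, c, d}" "triangle v c d" "0 < det3 v c d" "0 < det3 v c N" "0 < det3 v N d"
    using germ_oriented[OF assms(2)] by blast
  have first: False
    if "triangle v a b" "triangle v c d" "0 < det3 v a b" "0 < det3 v a N" "0 < det3 v N b"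
      "0 < det3 v c N" "0 < det3 v a c" for a b c d
  proof -
    have "0 < det3 v a c * det3 v N b + det3 v a b * det3 v c N" using that by (simp add: add_pos_pos)
    then have "0 < det3 v a N * det3 v c b" by (simp only: plane_relation[of v a N c b])
    then have "0 < det3 v c b" using that by (simp add: zero_less_mult_iff)
    moreover have "{v, c} \<in> M" using that unfolding triangle_def by blast
    ultimately show False using sector_empty that by blast
  qed
  note V = triangle_V[OF 1(2)] triangle_V[OF 2(2)]
  have "\<not> 0 < det3 v a c" using first[OF 1(2) 2(2)] 1 2 by blast
  moreover have "\<not> 0 < det3 v c a" using first[OF 2(2) 1(2)] 1 2 by blast
  ultimately have "det3 v a c = 0" using det3_swap(2)[of v a c] by linarith
  then have ac: "a = c" using general_nz[of v a c] V by blast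
  have "b = d"
  proof (rule ccontr)
    assume "b \<noteq> d"
    then have "det3 v b d \<noteq> 0" using general_nz[of v b d] V by blast
    then consider "0 < det3 v b d" | "0 < det3 v d b" using det3_swap(2)[of v b d] by linarith
    then show False
    proof cases
      case bd: 1
      have "{v, b} \<in> M" using 1(2) unfolding triangle_def by blast
      from sector_empty[OF 2(2) this 2(3) _ bd] 1(3) show False unfolding ac by blast
    next
      case db: 2
      have "{v, d} \<in> M" using 2(2) unfolding triangle_def by blast
      from sector_empty[OF 1(2) this 1(3) _ db] 2(3) show False unfolding ac by blast
    qed
  qed
  then show ?thesis using ac 1 2 by simp
qed

definition generic_direction :: "real ^ 3 \<Rightarrow> bool" where
  "generic_direction N \<longleftrightarrow> (\<forall>a\<in>V. \<forall>b\<in>V. a \<noteq> b \<longrightarrow> det3 N a b \<noteq> 0)"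

lemma generic_directionD:
  "generic_direction N \<Longrightarrow> a \<in> V \<Longrightarrow> b \<in> V \<Longrightarrow> a \<noteq> b \<Longrightarrow> det3 N a b \<noteq> 0"
  unfolding generic_direction_def by blast

text \<open>The moment curve meets every plane in finitely many points.\<close>

lemma generic_direction_exists: "\<exists>N. generic_direction N"
proof -
  define N where "N = (\<lambda>x. vector [1, x, x\<^sup>2] :: real ^ 3)"
  have fin: "finite {x. det3 (N x) a b = 0}" if ab: "a \<in> V" "b \<in> V" "a \<noteq> b" for a b
  proof -
    define p where "p = [:a$2 * b$3 - a$3 * b$2, - (a$1 * b$3 - a$3 * b$1), a$1 * b$2 - a$2 * b$1:]"
    obtain x where "0 < det3 a b x" using spanning[OF ab] by blast
    then have "det3 x a b \<noteq> 0" using det3_rotate[of a b x] by simp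
    then have "p \<noteq> 0" unfolding det3_def p_def by auto
    moreover have "{x. det3 (N x) a b = 0} = {x. poly p x = 0}"
      unfolding det3_def p_def N_def by (simp add: algebra_simps power2_eq_square)
    ultimately show ?thesis using poly_roots_finite by simp
  qed
  have "finite (\<Union>(a, b)\<in>{(a, b). a \<in> V \<and> b \<in> V \<and> a \<noteq> b}. {x. det3 (N x) a b = 0})"
  proof (rule finite_UN_I)
    show "finite {(a, b). a \<in> V \<and> b \<in> V \<and> a \<noteq> b}"
      by (rule finite_subset[of _ "V \<times> V"]) (use finite_V in auto)
  qed (use fin in auto)
  then obtain x where "x \<notin> (\<Union>(a, b)\<in>{(a, b). a \<in> V \<and> b \<in> V \<and> a \<noteq> b}. {x. det3 (N x) a b = 0})"
    using ex_new_if_finite infinite_UNIV_char_0 by blast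
  then show ?thesis unfolding generic_direction_def by blast
qed

text \<open>Walk from a point of an edge towards \<open>N\<close>: beyond the last edge that is met lies a triangle
  which is never left again.\<close>

lemma triangle_containing:
  assumes N: "generic_direction N" and e0: "{a0, b0} \<in> M"
  shows "\<exists>a b c. triangle a b c \<and> in_triangle N a b c"
proof -
  have V0: "a0 \<in> V" "b0 \<in> V" "a0 \<noteq> b0" using edgeD[OF e0] by auto
  \<comment> \<open>The starting point slides along the edge until the great circle of the walk
    misses all vertices; each vertex excludes at most one \<epsilon>.\<close>
  obtain \<epsilon> where \<epsilon>: "0 < \<epsilon>" "\<And>v. v \<in> V \<Longrightarrow> det3 (a0 + \<epsilon> *\<^sub>R b0) N v \<noteq> 0"
  proof -
    have "infinite ({0<..} - (\<lambda>v. - det3 a0 N v / det3 b0 N v) ` V :: real set)"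
      using finite_V infinite_Ioi by (simp add: Diff_infinite_finite)
    then obtain \<epsilon> where "\<epsilon> \<in> {0<..} - (\<lambda>v. - det3 a0 N v / det3 b0 N v) ` V"
      using infinite_imp_nonempty by blast
    then have e: "0 < \<epsilon>" "\<epsilon> \<notin> (\<lambda>v. - det3 a0 N v / det3 b0 N v) ` V" by auto
    have "det3 (a0 + \<epsilon> *\<^sub>R b0) N v \<noteq> 0" if v: "v \<in> V" for v
    proof (cases "v = b0")
      case True
      have "det3 a0 N b0 \<noteq> 0" using generic_directionD[OF N V0] det3_swap(1)[of N a0 b0] by simp
      then show ?thesis using True by simp
    next
      case False
      have "det3 b0 N v \<noteq> 0" using generic_directionD[OF N V0(2) v] False det3_swap(1)[of N b0 v] by auto
      moreover have "\<epsilon> \<noteq> - det3 a0 N v / det3 b0 N v" using e v by blast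
      ultimately show ?thesis by (simp add: field_simps)
    qed
    then show ?thesis using that e by blast
  qed
  define p where "p = a0 + \<epsilon> *\<^sub>R b0"
  \<comment> \<open>Times at which the walk meets the interior of an edge. \<open>T\<close> is
    finite since \<open>N\<close> lies off the great circle of every edge, which is therefore met at
    most once.\<close>
  define T where "T = {\<tau>. 0 \<le> \<tau> \<and> (\<exists>a b \<alpha> \<beta>. {a, b} \<in> M \<and> 0 < \<alpha> \<and> 0 < \<beta> \<and> p + \<tau> *\<^sub>R N = \<alpha> *\<^sub>R a + \<beta> *\<^sub>R b)}"
  have "T \<subseteq> (\<lambda>(a, b). - det3 p a b / det3 N a b) ` (V \<times> V)"
  proof
    fix \<tau> assume "\<tau> \<in> T"
    then obtain a b \<alpha> \<beta> where *: "{a, b} \<in> M" "p + \<tau> *\<^sub>R N = \<alpha> *\<^sub>R a + \<beta> *\<^sub>R b" unfolding T_def by blast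
    have V: "a \<in> V" "b \<in> V" "a \<noteq> b" using edgeD[OF *(1)] by auto
    have "det3 (p + \<tau> *\<^sub>R N) a b = 0" unfolding *(2) by simp
    then have "\<tau> = - det3 p a b / det3 N a b" using generic_directionD[OF N V] by (simp add: field_simps)
    then show "\<tau> \<in> (\<lambda>(a, b). - det3 p a b / det3 N a b) ` (V \<times> V)" using V by auto
  qed
  then have finT: "finite T" using finite_V by (meson finite_SigmaI finite_imageI finite_subset)
  have TI: "\<sigma> \<in> T" if "0 \<le> \<sigma>" "{a, b} \<in> M" "0 < \<alpha>" "0 < \<beta>" "p + \<sigma> *\<^sub>R N = \<alpha> *\<^sub>R a + \<beta> *\<^sub>R b" for \<sigma> a b \<alpha> \<beta>
    unfolding T_def using that by blast
  \<comment> \<open>Starting on an edge guarantees that a last meeting exists.\<close>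
  have "0 \<in> T" by (rule TI[OF _ e0, of _ 1 \<epsilon>]) (use \<epsilon>(1) in \<open>auto simp: p_def\<close>)
  define \<tau> where "\<tau> = Max T"
  have "\<tau> \<in> T" unfolding \<tau>_def by (rule Max_in[OF finT]) (use \<open>0 \<in> T\<close> in auto)
  have max: "\<And>\<sigma>. \<sigma> \<in> T \<Longrightarrow> \<sigma> \<le> \<tau>" unfolding \<tau>_def using finT by simp
  \<comment> \<open>Orient the last edge so that the walk continues into its left triangle.\<close>
  obtain a b \<alpha> \<beta> where \<tau>: "0 \<le> \<tau>" "{a, b} \<in> M" "0 < \<alpha>" "0 < \<beta>"
    "p + \<tau> *\<^sub>R N = \<alpha> *\<^sub>R a + \<beta> *\<^sub>R b" "0 < det3 a b N"
  proof -
    obtain a b \<alpha> \<beta> where *: "0 \<le> \<tau>" "{a, b} \<in> M" "0 < \<alpha>" "0 < \<beta>" "p + \<tau> *\<^sub>R N = \<alpha> *\<^sub>R a + \<beta> *\<^sub>R b"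
      using \<open>\<tau> \<in> T\<close> unfolding T_def by blast
    have "det3 a b N \<noteq> 0" using generic_directionD[OF N, of a b] edgeD[OF *(2)] det3_rotate[of a b N] by auto
    then consider "0 < det3 a b N" | "0 < det3 b a N" using det3_swap(1)[of a b N] by linarith
    then show ?thesis
    proof cases
      case 1
      then show ?thesis using that * by blast
    next
      case 2
      then show ?thesis using that[of b a \<beta> \<alpha>] * by (simp add: insert_commute add.commute)
    qed
  qed
  obtain c where c: "triangle a b c" "0 < det3 a b c" using triangle_left_ex[OF \<tau>(2)] by blast
  note V = triangle_V[OF c(1)]
  have edges: "{b, c} \<in> M" "{a, c} \<in> M" using c unfolding triangle_def by auto
  define n1 n2 n3 where "n1 = det3 N b c / det3 a b c" and "n2 = det3 a N c / det3 a b c"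
    and "n3 = det3 a b N / det3 a b c"
  have Neq: "N = n1 *\<^sub>R a + n2 *\<^sub>R b + n3 *\<^sub>R c"
    using coordinates[of a b c N] c unfolding n1_def n2_def n3_def by simp
  have n3: "0 < n3" unfolding n3_def using c \<tau> by simp
  have nz: "n1 \<noteq> 0" "n2 \<noteq> 0" unfolding n1_def n2_def
    using c V generic_directionD[OF N, of b c] generic_directionD[OF N, of a c] det3_swap(1)[of a N c] by auto
  have move: "p + (\<tau> + r) *\<^sub>R N = (\<alpha> + r * n1) *\<^sub>R a + (\<beta> + r * n2) *\<^sub>R b + (r * n3) *\<^sub>R c" for r
  proof -
    have "p + (\<tau> + r) *\<^sub>R N = (p + \<tau> *\<^sub>R N) + r *\<^sub>R N" by (simp add: scaleR_add_left)
    also have "r *\<^sub>R N = r *\<^sub>R (n1 *\<^sub>R a + n2 *\<^sub>R b + n3 *\<^sub>R c)" by (simp only: Neq[symmetric])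
    finally show ?thesis unfolding \<tau>(5) by (simp add: algebra_simps)
  qed
  \<comment> \<open>\<open>A\<close>, \<open>B\<close> and \<open>C\<close> treat an exit through
    \<open>b c\<close>, through \<open>a c\<close> and through the corner \<open>c\<close>. The
    first two give a meeting after the last one, the third contradicts the choice of
    \<epsilon>.\<close>
  have A: False if r: "0 < r" "\<alpha> + r * n1 = 0" "0 < \<beta> + r * n2" for r
  proof -
    have "\<tau> + r \<in> T"
      by (rule TI[OF _ edges(1), of _ "\<beta> + r * n2" "r * n3"]) (use move[of r] r \<tau>(1) n3 in auto)
    then show False using max r by force
  qed
  have B: False if r: "0 < r" "\<beta> + r * n2 = 0" "0 < \<alpha> + r * n1" for r
  proof -
    have "\<tau> + r \<in> T"
      by (rule TI[OF _ edges(2), of _ "\<alpha> + r * n1" "r * n3"]) (use move[of r] r \<tau>(1) n3 in auto)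
    then show False using max r by force
  qed
  have C: False if r: "\<alpha> + r * n1 = 0" "\<beta> + r * n2 = 0" for r
  proof -
    have "det3 (p + (\<tau> + r) *\<^sub>R N) N c = 0" unfolding move using r by simp
    then have "det3 p N c = 0" by simp
    then show False using \<epsilon>(2)[of c] V unfolding p_def by simp
  qed
  define ra rb where "ra = - \<alpha> / n1" and "rb = - \<beta> / n2"
  have ra: "\<alpha> + ra * n1 = 0" "n1 < 0 \<Longrightarrow> 0 < ra" using nz \<tau> by (auto simp: ra_def divide_pos_neg)
  have rb: "\<beta> + rb * n2 = 0" "n2 < 0 \<Longrightarrow> 0 < rb" using nz \<tau> by (auto simp: rb_def divide_pos_neg)
  consider "0 < n1" "0 < n2" | "n1 < 0" "0 < n2" | "0 < n1" "n2 < 0" | "n1 < 0" "n2 < 0" using nz by linarith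
  then show ?thesis
  proof cases
    case 1
    then show ?thesis using c(1) Neq n3 unfolding in_triangle_def by blast
  next
    case 2
    then show ?thesis using A[of ra] ra \<tau> by (simp add: add_pos_pos)
  next
    case 3
    then show ?thesis using B[of rb] rb \<tau> by (simp add: add_pos_pos)
  next
    case 4
    consider "ra < rb" | "rb < ra" | "ra = rb" by linarith
    then show ?thesis
    proof cases
      case 1
      then have "rb * n2 < ra * n2" using 4 by simp
      then have False using A[of ra] ra rb 4 by linarith
      then show ?thesis ..
    next
      case 2
      then have "ra * n1 < rb * n1" using 4 by simp
      then have False using B[of rb] ra rb 4 by linarith
      then show ?thesis ..
    next
      case 3
      then show ?thesis using C[of ra] ra rb by simp
    qed
  qed
qed

section \<open>Counting germs for a pole and its antipode\<close>

lemma germI: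
  assumes "triangle a b c" "N = \<rho> *\<^sub>R a + \<alpha> *\<^sub>R b + \<beta> *\<^sub>R c" "0 < \<alpha>" "0 < \<beta>"
  shows "germ N a {a, b, c}"
  using assms unfolding germ_def by blast

text \<open>The second component selects one of the poles \<open>N\<close> and
  \<open>- N\<close>.\<close>

definition germs :: "real ^ 3 \<Rightarrow> (real ^ 3) set \<Rightarrow> ((real ^ 3) \<times> real) set" where
  "germs N t = {(v, s) \<in> V \<times> {1, - 1}. germ (s *\<^sub>R N) v t}"

lemma finite_germs: "finite (germs N t)"
  unfolding germs_def by (rule finite_subset[of _ "V \<times> {1, - 1}"]) (use finite_V in auto)

text \<open>Double counting: by \<open>germ_unique\<close>, a vertex and a pole determine at most
  one triangle.\<close>

lemma sum_card_germs: "(\<Sum>t\<in>triangles. card (germs N t)) \<le> 2 * card V"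
proof -
  have "(\<Sum>t\<in>triangles. card (germs N t))
      = (\<Sum>t\<in>triangles. card {x \<in> V \<times> {1, - 1}. germ (snd x *\<^sub>R N) (fst x) t})"
    unfolding germs_def by (intro sum.cong refl arg_cong[of _ _ card]) auto
  also have "\<dots> = (\<Sum>x\<in>V \<times> {1, - 1}. card {t \<in> triangles. germ (snd x *\<^sub>R N) (fst x) t})"
    by (rule sum_multicount_gen) (use finite_V finite_triangles in auto)
  also have "\<dots> \<le> (\<Sum>x\<in>V \<times> {1, - 1 :: real}. 1)"
  proof (rule sum_mono)
    fix x :: "(real ^ 3) \<times> real"
    have "card {t \<in> triangles. germ (snd x *\<^sub>R N) (fst x) t} \<le> Suc 0"
      using finite_triangles germ_unique by (subst card_le_Suc0_iff_eq) auto
    then show "card {t \<in> triangles. germ (snd x *\<^sub>R N) (fst x) t} \<le> 1" by simp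
  qed
  also have "\<dots> = 2 * card V" by (simp add: card_cartesian_product)
  finally show ?thesis .
qed

lemma triangle_coordinates:
  assumes N: "generic_direction N" and t: "triangle a b c"
  obtains \<alpha> \<beta> \<gamma> where "N = \<alpha> *\<^sub>R a + \<beta> *\<^sub>R b + \<gamma> *\<^sub>R c" "\<alpha> \<noteq> 0" "\<beta> \<noteq> 0" "\<gamma> \<noteq> 0"
proof -
  note V = triangle_V[OF t]
  have d: "det3 a b c \<noteq> 0" using V general_nz by blast
  have "det3 N b c \<noteq> 0" "det3 N a c \<noteq> 0" "det3 N a b \<noteq> 0" using generic_directionD[OF N] V by auto
  then have "det3 N b c \<noteq> 0" "det3 a N c \<noteq> 0" "det3 a b N \<noteq> 0"
    using det3_swap(1)[of a N c] det3_rotate[of a b N] by auto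
  then show ?thesis using that[OF coordinates[OF d]] d by simp
qed

text \<open>Two of the three nonzero coordinates of \<open>N\<close> agree in sign; at the remaining
  corner, \<open>N\<close> or \<open>- N\<close> points into the triangle.\<close>

lemma card_germs_ge_1:
  assumes N: "generic_direction N" and t: "t \<in> triangles"
  shows "1 \<le> card (germs N t)"
proof -
  obtain a b c where abc: "t = {a, b, c}" "triangle a b c" using t unfolding triangles_def by blast
  note V = triangle_V[OF abc(2)]
  have p: "triangle a c b" "triangle b a c" "triangle b c a" "triangle c a b" "triangle c b a"
    using abc(2) triangle_perm by blast+
  obtain \<alpha> \<beta> \<gamma> where co: "N = \<alpha> *\<^sub>R a + \<beta> *\<^sub>R b + \<gamma> *\<^sub>R c" "\<alpha> \<noteq> 0" "\<beta> \<noteq> 0" "\<gamma> \<noteq> 0"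
    using triangle_coordinates[OF N abc(2)] by blast
  have two: "germs N t \<noteq> {}"
    if xyz: "triangle x y z" "t = {x, y, z}" "N = \<rho> *\<^sub>R x + \<alpha> *\<^sub>R y + \<beta> *\<^sub>R z" "0 < \<alpha> * \<beta>" for x y z \<rho> \<alpha> \<beta>
  proof -
    have "x \<in> V" using triangle_V xyz by blast
    consider "0 < \<alpha>" "0 < \<beta>" | "\<alpha> < 0" "\<beta> < 0" using xyz(4) by (auto simp: zero_less_mult_iff)
    then show ?thesis
    proof cases
      case 1
      then have "germ N x t" using germI[OF xyz(1,3)] xyz by simp
      then have "(x, 1) \<in> germs N t" using \<open>x \<in> V\<close> unfolding germs_def by simp
      then show ?thesis by blast
    next
      case 2
      have "- N = (- \<rho>) *\<^sub>R x + (- \<alpha>) *\<^sub>R y + (- \<beta>) *\<^sub>R z" unfolding xyz(3) by simp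
      then have "germ (- N) x t" using germI[OF xyz(1), of "- N" "- \<rho>" "- \<alpha>" "- \<beta>"] 2 xyz(2) by simp
      then have "(x, - 1) \<in> germs N t" using \<open>x \<in> V\<close> unfolding germs_def by simp
      then show ?thesis by blast
    qed
  qed
  have "0 < \<alpha> * \<beta> \<or> 0 < \<alpha> * \<gamma> \<or> 0 < \<beta> * \<gamma>"
    using co(2-4) by (auto simp: zero_less_mult_iff)
  then consider "0 < \<alpha> * \<beta>" | "0 < \<alpha> * \<gamma>" | "0 < \<beta> * \<gamma>" by blast
  then have "germs N t \<noteq> {}"
  proof cases
    case 1
    then show ?thesis using two[OF p(4), of \<gamma> \<alpha> \<beta>] abc co(1) by (simp add: insert_commute add_ac)
  next
    case 2
    then show ?thesis using two[OF p(2), of \<beta> \<alpha> \<gamma>] abc co(1) by (simp add: insert_commute add_ac)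
  next
    case 3
    then show ?thesis using two[OF abc(2), of \<alpha> \<beta> \<gamma>] abc co(1) by simp
  qed
  then show ?thesis using finite_germs[of N t] by (simp add: Suc_leI card_gt_0_iff)
qed

lemma card_germs_ge_3:
  assumes t: "triangle a b c" and s: "s \<in> {1, - 1}" and N: "in_triangle (s *\<^sub>R N) a b c"
  shows "3 \<le> card (germs N {a, b, c})"
proof -
  note V = triangle_V[OF t]
  have p: "triangle b a c" "triangle c a b" using t triangle_perm by blast+
  obtain \<alpha> \<beta> \<gamma> where co: "0 < \<alpha>" "0 < \<beta>" "0 < \<gamma>" "s *\<^sub>R N = \<alpha> *\<^sub>R a + \<beta> *\<^sub>R b + \<gamma> *\<^sub>R c"
    using N unfolding in_triangle_def by blast
  have "germ (s *\<^sub>R N) a {a, b, c}" using germI[OF t co(4,2,3)] .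
  moreover have "germ (s *\<^sub>R N) b {a, b, c}"
    using germI[OF p(1), of "s *\<^sub>R N" \<beta> \<alpha> \<gamma>] co by (simp add: insert_commute add_ac)
  moreover have "germ (s *\<^sub>R N) c {a, b, c}"
    using germI[OF p(2), of "s *\<^sub>R N" \<gamma> \<alpha> \<beta>] co by (simp add: insert_commute add_ac)
  ultimately have "{(a, s), (b, s), (c, s)} \<subseteq> germs N {a, b, c}"
    using V s unfolding germs_def by auto
  moreover have "card {(a, s), (b, s), (c, s)} = 3" using V by simp
  ultimately show ?thesis using card_mono[OF finite_germs] by metis
qed

text \<open>Each triangle receives one germ, except that the two triangles around \<open>N\<close> and \<open>- N\<close> receive
  three. Since there are at most \<open>2 |V|\<close> germs, while the edges of \<open>E\<close> border \<open>2 |E|\<close> triangles,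
  the triangles with two edges in \<open>E\<close> must make up for the four missing ones.\<close>

lemma many_ears:
  assumes E: "E \<subseteq> M" "E \<noteq> {}" "card E = card V"
    and no_triangle: "\<And>a b c. {a, b} \<in> E \<Longrightarrow> {a, c} \<in> E \<Longrightarrow> {b, c} \<in> E \<Longrightarrow> False"
  shows "4 \<le> card {t \<in> triangles. 2 \<le> card {e \<in> E. e \<subseteq> t}}"
proof -
  define R where "R = {t \<in> triangles. 2 \<le> card {e \<in> E. e \<subseteq> t}}"
  define q where "q = (\<lambda>t. card {e \<in> E. e \<subseteq> t})"
  have doubleton: "\<exists>a b. e = {a, b}" if "e \<in> E" for e
    using edges E(1) that by blast
  have "M \<subseteq> Pow V"
  proof
    fix e assume "e \<in> M"
    then show "e \<in> Pow V" using edges[of e] edgeD by blast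
  qed
  then have finE: "finite E" using E(1) finite_V by (meson finite_Pow_iff finite_subset subset_trans)
  have "(\<Sum>t\<in>triangles. q t) = (\<Sum>e\<in>E. 2)"
    unfolding q_def
  proof (rule sum_multicount_gen)
    show "\<forall>e\<in>E. card {t \<in> triangles. e \<subseteq> t} = 2"
    proof
      fix e assume e: "e \<in> E"
      then obtain a b where "e = {a, b}" using doubleton by blast
      then show "card {t \<in> triangles. e \<subseteq> t} = 2" using card_triangles_edge[of a b] E(1) e by auto
    qed
  qed (use finE finite_triangles in auto)
  then have sumq: "(\<Sum>t\<in>triangles. q t) = 2 * card V" using E(3) by simp
  have q2: "q t \<le> 2" if t: "t \<in> triangles" for t
  proof -
    obtain a b c where abc: "t = {a, b, c}" "triangle a b c" using t unfolding triangles_def by blast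
    note V = triangle_V[OF abc(2)]
    have "e \<in> {{a, b}, {a, c}, {b, c}}" if e: "e \<in> E" "e \<subseteq> t" for e
    proof -
      obtain x y where xy: "e = {x, y}" using doubleton e by blast
      moreover have "x \<noteq> y" using edgeD[of x y] E(1) e xy by blast
      ultimately show ?thesis using e(2) abc(1) by auto
    qed
    then have sub: "{e \<in> E. e \<subseteq> t} \<subseteq> {{a, b}, {a, c}, {b, c}}" by blast
    moreover have "{e \<in> E. e \<subseteq> t} \<noteq> {{a, b}, {a, c}, {b, c}}" using no_triangle[of a b c] by blast
    ultimately have "card {e \<in> E. e \<subseteq> t} < card {{a, b}, {a, c}, {b, c}}"
      by (intro psubset_card_mono) auto
    also have "\<dots> \<le> 3" using card_length[of "[{a, b}, {a, c}, {b, c}]"] by simp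
    finally show ?thesis unfolding q_def by simp
  qed
  obtain N where N: "generic_direction N" using generic_direction_exists by blast
  then have N': "generic_direction (- N)" unfolding generic_direction_def by simp
  obtain a0 b0 where e0: "{a0, b0} \<in> M" using E doubleton by blast
  obtain a b c where t1: "triangle a b c" "in_triangle N a b c" using triangle_containing[OF N e0] by blast
  obtain a' b' c' where t2: "triangle a' b' c'" "in_triangle (- N) a' b' c'"
    using triangle_containing[OF N' e0] by blast
  define D where "D = {{a, b, c}, {a', b', c'}}"
  \<comment> \<open>The two poles lie in different triangles, since coordinates change sign under
    negation; so \<open>D\<close> really contributes twice.\<close>
  have "\<not> in_triangle (- N) a b c"
  proof
    assume "in_triangle (- N) a b c"
    then obtain \<alpha> \<beta> \<gamma> where 1: "0 < \<alpha>" "- N = \<alpha> *\<^sub>R a + \<beta> *\<^sub>R b + \<gamma> *\<^sub>R c" unfolding in_triangle_def by blast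
    obtain \<alpha>' \<beta>' \<gamma>' where 2: "0 < \<alpha>'" "N = \<alpha>' *\<^sub>R a + \<beta>' *\<^sub>R b + \<gamma>' *\<^sub>R c"
      using t1(2) unfolding in_triangle_def by blast
    have "det3 (- N) b c = \<alpha> * det3 a b c" unfolding 1(2) by simp
    moreover have "det3 N b c = \<alpha>' * det3 a b c" unfolding 2(2) by simp
    ultimately have "(\<alpha> + \<alpha>') * det3 a b c = 0" by (simp add: algebra_simps)
    then show False using 1 2 triangle_V[OF t1(1)] general_nz[of a b c] by simp
  qed
  moreover have "in_triangle (- N) a b c" if eq: "{a, b, c} = {a', b', c'}"
  proof -
    have "(a', b', c') \<in> {(a, b, c), (a, c, b), (b, a, c), (b, c, a), (c, a, b), (c, b, a)}"
    proof -
      have "a' \<in> {a, b, c}" "b' \<in> {a, b, c}" "c' \<in> {a, b, c}" unfolding eq by auto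
      then show ?thesis
        using triangle_V[OF t2(1)] by (elim insertE emptyE) simp_all
    qed
    moreover have "in_triangle (- N) b c a = in_triangle (- N) a b c"
        "in_triangle (- N) c a b = in_triangle (- N) a b c" "in_triangle (- N) c b a = in_triangle (- N) a b c"
      using in_triangle_perm by blast+
    ultimately show ?thesis using t2(2) in_triangle_perm by (elim insertE emptyE) simp_all
  qed
  ultimately have "{a, b, c} \<noteq> {a', b', c'}" by blast
  then have "card D = 2" unfolding D_def unfolding card_2_iff by blast
  have "D \<subseteq> triangles" using t1 t2 unfolding D_def triangles_def by auto
  have D3: "3 \<le> card (germs N t)" if "t \<in> D" for t
    using that card_germs_ge_3[OF t1(1), of 1 N] card_germs_ge_3[OF t2(1), of "- 1" N] t1 t2
    unfolding D_def by auto
  \<comment> \<open>At most one edge of \<open>E\<close> borders a triangle outside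
    \<open>R\<close>, and at most two border one in \<open>R\<close>; on \<open>D\<close> the two
    extra germs pay for the extra summand. Summation gives
    \<open>2 |V| + 4 <= 2 |V| + |R|\<close>.\<close>
  have each: "q t + 2 * (if t \<in> D then 1 else 0) \<le> card (germs N t) + (if t \<in> R then 1 else 0)"
    if t: "t \<in> triangles" for t
  proof -
    have "q t \<le> 1 + (if t \<in> R then 1 else 0)"
      using q2[OF t] t unfolding R_def q_def by auto
    then show ?thesis using D3[of t] card_germs_ge_1[OF N t] by auto
  qed
  have "(\<Sum>t\<in>triangles. q t + 2 * (if t \<in> D then 1 else 0))
      \<le> (\<Sum>t\<in>triangles. card (germs N t) + (if t \<in> R then 1 else 0))"
    by (rule sum_mono) (rule each)
  moreover have "(\<Sum>t\<in>triangles. (if t \<in> D then 1 else 0)) = card (triangles \<inter> D)"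
    "(\<Sum>t\<in>triangles. (if t \<in> R then 1 else 0)) = card (triangles \<inter> R)"
    using finite_triangles by (simp_all add: sum.If_cases)
  moreover have "triangles \<inter> D = D" "triangles \<inter> R = R" using \<open>D \<subseteq> triangles\<close> unfolding R_def by auto
  ultimately have "2 * card V + 2 * card D \<le> (\<Sum>t\<in>triangles. card (germs N t)) + card R"
    unfolding sum.distrib sum_distrib_left[symmetric] sumq by simp
  then show ?thesis using sum_card_germs[of N] \<open>card D = 2\<close> unfolding R_def by linarith
qed

end

section \<open>Ears of noncrossing cycles\<close>

text \<open>A maximal noncrossing extension of \<open>E\<close> exists because there are finitely
  many pairs of vertices. A triangle with two sides in \<open>E\<close> is an ear, since these sides
  share a vertex.\<close>

lemma ears_exist:
  fixes V :: "(real ^ 3) set" and E :: "(real ^ 3) set set"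
  assumes V: "finite V" "general_position V"
    and spanning: "\<And>a b. a \<in> V \<Longrightarrow> b \<in> V \<Longrightarrow> a \<noteq> b \<Longrightarrow> \<exists>x\<in>V. 0 < det3 a b x"
    and E: "E \<noteq> {}" "card E = card V"
    and E_edges: "\<And>e. e \<in> E \<Longrightarrow> \<exists>a b. e = {a, b} \<and> a \<in> V \<and> b \<in> V \<and> a \<noteq> b"
    and noncrossing: "\<And>a b c d. {a, b} \<in> E \<Longrightarrow> {c, d} \<in> E \<Longrightarrow> distinct [a, b, c, d] \<Longrightarrow> \<not> crossing a b c d"
    and no_triangle: "\<And>a b c. {a, b} \<in> E \<Longrightarrow> {a, c} \<in> E \<Longrightarrow> {b, c} \<in> E \<Longrightarrow> False"
  shows "4 \<le> card {t. \<exists>a b c. t = {a, b, c} \<and> {a, b} \<in> E \<and> {b, c} \<in> E \<and> a \<noteq> c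
    \<and> (\<forall>x\<in>V. \<not> in_triangle x a b c)}"
proof -
  define pairs where "pairs = {{a, b} | a b. a \<in> V \<and> b \<in> V \<and> a \<noteq> b}"
  define NC where "NC = (\<lambda>M. \<forall>a b c d. {a, b} \<in> M \<longrightarrow> {c, d} \<in> M \<longrightarrow> distinct [a, b, c, d] \<longrightarrow> \<not> crossing a b c d)"
  define A where "A = {M. M \<subseteq> pairs \<and> NC M}"
  have "pairs \<subseteq> Pow V" unfolding pairs_def by blast
  then have finP: "finite pairs" using V(1) finite_subset by blast
  then have "finite A" unfolding A_def by simp
  moreover have "E \<subseteq> pairs" unfolding pairs_def by (rule subsetI, rule CollectI, rule E_edges)
  then have "E \<in> A" unfolding A_def NC_def using noncrossing by simp
  ultimately have "\<exists>M\<in>A. E \<subseteq> M \<and> (\<forall>M'\<in>A. M \<subseteq> M' \<longrightarrow> M = M')"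
    by (rule finite_has_maximal2)
  then obtain M where M: "M \<in> A" "E \<subseteq> M" "\<And>M'. M' \<in> A \<Longrightarrow> M \<subseteq> M' \<Longrightarrow> M = M'"
    by (elim bexE conjE) simp
  have Mp: "M \<subseteq> pairs" and MN: "NC M" using M(1) unfolding A_def by simp_all
  have pairsD: "\<exists>a b. e = {a, b} \<and> a \<in> V \<and> b \<in> V \<and> a \<noteq> b" if "e \<in> M" for e
    using subsetD[OF Mp that] unfolding pairs_def by simp
  interpret maximal_noncrossing V M
  proof
    show "finite V" "general_position V" by fact+
    show "\<exists>x\<in>V. 0 < det3 a b x" if "a \<in> V" "b \<in> V" "a \<noteq> b" for a b using spanning that .
    show "\<exists>a b. e = {a, b}" if "e \<in> M" for e using pairsD[OF that] by auto
    show "a \<in> V \<and> b \<in> V \<and> a \<noteq> b" if ab: "{a, b} \<in> M" for a b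
    proof -
      obtain x y where "{a, b} = {x, y}" "x \<in> V" "y \<in> V" "x \<noteq> y"
        using pairsD[OF ab] by blast
      then show ?thesis by (auto simp: doubleton_eq_iff)
    qed
    show "\<not> crossing a b c d" if "{a, b} \<in> M" "{c, d} \<in> M" "distinct [a, b, c, d]" for a b c d
      using MN that unfolding NC_def by blast
    show "{a, b} \<in> M" if ab: "a \<in> V" "b \<in> V" "a \<noteq> b"
      and nc: "\<And>c d. {c, d} \<in> M \<Longrightarrow> distinct [a, b, c, d] \<Longrightarrow> \<not> crossing a b c d" for a b
    proof -
      have "NC (insert {a, b} M)" unfolding NC_def
      proof (intro allI impI)
        fix p q c d
        assume pq: "{p, q} \<in> insert {a, b} M" and cd: "{c, d} \<in> insert {a, b} M"
          and dist: "distinct [p, q, c, d]"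
        have nc': "\<not> crossing x y c d" if "{x, y} = {a, b}" "{c, d} \<in> M" "distinct [x, y, c, d]" for x y c d
        proof -
          have "(x = a \<and> y = b) \<or> (x = b \<and> y = a)" using that(1) by (simp add: doubleton_eq_iff)
          then show ?thesis using nc[OF that(2)] that(3) crossing_commute[of a b c d] by auto
        qed
        consider "{p, q} \<in> M" "{c, d} \<in> M" | "{p, q} = {a, b}" "{c, d} \<in> M" | "{p, q} \<in> M" "{c, d} = {a, b}"
          using pq cd dist by (auto simp: doubleton_eq_iff)
        then show "\<not> crossing p q c d"
        proof cases
          case 1
          then show ?thesis using MN dist unfolding NC_def by blast
        next
          case 2
          then show ?thesis using nc' dist by blast
        next
          case 3
          then have "\<not> crossing c d p q" using nc'[of c d p q] dist by auto
          then show ?thesis using crossing_sym by blast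
        qed
      qed
      moreover have "{a, b} \<in> pairs" using ab unfolding pairs_def by blast
      ultimately have "insert {a, b} M \<in> A" using Mp unfolding A_def by simp
      from M(3)[OF this] show ?thesis by blast
    qed
  qed
  let ?R = "{t. \<exists>a b c. t = {a, b, c} \<and> {a, b} \<in> E \<and> {b, c} \<in> E \<and> a \<noteq> c
    \<and> (\<forall>x\<in>V. \<not> in_triangle x a b c)}"
  have "{t \<in> triangles. 2 \<le> card {e \<in> E. e \<subseteq> t}} \<subseteq> ?R"
  proof
    fix t assume "t \<in> {t \<in> triangles. 2 \<le> card {e \<in> E. e \<subseteq> t}}"
    then have t: "t \<in> triangles" "\<not> card {e \<in> E. e \<subseteq> t} \<le> Suc 0" by auto
    have "finite {e \<in> E. e \<subseteq> t}" using finite_subset[OF subset_trans[OF M(2) Mp] finP] by simp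
    then obtain e f where ef: "e \<in> E" "f \<in> E" "e \<subseteq> t" "f \<subseteq> t" "e \<noteq> f"
      using t(2) card_le_Suc0_iff_eq[of "{e \<in> E. e \<subseteq> t}"] by blast
    obtain b c where e: "e = {b, c}" "b \<noteq> c" using E_edges[OF ef(1)] by blast
    obtain d where d: "t = {b, c, d}" "triangle b c d"
      using triangles_edge[OF t(1), of b c] ef e by auto
    obtain x y where f: "f = {x, y}" "x \<noteq> y" using E_edges[OF ef(2)] by blast
    have "f = {b, d} \<or> f = {c, d}" using f ef e d by (auto simp: doubleton_eq_iff)
    then show "t \<in> ?R"
    proof
      assume "f = {b, d}"
      then have "t = {c, b, d}" "{c, b} \<in> E" "{b, d} \<in> E" "c \<noteq> d" "\<forall>x\<in>V. \<not> in_triangle x c b d"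
        using ef e d triangle_V[OF d(2)] in_triangle_perm unfolding triangle_def by (auto simp: insert_commute)
      then show ?thesis by blast
    next
      assume "f = {c, d}"
      then have "t = {b, c, d}" "{b, c} \<in> E" "{c, d} \<in> E" "b \<noteq> d" "\<forall>x\<in>V. \<not> in_triangle x b c d"
        using ef e d triangle_V[OF d(2)] unfolding triangle_def by auto
      then show ?thesis by blast
    qed
  qed
  moreover have "?R \<subseteq> Pow V"
  proof
    fix t assume "t \<in> ?R"
    then obtain a b c where "t = {a, b, c}" "{a, b} \<in> E" "{b, c} \<in> E" by blast
    then show "t \<in> Pow V" using M(2) edgeD by blast
  qed
  then have "finite ?R" using V(1) finite_subset by blast
  ultimately have "card {t \<in> triangles. 2 \<le> card {e \<in> E. e \<subseteq> t}} \<le> card ?R" by (intro card_mono)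
  moreover have "4 \<le> card {t \<in> triangles. 2 \<le> card {e \<in> E. e \<subseteq> t}}"
    by (rule many_ears[OF M(2) E]) (rule no_triangle)
  ultimately show ?thesis by linarith
qed

section \<open>Positive relations\<close>

text \<open>For vectors in general position: the origin is interior to their tetrahedron. Having
  exactly four elements, the set names the vertices that must not be cut off.\<close>

definition positive_relation :: "(real ^ 3) set \<Rightarrow> bool" where
  "positive_relation T \<longleftrightarrow> card T = 4 \<and> (\<exists>\<omega>. (\<forall>v\<in>T. 0 < \<omega> v) \<and> (\<Sum>v\<in>T. \<omega> v *\<^sub>R v) = 0)"

lemma det3_sum: "det3 a b (\<Sum>v\<in>T. f v) = (\<Sum>v\<in>T. det3 a b (f v))"
proof (cases "finite T")
  case True
  then show ?thesis by (induction T rule: finite_induct) auto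
qed simp

text \<open>Apply \<open>det3 a b\<close> to the relation: if no term is positive, all vanish, and
  four vectors would lie on the great circle of \<open>a\<close> and \<open>b\<close>.\<close>

lemma positive_relation_spanning:
  assumes gp: "general_position V" and T: "positive_relation T" "T \<subseteq> V"
    and ab: "a \<in> V" "b \<in> V" "a \<noteq> b"
  shows "\<exists>x\<in>V. 0 < det3 a b x"
proof (rule ccontr)
  assume no: "\<not> ?thesis"
  obtain \<omega> where \<omega>: "card T = 4" "\<forall>v\<in>T. 0 < \<omega> v" "(\<Sum>v\<in>T. \<omega> v *\<^sub>R v) = 0"
    using T(1) unfolding positive_relation_def by blast
  have fin: "finite T" using \<omega>(1) card.infinite by fastforce
  have "(\<Sum>v\<in>T. \<omega> v * det3 a b v) = 0"
    using arg_cong[OF \<omega>(3), of "det3 a b"] by (simp add: det3_sum)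
  moreover have le: "\<omega> v * det3 a b v \<le> 0" if "v \<in> T" for v
    using that no \<omega>(2) T(2) by (meson less_imp_le mult_nonneg_nonpos not_less subsetD)
  ultimately have "\<forall>v\<in>T. \<omega> v * det3 a b v = 0"
    using sum_nonneg_eq_0_iff[of T "\<lambda>v. - (\<omega> v * det3 a b v)"] fin by (simp add: sum_negf)
  then have "\<forall>v\<in>T. det3 a b v = 0" using \<omega>(2) by force
  then have "T \<subseteq> {a, b}" using general_positionD[OF gp ab(1,2)] T(2) ab by auto
  then have "card T \<le> card {a, b}" by (intro card_mono) auto
  then show False using \<omega>(1) ab by simp
qed

text \<open>A pivot step of the simplex method: \<open>- x\<close> is expressed through
  \<open>T\<close>, and the minimum ratio decides which vector leaves.\<close>

lemma positive_relation_exchange: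
  assumes gp: "general_position V" and T: "positive_relation T" "T \<subseteq> V" and x: "x \<in> V" "x \<notin> T"
  obtains v where "v \<in> T" "positive_relation (insert x (T - {v}))"
proof -
  obtain \<omega> where \<omega>: "card T = 4" "\<forall>v\<in>T. 0 < \<omega> v" "(\<Sum>v\<in>T. \<omega> v *\<^sub>R v) = 0"
    using T(1) unfolding positive_relation_def by blast
  have fin: "finite T" using \<omega>(1) card.infinite by fastforce
  obtain B where "B \<subseteq> T" "card B = 3" using obtain_subset_with_card_n[of 3 T] \<omega>(1) by auto
  then obtain a b c where B: "{a, b, c} \<subseteq> T" "distinct [a, b, c]" by (auto simp: card_3_iff)
  have d: "det3 a b c \<noteq> 0" using general_positionD[OF gp _ _ _ B(2)] B T(2) by auto
  obtain p q r where "- x = p *\<^sub>R a + q *\<^sub>R b + r *\<^sub>R c" using coordinates_obtain[OF d] by blast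
  define \<mu> where "\<mu> = (\<lambda>v. if v = a then p else if v = b then q else if v = c then r else 0)"
  have "(\<Sum>v\<in>T. \<mu> v *\<^sub>R v) = (\<Sum>v\<in>{a, b, c}. \<mu> v *\<^sub>R v)"
    by (rule sum.mono_neutral_right) (use fin B in \<open>auto simp: \<mu>_def\<close>)
  also have "\<dots> = - x" using B(2) \<open>- x = _\<close> by (auto simp: \<mu>_def)
  finally have \<mu>: "(\<Sum>v\<in>T. \<mu> v *\<^sub>R v) = - x" .
  have "Min ((\<lambda>v. \<mu> v / \<omega> v) ` T) \<in> (\<lambda>v. \<mu> v / \<omega> v) ` T" using fin B by (intro Min_in) auto
  then obtain v where v: "v \<in> T" "\<mu> v / \<omega> v = Min ((\<lambda>v. \<mu> v / \<omega> v) ` T)" by auto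
  \<comment> \<open>Subtracting \<open>s\<close> times the given relation kills the coefficient of
    \<open>v\<close> and keeps the others nonnegative.\<close>
  define s where "s = \<mu> v / \<omega> v"
  define \<nu> where "\<nu> = (\<lambda>u. \<mu> u - s * \<omega> u)"
  have \<nu>v: "\<nu> v = 0" using \<omega>(2) v(1) by (auto simp: \<nu>_def s_def)
  have \<nu>ge: "0 \<le> \<nu> u" if "u \<in> T" for u
  proof -
    have "s \<le> \<mu> u / \<omega> u" unfolding s_def v(2) using fin that by simp
    then show ?thesis using \<omega>(2) that by (simp add: \<nu>_def pos_le_divide_eq)
  qed
  have "(\<Sum>u\<in>T. \<nu> u *\<^sub>R u) = - x - s *\<^sub>R (\<Sum>u\<in>T. \<omega> u *\<^sub>R u)"
    unfolding \<nu>_def \<mu>[symmetric] by (simp add: scaleR_diff_left sum_subtractf scaleR_sum_right)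
  then have "(\<Sum>u\<in>T. \<nu> u *\<^sub>R u) = - x" using \<omega>(3) by simp
  then have \<nu>: "(\<Sum>u\<in>T - {v}. \<nu> u *\<^sub>R u) = - x"
    using sum.remove[OF fin v(1), of "\<lambda>u. \<nu> u *\<^sub>R u"] \<nu>v by simp
  \<comment> \<open>A second vanishing coefficient would put \<open>x\<close> into the plane of two
    vectors of \<open>T\<close>.\<close>
  have \<nu>pos: "0 < \<nu> u" if u: "u \<in> T - {v}" for u
  proof (rule ccontr)
    assume "\<not> 0 < \<nu> u"
    then have "\<nu> u = 0" using \<nu>ge[of u] u by auto
    then have eq: "(\<Sum>w\<in>T - {v} - {u}. \<nu> w *\<^sub>R w) = - x"
      using \<nu> sum.remove[of "T - {v}" u "\<lambda>u. \<nu> u *\<^sub>R u"] fin u by simp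
    have "card (T - {v} - {u}) = 2" using \<omega>(1) fin u v by simp
    then obtain y z where yz: "T - {v} - {u} = {y, z}" "y \<noteq> z" by (auto simp: card_2_iff)
    then have "- x = \<nu> y *\<^sub>R y + \<nu> z *\<^sub>R z" using eq by simp
    from arg_cong[OF this, of "det3 y z"] have "det3 y z x = 0" by simp
    moreover have "y \<in> T" "z \<in> T" using yz by auto
    ultimately show False using general_positionD[OF gp, of y z x] x T(2) yz by auto
  qed
  have "(\<Sum>u\<in>insert x (T - {v}). (\<nu>(x := 1)) u *\<^sub>R u) = x + (\<Sum>u\<in>T - {v}. (\<nu>(x := 1)) u *\<^sub>R u)"
    using fin x by simp
  also have "(\<Sum>u\<in>T - {v}. (\<nu>(x := 1)) u *\<^sub>R u) = (\<Sum>u\<in>T - {v}. \<nu> u *\<^sub>R u)"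
    by (rule sum.cong) (use x in auto)
  finally have "(\<Sum>u\<in>insert x (T - {v}). (\<nu>(x := 1)) u *\<^sub>R u) = 0" using \<nu> by simp
  moreover have "\<forall>u\<in>insert x (T - {v}). 0 < (\<nu>(x := 1)) u" using \<nu>pos by auto
  moreover have "card (insert x (T - {v})) = 4" using \<omega>(1) fin v x by simp
  ultimately have "positive_relation (insert x (T - {v}))" unfolding positive_relation_def by blast
  then show ?thesis using that v by blast
qed

text \<open>Caratheodory bounds the support by four, and linear independence of triples excludes a
  smaller one.\<close>

lemma positive_relation_exists:
  assumes fin: "finite V" and gp: "general_position V" and V: "3 \<le> card V" and hull: "0 \<in> convex hull V"
  shows "\<exists>T\<subseteq>V. positive_relation T"
proof -
  obtain S where S0: "finite S" "S \<subseteq> V" "card S \<le> DIM(real ^ 3) + 1" "0 \<in> convex hull S"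
    using hull unfolding caratheodory[of V] mem_Collect_eq by (elim exE conjE)
  obtain u where "\<forall>x\<in>S. 0 \<le> u x" "sum u S = 1" "(\<Sum>v\<in>S. u v *\<^sub>R v) = 0"
    using S0(4) unfolding convex_hull_finite[OF S0(1)] mem_Collect_eq by (elim exE conjE)
  then have S: "finite S" "S \<subseteq> V" "card S \<le> 4" "\<forall>x\<in>S. 0 \<le> u x" "sum u S = 1"
      "(\<Sum>v\<in>S. u v *\<^sub>R v) = 0"
    using S0 by simp_all
  define T where "T = {v \<in> S. 0 < u v}"
  have "T \<subseteq> S" unfolding T_def by blast
  then have T: "finite T" "T \<subseteq> V" "card T \<le> 4"
    using S(1-3) finite_subset card_mono[of S T] by auto
  have sum: "(\<Sum>v\<in>T. u v *\<^sub>R v) = 0"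
    unfolding S(6)[symmetric] T_def using S by (intro sum.mono_neutral_left) force+
  have "T \<noteq> {}"
  proof
    assume "T = {}"
    then have "\<forall>v\<in>S. u v = 0" using S(4) unfolding T_def by force
    then show False using S(5) by simp
  qed
  have "\<not> card T \<le> 3"
  proof
    assume "card T \<le> 3"
    \<comment> \<open>Padding the support to exactly three vectors lets \<open>det3 y z\<close>
      isolate the coefficient of \<open>x\<close>.\<close>
    then obtain B where B: "T \<subseteq> B" "B \<subseteq> V" "card B = 3"
      using exists_subset_between[of T 3 V] T V fin by auto
    obtain x where x: "x \<in> T" using \<open>T \<noteq> {}\<close> by blast
    have "card (B - {x}) = 2" using B x by (simp add: card_Diff_singleton subset_iff)
    then obtain y z where yz: "B - {x} = {y, z}" "y \<noteq> z" by (auto simp: card_2_iff)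
    have "0 = (\<Sum>v\<in>T. u v * det3 y z v)" using arg_cong[OF sum, of "det3 y z"] by (simp add: det3_sum)
    also have "\<dots> = (\<Sum>v\<in>{x}. u v * det3 y z v)"
    proof (rule sum.mono_neutral_right)
      have "T - {x} \<subseteq> {y, z}" using B(1) yz(1) by blast
      then show "\<forall>v\<in>T - {x}. u v * det3 y z v = 0" by auto
    qed (use T(1) x in auto)
    finally have "u x * det3 y z x = 0" by simp
    moreover have "y \<in> V" "z \<in> V" "x \<in> V" "y \<noteq> x" "z \<noteq> x" using yz B x by auto
    ultimately show False using general_positionD[OF gp, of y z x] yz x unfolding T_def by auto
  qed
  then have "card T = 4" using T by simp
  then show ?thesis using T(2) sum unfolding positive_relation_def T_def by blast
qed

section \<open>Cutting off ears\<close>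

definition polygon_edges :: "(real ^ 3) list \<Rightarrow> (real ^ 3) set set" where
  "polygon_edges xs = (\<lambda>i. {xs ! i, xs ! (Suc i mod length xs)}) ` {..<length xs}"

definition simple_polygon :: "(real ^ 3) list \<Rightarrow> bool" where
  "simple_polygon xs \<longleftrightarrow> (\<forall>a b c d. {a, b} \<in> polygon_edges xs \<longrightarrow> {c, d} \<in> polygon_edges xs \<longrightarrow>
     distinct [a, b, c, d] \<longrightarrow> \<not> crossing a b c d)"

text \<open>Adding \<open>length xs\<close> before subtracting 1 protects index 0 from truncated
  subtraction.\<close>

definition turn :: "(real ^ 3) list \<Rightarrow> nat \<Rightarrow> real" where
  "turn xs i = det3 (xs ! ((i + length xs - 1) mod length xs)) (xs ! i) (xs ! (Suc i mod length xs))"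

definition signs :: "(real ^ 3) list \<Rightarrow> bool list" where
  "signs xs = map (\<lambda>i. 0 < turn xs i) [0..<length xs]"

definition ear :: "(real ^ 3) list \<Rightarrow> nat \<Rightarrow> bool" where
  "ear xs i \<longleftrightarrow> (\<forall>x\<in>set xs. \<not> in_triangle x (xs ! ((i + length xs - 1) mod length xs)) (xs ! i)
     (xs ! (Suc i mod length xs)))"

text \<open>Three changes along the list amount to at least four changes around the cycle, because
  the number of changes in a cyclic sequence of truth values is even.\<close>

definition alternating :: "bool list \<Rightarrow> bool" where
  "alternating bs \<longleftrightarrow> (\<exists>i j k l. i < j \<and> j < k \<and> k < l \<and> l < length bs \<and>
     bs ! i \<noteq> bs ! j \<and> bs ! j \<noteq> bs ! k \<and> bs ! k \<noteq> bs ! l)"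

lemma length_signs [simp]: "length (signs xs) = length xs"
  by (simp add: signs_def)

lemma nth_signs: "i < length xs \<Longrightarrow> signs xs ! i = (0 < turn xs i)"
  by (simp add: signs_def)

lemma polygon_edgesD:
  assumes "{a, b} \<in> polygon_edges xs"
  shows "\<exists>i<length xs. (a = xs ! i \<and> b = xs ! (Suc i mod length xs)) \<or>
    (b = xs ! i \<and> a = xs ! (Suc i mod length xs))"
  using assms unfolding polygon_edges_def by (auto simp: doubleton_eq_iff)

text \<open>A polygon with at least four vertices has as many edges as vertices and contains no
  three edges forming a triangle, so \<open>ears_exist\<close> applies. Every ear triangle arises
  from the index of its middle vertex, hence there are at least as many such indices.\<close>

lemma ears_polygon:
  assumes n: "4 \<le> length xs" and dist: "distinct xs" and gp: "general_position (set xs)"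
    and T: "positive_relation T" "T \<subseteq> set xs" and simple: "simple_polygon xs"
  shows "4 \<le> card {i. i < length xs \<and> ear xs i}"
proof -
  define n where "n = length xs"
  have n4: "4 \<le> n" using n unfolding n_def .
  have nthI: "xs ! i = xs ! j \<longleftrightarrow> i = j" if "i < n" "j < n" for i j
    using that dist by (simp add: n_def nth_eq_iff_index_eq)
  have nx: "Suc i mod n = (if Suc i = n then 0 else Suc i)" if "i < n" for i using that by auto
  have nxl: "Suc i mod n < n" for i using n4 by simp
  have edgeI: "{xs ! i, xs ! (Suc i mod n)} \<in> polygon_edges xs" if "i < n" for i
    using that unfolding polygon_edges_def n_def by blast
  have inj: "inj_on (\<lambda>i. {xs ! i, xs ! (Suc i mod n)}) {..<n}"
  proof (rule inj_onI)
    fix i j assume ij: "i \<in> {..<n}" "j \<in> {..<n}" "{xs ! i, xs ! (Suc i mod n)} = {xs ! j, xs ! (Suc j mod n)}"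
    then have "i = j \<or> (i = Suc j mod n \<and> Suc i mod n = j)"
      using nthI nxl by (auto simp: doubleton_eq_iff)
    then show "i = j" using ij(1,2) n4 nx[of i] nx[of j] by (auto split: if_splits)
  qed
  have cardE: "card (polygon_edges xs) = card (set xs)"
    using card_image[OF inj] distinct_card[OF dist] unfolding polygon_edges_def n_def by simp
  have no_triangle: False if abc: "{a, b} \<in> polygon_edges xs" "{a, c} \<in> polygon_edges xs" "{b, c} \<in> polygon_edges xs"
    for a b c
  proof -
    have idx: "\<exists>i j. i < n \<and> j < n \<and> a = xs ! i \<and> b = xs ! j \<and> (j = Suc i mod n \<or> i = Suc j mod n)"
      if "{a, b} \<in> polygon_edges xs" for a b
      using polygon_edgesD[OF that, folded n_def] nxl by blast
    obtain i j where 1: "i < n" "j < n" "a = xs ! i" "b = xs ! j" "j = Suc i mod n \<or> i = Suc j mod n"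
      using idx[OF abc(1)] by blast
    obtain i' k where 2: "i' < n" "k < n" "a = xs ! i'" "c = xs ! k" "k = Suc i' mod n \<or> i' = Suc k mod n"
      using idx[OF abc(2)] by blast
    obtain j' k' where 3: "j' < n" "k' < n" "b = xs ! j'" "c = xs ! k'" "k' = Suc j' mod n \<or> j' = Suc k' mod n"
      using idx[OF abc(3)] by blast
    have "i' = i" "j' = j" "k' = k" using 1 2 3 nthI by simp_all
    then show False using 1 2 3 nx[of i] nx[of j] nx[of k] n4 by (auto split: if_splits)
  qed
  have "4 \<le> card {t. \<exists>a b c. t = {a, b, c} \<and> {a, b} \<in> polygon_edges xs \<and> {b, c} \<in> polygon_edges xs
      \<and> a \<noteq> c \<and> (\<forall>x\<in>set xs. \<not> in_triangle x a b c)}"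
  proof (rule ears_exist)
    show "finite (set xs)" by simp
    show "general_position (set xs)" by fact
    show "\<exists>x\<in>set xs. 0 < det3 a b x" if "a \<in> set xs" "b \<in> set xs" "a \<noteq> b" for a b
      using positive_relation_spanning[OF gp T that] .
    show "polygon_edges xs \<noteq> {}" using edgeI[of 0] n4 by auto
    show "card (polygon_edges xs) = card (set xs)" by fact
    show "\<exists>a b. e = {a, b} \<and> a \<in> set xs \<and> b \<in> set xs \<and> a \<noteq> b" if e: "e \<in> polygon_edges xs" for e
    proof -
      obtain i where i: "i < n" "e = {xs ! i, xs ! (Suc i mod n)}"
        using e unfolding polygon_edges_def n_def by blast
      have "i \<noteq> Suc i mod n" using nx[OF i(1)] i n4 by auto
      then have "xs ! i \<noteq> xs ! (Suc i mod n)" using nthI[OF i(1) nxl] by blast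
      moreover have "xs ! i \<in> set xs" "xs ! (Suc i mod n) \<in> set xs" using i nxl unfolding n_def by simp_all
      ultimately show ?thesis using i by blast
    qed
    show "\<not> crossing a b c d" if "{a, b} \<in> polygon_edges xs" "{c, d} \<in> polygon_edges xs" "distinct [a, b, c, d]"
      for a b c d using simple that unfolding simple_polygon_def by blast
    show "{a, b} \<in> polygon_edges xs \<Longrightarrow> {a, c} \<in> polygon_edges xs \<Longrightarrow> {b, c} \<in> polygon_edges xs \<Longrightarrow> False"
      for a b c by (rule no_triangle)
  qed
  also have "\<dots> \<le> card {i. i < n \<and> ear xs i}"
  proof (rule surj_card_le)
    show "finite {i. i < n \<and> ear xs i}" by simp
    show "{t. \<exists>a b c. t = {a, b, c} \<and> {a, b} \<in> polygon_edges xs \<and> {b, c} \<in> polygon_edges xs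
      \<and> a \<noteq> c \<and> (\<forall>x\<in>set xs. \<not> in_triangle x a b c)}
      \<subseteq> (\<lambda>i. {xs ! ((i + n - 1) mod n), xs ! i, xs ! (Suc i mod n)}) ` {i. i < n \<and> ear xs i}"
    proof
      fix t assume "t \<in> {t. \<exists>a b c. t = {a, b, c} \<and> {a, b} \<in> polygon_edges xs \<and> {b, c} \<in> polygon_edges xs
        \<and> a \<noteq> c \<and> (\<forall>x\<in>set xs. \<not> in_triangle x a b c)}"
      then obtain a b c where t: "t = {a, b, c}" "{a, b} \<in> polygon_edges xs" "{b, c} \<in> polygon_edges xs"
        "a \<noteq> c" "\<forall>x\<in>set xs. \<not> in_triangle x a b c"
        unfolding mem_Collect_eq by (elim exE conjE)
      have pv: "(i + n - 1) mod n = j" if "i = Suc j mod n" "j < n" for i j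
        using that nx[OF that(2)] by (auto split: if_splits)
      obtain j where j: "j < n" "(a = xs ! j \<and> b = xs ! (Suc j mod n)) \<or> (b = xs ! j \<and> a = xs ! (Suc j mod n))"
        using polygon_edgesD[OF t(2), folded n_def] by blast
      obtain k where k: "k < n" "(b = xs ! k \<and> c = xs ! (Suc k mod n)) \<or> (c = xs ! k \<and> b = xs ! (Suc k mod n))"
        using polygon_edgesD[OF t(3), folded n_def] by blast
      have "\<exists>i<n. b = xs ! i \<and> ((a = xs ! ((i + n - 1) mod n) \<and> c = xs ! (Suc i mod n)) \<or>
          (c = xs ! ((i + n - 1) mod n) \<and> a = xs ! (Suc i mod n)))"
      proof -
        consider "a = xs ! j" "b = xs ! (Suc j mod n)" "b = xs ! k" "c = xs ! (Suc k mod n)"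
          | "a = xs ! j" "b = xs ! (Suc j mod n)" "c = xs ! k" "b = xs ! (Suc k mod n)"
          | "b = xs ! j" "a = xs ! (Suc j mod n)" "b = xs ! k" "c = xs ! (Suc k mod n)"
          | "b = xs ! j" "a = xs ! (Suc j mod n)" "c = xs ! k" "b = xs ! (Suc k mod n)"
          using j(2) k(2) by blast
        then show ?thesis
        proof cases
          case 1
          then have "xs ! k = xs ! (Suc j mod n)" by simp
          then have "k = Suc j mod n" using nthI[OF k(1) nxl] by blast
          from pv[OF this j(1)] show ?thesis using 1 k(1) by (intro exI[of _ k]) simp
        next
          case 2
          then have "Suc k mod n = Suc j mod n" using nthI[OF nxl nxl] by simp
          then have "k = j" using nx[OF k(1)] nx[OF j(1)] by (auto split: if_splits)
          then show ?thesis using 2 t(4) by simp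
        next
          case 3
          then have "k = j" using nthI[OF k(1) j(1)] by simp
          then show ?thesis using 3 t(4) by simp
        next
          case 4
          then have "xs ! j = xs ! (Suc k mod n)" by simp
          then have "j = Suc k mod n" using nthI[OF j(1) nxl] by blast
          from pv[OF this k(1)] show ?thesis using 4 j(1) by (intro exI[of _ j]) simp
        qed
      qed
      then obtain i where i: "i < n" "b = xs ! i" "(a = xs ! ((i + n - 1) mod n) \<and> c = xs ! (Suc i mod n)) \<or>
          (c = xs ! ((i + n - 1) mod n) \<and> a = xs ! (Suc i mod n))" by blast
      have "in_triangle x c b a = in_triangle x a b c" for x using in_triangle_perm by blast
      then have "ear xs i" using i t(5) unfolding ear_def n_def[symmetric] by auto
      moreover have "t = {xs ! ((i + n - 1) mod n), xs ! i, xs ! (Suc i mod n)}" using i t(1) by auto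
      ultimately show "t \<in> (\<lambda>i. {xs ! ((i + n - 1) mod n), xs ! i, xs ! (Suc i mod n)}) ` {i. i < n \<and> ear xs i}"
        using i(1) by blast
    qed
  qed
  finally show ?thesis unfolding n_def .
qed

section \<open>Invariance under cyclic rotation\<close>

lemma alternating_rotate1:
  assumes "alternating (rotate1 bs)"
  shows "alternating bs"
proof (cases bs)
  case Nil
  then show ?thesis using assms by (simp add: alternating_def)
next
  case (Cons b cs)
  obtain i j k l where *: "i < j" "j < k" "k < l" "l < Suc (length cs)"
    "(cs @ [b]) ! i \<noteq> (cs @ [b]) ! j" "(cs @ [b]) ! j \<noteq> (cs @ [b]) ! k" "(cs @ [b]) ! k \<noteq> (cs @ [b]) ! l"
    using assms unfolding alternating_def Cons by auto
  show ?thesis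
  proof (cases "l = length cs")
    case True
    \<comment> \<open>The wrapped entry differs from the third, hence equals the second and differs
      from the first: there are only two values.\<close>
    then have "bs ! 0 \<noteq> bs ! Suc i" "bs ! Suc i \<noteq> bs ! Suc j" "bs ! Suc j \<noteq> bs ! Suc k"
      using * unfolding Cons by (auto simp: nth_append)
    then show ?thesis unfolding alternating_def using * True Cons
      by (intro exI[of _ 0] exI[of _ "Suc i"] exI[of _ "Suc j"] exI[of _ "Suc k"]) auto
  next
    case False
    then have "bs ! Suc i \<noteq> bs ! Suc j" "bs ! Suc j \<noteq> bs ! Suc k" "bs ! Suc k \<noteq> bs ! Suc l"
      using * unfolding Cons by (auto simp: nth_append)
    then show ?thesis unfolding alternating_def using * False Cons
      by (intro exI[of _ "Suc i"] exI[of _ "Suc j"] exI[of _ "Suc k"] exI[of _ "Suc l"]) auto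
  qed
qed

lemma signs_rotate1: "signs (rotate1 xs) = rotate1 (signs xs)"
proof (rule nth_equalityI)
  fix i assume "i < length (signs (rotate1 xs))"
  then have i: "i < length xs" by simp
  define n where "n = length xs"
  have n: "0 < n" "i < n" using i unfolding n_def by auto
  have m: "Suc i mod n < n" "(i + n - 1) mod n < n" using n by auto
  have p: "Suc ((i + n - 1) mod n) mod n = i" using n by (simp add: mod_Suc_eq)
  have q: "(Suc i mod n + n - 1) mod n = i"
  proof (cases "Suc i = n")
    case False
    then have "Suc i mod n = Suc i" using n by simp
    then show ?thesis using n by simp
  qed (use n in auto)
  have "turn (rotate1 xs) i = turn xs (Suc i mod n)"
    unfolding turn_def length_rotate1 n_def[symmetric]
    using n m p q by (simp add: nth_rotate1 n_def[symmetric])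
  then show "signs (rotate1 xs) ! i = rotate1 (signs xs) ! i"
    using i m unfolding n_def by (simp add: nth_signs nth_rotate1)
qed simp

lemma alternating_rotate: "alternating (signs (rotate k xs)) \<Longrightarrow> alternating (signs xs)"
proof (induction k)
  case (Suc k)
  then have "alternating (rotate1 (signs (rotate k xs)))" by (simp add: signs_rotate1)
  then show ?case using Suc.IH alternating_rotate1 by blast
qed simp

lemma polygon_edges_rotate1: "polygon_edges (rotate1 xs) = polygon_edges xs"
proof -
  define n where "n = length xs"
  have "polygon_edges (rotate1 xs) = (\<lambda>i. {xs ! (Suc i mod n), xs ! (Suc (Suc i mod n) mod n)}) ` {..<n}"
    unfolding polygon_edges_def length_rotate1 n_def[symmetric]
  proof (intro image_cong refl)
    fix i assume "i \<in> {..<n}"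
    then have "i < length xs" "Suc i mod n < length xs" by (simp_all flip: n_def)
    then show "{rotate1 xs ! i, rotate1 xs ! (Suc i mod n)} = {xs ! (Suc i mod n), xs ! (Suc (Suc i mod n) mod n)}"
      by (simp only: nth_rotate1 n_def)
  qed
  also have "\<dots> = (\<lambda>i. {xs ! i, xs ! (Suc i mod n)}) ` (\<lambda>i. Suc i mod n) ` {..<n}"
    by (simp add: image_image)
  also have "(\<lambda>i. Suc i mod n) ` {..<n} = {..<n}"
  proof
    show "{..<n} \<subseteq> (\<lambda>i. Suc i mod n) ` {..<n}"
    proof
      fix i assume "i \<in> {..<n}"
      then have "i = Suc ((i + n - 1) mod n) mod n" "(i + n - 1) mod n < n" by (auto simp: mod_Suc_eq)
      then show "i \<in> (\<lambda>i. Suc i mod n) ` {..<n}" by blast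
    qed
  qed auto
  finally show ?thesis unfolding polygon_edges_def n_def .
qed

lemma polygon_edges_rotate: "polygon_edges (rotate k xs) = polygon_edges xs"
  by (induction k) (simp_all add: polygon_edges_rotate1)

lemma ear_rotate:
  assumes "i < length xs" "ear xs i"
  shows "ear (rotate i xs) 0"
proof -
  define n where "n = length xs"
  have n: "i < n" using assms unfolding n_def by simp
  have "(0 + n - 1) mod n = n - 1" using n by simp
  moreover have "rotate i xs ! (n - 1) = xs ! ((i + n - 1) mod n)" using n by (simp add: nth_rotate n_def)
  moreover have "rotate i xs ! 0 = xs ! i" using n nth_rotate[of 0 xs i] by (cases xs) (auto simp: n_def)
  moreover have "rotate i xs ! (Suc 0 mod n) = xs ! (Suc i mod n)"
    using n by (simp add: nth_rotate n_def mod_add_right_eq)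
  ultimately show ?thesis using assms(2) unfolding ear_def set_rotate length_rotate n_def[symmetric] by simp
qed

section \<open>The effect of removing one ear\<close>

text \<open>If the turn at the neighbour \<open>q\<close> agrees with the turn at the tip
  \<open>v\<close>, it keeps its sign after the cut. In the basis \<open>p\<close>,
  \<open>v\<close>, \<open>q\<close>, agreement means that \<open>r\<close> has \<alpha> > 0, and a
  reversed turn would give \<beta> > 0. Then \<open>r\<close> lies inside the ear or the edge
  \<open>q r\<close> crosses \<open>p v\<close>, depending on the sign of \<gamma>.\<close>

lemma ear_turn:
  assumes gp: "general_position V" and V: "p \<in> V" "v \<in> V" "q \<in> V" "r \<in> V" "distinct [p, v, q, r]"
    and e: "\<not> in_triangle r p v q" and nc: "\<not> crossing q r p v" and s: "0 < det3 p v q * det3 v q r"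
  shows "0 < det3 p v q * det3 p q r"
proof (rule ccontr)
  assume neg: "\<not> ?thesis"
  have D: "det3 p v q \<noteq> 0" "det3 p q r \<noteq> 0" "det3 p v r \<noteq> 0"
    using general_positionD[OF gp] V by auto
  obtain \<alpha> \<beta> \<gamma> where r: "r = \<alpha> *\<^sub>R p + \<beta> *\<^sub>R v + \<gamma> *\<^sub>R q" using coordinates_obtain[OF D(1)] by blast
  have 1: "det3 v q r = \<alpha> * det3 p v q" unfolding r using det3_rotate[of v q p] by simp
  have 2: "det3 p q r = - \<beta> * det3 p v q" unfolding r using det3_swap(2)[of p q v] by simp
  have 3: "det3 p v r = \<gamma> * det3 p v q" unfolding r by simp
  have sq: "0 < det3 p v q * det3 p v q" using D(1) not_real_square_gt_zero by blast
  have "0 < \<alpha> * (det3 p v q * det3 p v q)" using s unfolding 1 by (simp add: mult_ac)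
  then have \<alpha>: "0 < \<alpha>" using sq by (simp add: zero_less_mult_iff)
  have "0 \<le> \<beta> * (det3 p v q * det3 p v q)" using neg unfolding 2 by (simp add: mult_ac)
  then have "0 \<le> \<beta>" using sq by (simp add: zero_le_mult_iff)
  then have \<beta>: "0 < \<beta>" using D(2) unfolding 2 by (cases "\<beta> = 0") auto
  have "\<gamma> \<noteq> 0" using D(3) unfolding 3 by auto
  then consider "0 < \<gamma>" | "\<gamma> < 0" by linarith
  then show False
  proof cases
    case 1
    then show False using e \<alpha> \<beta> r unfolding in_triangle_def by blast
  next
    case 2
    have "(- \<gamma>) *\<^sub>R q + 1 *\<^sub>R r = \<alpha> *\<^sub>R p + \<beta> *\<^sub>R v" by (simp add: r)
    then have "crossing q r p v" by (rule crossingI) (use 2 \<alpha> \<beta> in auto)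
    then show False using nc by blast
  qed
qed

text \<open>An edge across \<open>p q\<close> enters the ear; by \<open>segment_exit\<close> it
  would have to end inside or leave across \<open>p v\<close> or \<open>v q\<close>.\<close>

lemma ear_shortcut:
  assumes gp: "general_position V" and V: "p \<in> V" "v \<in> V" "q \<in> V" "y \<in> V" "z \<in> V" "distinct [p, v, q, y, z]"
    and e: "\<And>x. x \<in> V \<Longrightarrow> \<not> in_triangle x p v q"
    and nc: "\<not> crossing y z p v" "\<not> crossing y z v q"
  shows "\<not> crossing p q y z"
proof
  assume "crossing p q y z"
  then obtain P Q s t where *: "0 < P" "0 < Q" "0 < s" "0 < t" "P *\<^sub>R p + Q *\<^sub>R q = s *\<^sub>R y + t *\<^sub>R z"
    unfolding crossing_def by blast
  have D: "det3 p v q \<noteq> 0" using general_positionD[OF gp] V by auto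
  have key: False
    if V': "y \<in> V" "z \<in> V" "distinct [p, v, q, y, z]"
      and nc: "\<not> crossing y z p v" "\<not> crossing y z v q" and st: "0 < s" "0 < t"
      and eq: "s *\<^sub>R y + t *\<^sub>R z = P *\<^sub>R p + Q *\<^sub>R q"
      and up: "0 < det3 p z q / det3 p v q" for y z s t
  proof -
    obtain \<alpha> \<beta> \<gamma> where z: "z = \<alpha> *\<^sub>R p + \<beta> *\<^sub>R v + \<gamma> *\<^sub>R q" using coordinates_obtain[OF D] by blast
    have 1: "det3 z v q = \<alpha> * det3 p v q" "det3 p z q = \<beta> * det3 p v q" "det3 p v z = \<gamma> * det3 p v q"
      unfolding z by simp_all
    have nz: "det3 z v q \<noteq> 0" "det3 p v z \<noteq> 0" "det3 v y z \<noteq> 0"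
      using general_positionD[OF gp] V V' by auto
    have "0 < \<beta>" using up D unfolding 1 by simp
    have eq': "s *\<^sub>R y + t *\<^sub>R z = P *\<^sub>R p + 0 *\<^sub>R v + Q *\<^sub>R q" using eq by simp
    have "0 < \<alpha> \<and> 0 < \<gamma>"
      by (rule segment_exit[where \<kappa> = 0, OF eq' z st *(1,2)]) (use nz \<open>0 < \<beta>\<close> nc in \<open>auto simp: 1\<close>)
    then have "in_triangle z p v q" using z \<open>0 < \<beta>\<close> unfolding in_triangle_def by blast
    then show False using e V' by blast
  qed
  have "det3 p (P *\<^sub>R p + Q *\<^sub>R q) q = 0" by simp
  then have "s * det3 p y q + t * det3 p z q = 0" unfolding *(5) by simp
  then have sum: "s * (det3 p y q / det3 p v q) + t * (det3 p z q / det3 p v q) = 0"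
    using D by (simp add: field_simps)
  have "det3 p z q \<noteq> 0" using general_positionD[OF gp] V by auto
  then have "det3 p z q / det3 p v q \<noteq> 0" using D by simp
  then consider "0 < det3 p z q / det3 p v q" | "det3 p z q / det3 p v q < 0" by linarith
  then show False
  proof cases
    case 1
    then show False using key[of y z s t] V nc * by auto
  next
    case 2
    then have "t * (det3 p z q / det3 p v q) < 0" using *(4) by (rule mult_pos_neg[rotated])
    then have "0 < s * (det3 p y q / det3 p v q)" using sum by linarith
    then have "0 < det3 p y q / det3 p v q" using *(3) by (simp only: zero_less_mult_iff) auto
    moreover have "t *\<^sub>R z + s *\<^sub>R y = P *\<^sub>R p + Q *\<^sub>R q" using *(5) by (simp add: add.commute)
    ultimately show False using key[of z y t s] V nc *(3,4) by (auto simp: crossing_commute)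
  qed
qed

text \<open>\<sigma> is the sign at the removed tip. By \<open>ends\<close>, an end entry changed by
  the cut has become \<sigma>, so in an alternating quadruple the new head can take its place. The
  two ends are never replaced together, since the outer ones of four alternating truth values
  differ.\<close>

lemma alternating_Cons:
  assumes len: "length bs = m" "length bs' = m"
    and mid: "\<And>i. 0 < i \<Longrightarrow> i < m - 1 \<Longrightarrow> bs' ! i = bs ! i"
    and ends: "bs ! 0 = \<sigma> \<Longrightarrow> bs' ! 0 = \<sigma>" "bs ! (m - 1) = \<sigma> \<Longrightarrow> bs' ! (m - 1) = \<sigma>"
    and alt: "alternating bs'"
  shows "alternating (\<sigma> # bs)"
proof -
  obtain i j k l where *: "i < j" "j < k" "k < l" "l < m" "bs' ! i \<noteq> bs' ! j" "bs' ! j \<noteq> bs' ! k" "bs' ! k \<noteq> bs' ! l"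
    using alt unfolding alternating_def len by blast
  have jk: "bs' ! j = bs ! j" "bs' ! k = bs ! k" using mid * by auto
  have i: "bs' ! i = bs ! i \<or> i = 0 \<and> bs' ! i = \<sigma>" using mid[of i] ends(1) * by (cases "i = 0") auto
  have l: "bs' ! l = bs ! l \<or> l = m - 1 \<and> bs' ! l = \<sigma>" using mid[of l] ends(2) * by (cases "l = m - 1") auto
  consider "bs' ! i = bs ! i" "bs' ! l = bs ! l" | "bs' ! i = \<sigma>" "bs' ! l = bs ! l" | "bs' ! i = bs ! i" "bs' ! l = \<sigma>"
    using i l * by auto
  then show ?thesis
  proof cases
    case 1
    then show ?thesis unfolding alternating_def using * jk len
      by (intro exI[of _ "Suc i"] exI[of _ "Suc j"] exI[of _ "Suc k"] exI[of _ "Suc l"]) auto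
  next
    case 2
    then show ?thesis unfolding alternating_def using * jk len
      by (intro exI[of _ 0] exI[of _ "Suc j"] exI[of _ "Suc k"] exI[of _ "Suc l"]) auto
  next
    case 3
    then show ?thesis unfolding alternating_def using * jk len
      by (intro exI[of _ 0] exI[of _ "Suc i"] exI[of _ "Suc j"] exI[of _ "Suc k"]) auto
  qed
qed

text \<open>With the tip at the head of the list, cutting it off means taking the tail, and the only
  new edge joins the last and first vertices of \<open>ys\<close>.\<close>

context
  fixes v :: "real ^ 3" and ys :: "(real ^ 3) list" and m :: nat
  assumes m: "length ys = m" "4 \<le> m" and dist: "distinct (v # ys)"
    and gp: "general_position (set (v # ys))" and simple: "simple_polygon (v # ys)" and ear0: "ear (v # ys) 0"
begin

lemma nth_ys_V: "i < m \<Longrightarrow> ys ! i \<in> set (v # ys)"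
  using m by simp

lemma nth_ys_eq: "i < m \<Longrightarrow> j < m \<Longrightarrow> ys ! i = ys ! j \<longleftrightarrow> i = j"
  using m dist by (simp add: nth_eq_iff_index_eq)

lemma nth_ys_neq: "i < m \<Longrightarrow> ys ! i \<noteq> v"
  using m dist by auto

lemma edges_Cons:
  "Suc i < m \<Longrightarrow> {ys ! i, ys ! Suc i} \<in> polygon_edges (v # ys)"
  "{v, ys ! 0} \<in> polygon_edges (v # ys)"
  "{ys ! (m - 1), v} \<in> polygon_edges (v # ys)"
proof -
  have e: "{(v # ys) ! i, (v # ys) ! (Suc i mod Suc m)} \<in> polygon_edges (v # ys)" if "i < Suc m" for i
    using that m unfolding polygon_edges_def by auto
  show "Suc i < m \<Longrightarrow> {ys ! i, ys ! Suc i} \<in> polygon_edges (v # ys)" using e[of "Suc i"] by simp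
  show "{v, ys ! 0} \<in> polygon_edges (v # ys)" using e[of 0] m by simp
  show "{ys ! (m - 1), v} \<in> polygon_edges (v # ys)" using e[of m] m by simp
qed

lemma noncrossing_Cons:
  "{a, b} \<in> polygon_edges (v # ys) \<Longrightarrow> {c, d} \<in> polygon_edges (v # ys) \<Longrightarrow> distinct [a, b, c, d]
    \<Longrightarrow> \<not> crossing a b c d"
  using simple unfolding simple_polygon_def by blast

lemma edges_tail:
  assumes "e \<in> polygon_edges ys"
  shows "e = {ys ! (m - 1), ys ! 0} \<or> e \<in> polygon_edges (v # ys)"
proof -
  obtain i where i: "i < m" "e = {ys ! i, ys ! (Suc i mod m)}"
    using assms m unfolding polygon_edges_def by blast
  show ?thesis
  proof (cases "Suc i = m")
    case True
    then have "i = m - 1" "Suc i mod m = 0" by simp_all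
    then show ?thesis using i by simp
  next
    case False
    then show ?thesis using edges_Cons(1)[of i] i by simp
  qed
qed

lemma ear_empty: "x \<in> set (v # ys) \<Longrightarrow> \<not> in_triangle x (ys ! (m - 1)) v (ys ! 0)"
  using ear0 m unfolding ear_def by auto

lemma simple_tail: "simple_polygon ys"
proof -
  define p q where "p = ys ! (m - 1)" and "q = ys ! 0"
  have pq: "p \<in> set (v # ys)" "q \<in> set (v # ys)" "p \<noteq> q" "p \<noteq> v" "q \<noteq> v"
    unfolding p_def q_def using m nth_ys_V nth_ys_eq[of "m - 1" 0] nth_ys_neq by auto
  have *: "\<not> crossing p q c d" if cd: "{c, d} \<in> polygon_edges ys" "distinct [p, q, c, d]" for c d
  proof -
    have "{c, d} \<noteq> {p, q}" using cd(2) by auto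
    then have cde: "{c, d} \<in> polygon_edges (v # ys)" using edges_tail[OF cd(1)] unfolding p_def q_def by auto
    have "c \<in> set ys" "d \<in> set ys" using polygon_edgesD[OF cd(1)] m by (auto intro!: nth_mem mod_less_divisor)
    then have V: "c \<in> set (v # ys)" "d \<in> set (v # ys)" "c \<noteq> v" "d \<noteq> v" using dist by auto
    show ?thesis
    proof (rule ear_shortcut[OF gp pq(1) _ pq(2) V(1,2)])
      show "v \<in> set (v # ys)" by simp
      show "distinct [p, v, q, c, d]" using V pq cd by auto
      show "\<not> in_triangle x p v q" if "x \<in> set (v # ys)" for x using ear_empty[OF that] unfolding p_def q_def .
      show "\<not> crossing c d p v" using noncrossing_Cons[OF cde edges_Cons(3)] V cd pq unfolding p_def by auto
      show "\<not> crossing c d v q" using noncrossing_Cons[OF cde edges_Cons(2)] V cd pq unfolding q_def by auto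
    qed
  qed
  have pqI: "(a = p \<and> b = q) \<or> (a = q \<and> b = p)" if "{a, b} = {p, q}" for a b
    using that by (simp add: doubleton_eq_iff)
  show ?thesis unfolding simple_polygon_def
  proof (intro allI impI)
    fix a b c d assume ab: "{a, b} \<in> polygon_edges ys" and cd: "{c, d} \<in> polygon_edges ys"
      and dd: "distinct [a, b, c, d]"
    consider "{a, b} = {p, q}" | "{c, d} = {p, q}"
      | "{a, b} \<in> polygon_edges (v # ys)" "{c, d} \<in> polygon_edges (v # ys)"
      using edges_tail[OF ab] edges_tail[OF cd] unfolding p_def q_def by blast
    then show "\<not> crossing a b c d"
    proof cases
      case 1
      then show ?thesis using pqI[OF 1] *[OF cd] dd crossing_commute by auto
    next
      case 2
      then have "\<not> crossing c d a b" using pqI[OF 2] *[OF ab] dd crossing_commute by auto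
      then show ?thesis using crossing_sym by blast
    next
      case 3
      then show ?thesis using noncrossing_Cons dd by blast
    qed
  qed
qed

lemma alternating_tail:
  assumes "alternating (signs ys)"
  shows "alternating (signs (v # ys))"
proof -
  define p q where "p = ys ! (m - 1)" and "q = ys ! 0"
  have V: "p \<in> set (v # ys)" "q \<in> set (v # ys)" "v \<in> set (v # ys)" "p \<noteq> q" "p \<noteq> v" "q \<noteq> v"
    unfolding p_def q_def using m nth_ys_V nth_ys_eq[of "m - 1" 0] nth_ys_neq by auto
  define r r' where "r = ys ! 1" and "r' = ys ! (m - 2)"
  have r: "r \<in> set (v # ys)" "r \<noteq> v" "r \<noteq> p" "r \<noteq> q"
    unfolding r_def p_def q_def using m nth_ys_V[of 1] nth_ys_neq[of 1] nth_ys_eq[of 1 0] nth_ys_eq[of 1 "m - 1"] by auto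
  have r': "r' \<in> set (v # ys)" "r' \<noteq> v" "r' \<noteq> p" "r' \<noteq> q"
    unfolding r'_def p_def q_def
    using m nth_ys_V[of "m - 2"] nth_ys_neq[of "m - 2"] nth_ys_eq[of "m - 2" 0] nth_ys_eq[of "m - 2" "m - 1"] by auto
  have D: "det3 p v q \<noteq> 0" "det3 v q r \<noteq> 0" "det3 p q r \<noteq> 0" "det3 r' p v \<noteq> 0" "det3 r' p q \<noteq> 0"
    using general_positionD[OF gp] V r r' by auto
  have same: "(0 < x) = (0 < y) \<longleftrightarrow> 0 < y * x" if "x \<noteq> 0" "y \<noteq> 0" for x y :: real
    using that by (auto simp: zero_less_mult_iff)
  have qr: "{q, r} \<in> polygon_edges (v # ys)" using edges_Cons(1)[of 0] m unfolding q_def r_def by simp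
  have "Suc (m - 2) = m - 1" using m by simp
  then have pr': "{p, r'} \<in> polygon_edges (v # ys)"
    using edges_Cons(1)[of "m - 2"] m unfolding p_def r'_def by (simp add: insert_commute)
  have pv: "{p, v} \<in> polygon_edges (v # ys)" "{q, v} \<in> polygon_edges (v # ys)"
    using edges_Cons(2,3) unfolding p_def q_def by (simp_all add: insert_commute)
  have first: "(0 < det3 p q r) = (0 < det3 p v q)" if "(0 < det3 v q r) = (0 < det3 p v q)"
  proof -
    have "0 < det3 p v q * det3 p q r"
    proof (rule ear_turn[OF gp V(1,3,2) r(1)])
      show "distinct [p, v, q, r]" using V r by auto
      show "\<not> in_triangle r p v q" using ear_empty[OF r(1)] unfolding p_def q_def .
      show "\<not> crossing q r p v" using noncrossing_Cons[OF qr pv(1)] V r by auto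
      show "0 < det3 p v q * det3 v q r" using that same D by blast
    qed
    then show ?thesis using same D by blast
  qed
  \<comment> \<open>Mirror image of \<open>first\<close>: reversing the order negates all three
    determinants and preserves their products.\<close>
  have last: "(0 < det3 r' p q) = (0 < det3 p v q)" if "(0 < det3 r' p v) = (0 < det3 p v q)"
  proof -
    have sw: "det3 q v p = - det3 p v q" "det3 v p r' = - det3 r' p v" "det3 q p r' = - det3 r' p q"
      using det3_swap(3) by blast+
    have "0 < det3 q v p * det3 q p r'"
    proof (rule ear_turn[OF gp V(2,3,1) r'(1)])
      show "distinct [q, v, p, r']" using V r' by auto
      have "in_triangle r' q v p = in_triangle r' p v q" using in_triangle_perm by blast
      then show "\<not> in_triangle r' q v p" using ear_empty[OF r'(1)] unfolding p_def q_def by simp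
      show "\<not> crossing p r' q v" using noncrossing_Cons[OF pr' pv(2)] V r' by auto
      have "0 < det3 p v q * det3 r' p v" using that same D by blast
      then show "0 < det3 q v p * det3 v p r'" unfolding sw by simp
    qed
    then have "0 < det3 p v q * det3 r' p q" unfolding sw by simp
    then show ?thesis using same D by blast
  qed
  define bs where "bs = map (\<lambda>i. 0 < turn (v # ys) (Suc i)) [0..<m]"
  have sg: "signs (v # ys) = (0 < turn (v # ys) 0) # bs"
    unfolding signs_def bs_def using m by (simp add: map_upt_Suc del: upt_Suc)
  have t0: "turn (v # ys) 0 = det3 p v q" using m unfolding turn_def p_def q_def by (simp add: nth_Cons')
  have t1: "turn (v # ys) (Suc 0) = det3 v q r" using m unfolding turn_def r_def q_def by simp
  have tm: "turn (v # ys) m = det3 r' p v"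
  proof -
    have "(m + Suc m - 1) mod Suc m = (m - 1 + Suc m) mod Suc m" using m by (intro arg_cong2[of _ _ _ _ "(mod)"]) auto
    also have "\<dots> = m - 1" unfolding mod_add_self2 by (rule mod_less) simp
    finally show ?thesis using m unfolding turn_def p_def r'_def by (simp add: nth_Cons' numeral_2_eq_2)
  qed
  have t0': "turn ys 0 = det3 p q r" using m unfolding turn_def p_def q_def r_def by simp
  have tm': "turn ys (m - 1) = det3 r' p q"
  proof -
    have "(m - 1 + m - 1) mod m = (m - 2 + m) mod m" using m by (intro arg_cong2[of _ _ _ _ "(mod)"]) auto
    also have "\<dots> = m - 2" unfolding mod_add_self2 by (rule mod_less) (use m in simp)
    finally show ?thesis using m unfolding turn_def p_def q_def r'_def by simp
  qed
  have ti: "turn (v # ys) (Suc i) = turn ys i" if "0 < i" "i < m - 1" for i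
  proof -
    have "(i + m - 1) mod m = (i - 1 + m) mod m" using that by (intro arg_cong2[of _ _ _ _ "(mod)"]) auto
    also have "\<dots> = i - 1" unfolding mod_add_self2 by (rule mod_less) (use that in simp)
    finally have 1: "(i + m - 1) mod m = i - 1" .
    have "(Suc i + Suc m - 1) mod Suc m = (i + Suc m) mod Suc m" by simp
    also have "\<dots> = i" unfolding mod_add_self2 by (rule mod_less) (use that in simp)
    finally have 2: "(Suc i + Suc m - 1) mod Suc m = i" .
    show ?thesis using 1 2 that m unfolding turn_def by (simp add: nth_Cons')
  qed
  have bsI: "bs ! i = (0 < turn (v # ys) (Suc i))" if "i < m" for i using that unfolding bs_def by simp
  show ?thesis unfolding sg t0
  proof (rule alternating_Cons[where bs' = "signs ys" and m = m])
    show "length bs = m" "length (signs ys) = m" unfolding bs_def using m by simp_all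
    show "signs ys ! i = bs ! i" if "0 < i" "i < m - 1" for i
      using that ti[of i] m bsI[of i] by (simp add: nth_signs)
    show "signs ys ! 0 = (0 < det3 p v q)" if "bs ! 0 = (0 < det3 p v q)"
      using that first m t1 t0' bsI[of 0] by (simp add: nth_signs)
    show "signs ys ! (m - 1) = (0 < det3 p v q)" if "bs ! (m - 1) = (0 < det3 p v q)"
      using that last m tm tm' bsI[of "m - 1"] by (simp add: nth_signs)
  qed fact
qed

end

section \<open>Induction on the number of vertices\<close>

theorem simple_polygon_alternating:
  assumes "4 \<le> length xs" "distinct xs" "general_position (set xs)"
    "positive_relation T" "T \<subseteq> set xs" "simple_polygon xs"
  shows "alternating (signs xs)"
  using assms
proof (induction "length xs" arbitrary: xs T rule: less_induct)
  case less
  note gp = less.prems(3)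
  obtain \<omega> where \<omega>: "card T = 4" "\<forall>v\<in>T. 0 < \<omega> v" "(\<Sum>v\<in>T. \<omega> v *\<^sub>R v) = 0"
    using less.prems(4) unfolding positive_relation_def by blast
  have card: "card (set xs) = length xs" using less.prems(2) distinct_card by blast
  show ?case
  proof (cases "length xs = 4")
    case True
    then have T: "T = set xs" using \<omega>(1) card less.prems(5) by (intro card_subset_eq) auto
    obtain a b c d where xs: "xs = [a, b, c, d]"
      using True by (auto simp: numeral_eq_Suc length_Suc_conv)
    have dd: "distinct [a, b, c, d]" using less.prems(2) xs by simp
    have sum: "\<omega> a *\<^sub>R a + \<omega> b *\<^sub>R b + \<omega> c *\<^sub>R c + \<omega> d *\<^sub>R d = 0"
      using \<omega>(3) dd unfolding T xs by (simp add: add_ac)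
    have pos: "0 < \<omega> a" "0 < \<omega> b" "0 < \<omega> c" "0 < \<omega> d" using \<omega>(2) unfolding T xs by auto
    have nz: "det3 d a b \<noteq> 0" "det3 a b c \<noteq> 0" "det3 b c d \<noteq> 0" "det3 c d a \<noteq> 0"
      using general_positionD[OF gp] dd unfolding xs by auto
    have opp: "(0 < x) \<noteq> (0 < y)" if "w * x + w' * y = 0" "0 < w" "0 < w'" "x \<noteq> 0" "y \<noteq> 0" for w w' x y :: real
    proof
      assume eq: "(0 < x) = (0 < y)"
      show False
      proof (cases "0 < x")
        case True
        then have "0 < w * x" "0 < w' * y" using eq that by simp_all
        then show False using that by linarith
      next
        case False
        then have "x < 0" "y < 0" using eq that by auto
        then have "w * x < 0" "w' * y < 0" using that by (simp_all add: mult_pos_neg)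
        then show False using that by linarith
      qed
    qed
    \<comment> \<open>Applying the determinant with two adjacent vertices to the relation leaves two
      terms, which are the turns at these vertices and must have opposite signs.\<close>
    have "\<omega> d * det3 d a b + \<omega> c * det3 a b c = 0"
      using arg_cong[OF sum, of "det3 a b"] det3_rotate[of a b d] by simp
    then have 1: "(0 < det3 d a b) \<noteq> (0 < det3 a b c)" using opp pos nz by blast
    have "\<omega> a * det3 a b c + \<omega> d * det3 b c d = 0"
      using arg_cong[OF sum, of "det3 b c"] det3_rotate[of b c a] by simp
    then have 2: "(0 < det3 a b c) \<noteq> (0 < det3 b c d)" using opp pos nz by blast
    have "\<omega> b * det3 b c d + \<omega> a * det3 c d a = 0"
      using arg_cong[OF sum, of "det3 c d"] det3_rotate[of c d b] by simp
    then have 3: "(0 < det3 b c d) \<noteq> (0 < det3 c d a)" using opp pos nz by blast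
    have "signs xs ! 0 = (0 < det3 d a b)" "signs xs ! 1 = (0 < det3 a b c)"
      "signs xs ! 2 = (0 < det3 b c d)" "signs xs ! 3 = (0 < det3 c d a)"
      unfolding xs by (simp_all add: nth_signs turn_def nth_Cons')
    then show ?thesis unfolding alternating_def using 1 2 3 True
      by (intro exI[of _ 0] exI[of _ 1] exI[of _ 2] exI[of _ 3]) simp
  next
    case False
    then have n5: "5 \<le> length xs" using less.prems(1) by simp
    have finT: "finite T" using less.prems(5) finite_subset by blast
    have "T \<noteq> set xs" using \<omega>(1) card n5 by auto
    then obtain x where x: "x \<in> set xs" "x \<notin> T" using less.prems(5) by blast
    obtain u where u: "u \<in> T" "positive_relation (insert x (T - {u}))"
      using positive_relation_exchange[OF gp less.prems(4,5) x] by blast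
    define K where "K = {i. i < length xs \<and> ear xs i}"
    have "4 \<le> card K" unfolding K_def using ears_polygon less.prems by blast
    moreover have "card ((!) xs ` K) = card K"
      using less.prems(2) by (intro card_image inj_onI) (auto simp: K_def nth_eq_iff_index_eq)
    moreover have "card (T - {u}) = 3" using \<omega>(1) u finT by simp
    \<comment> \<open>The relations on \<open>T\<close> and on \<open>insert x (T - {u})\<close>
      share only \<open>T - {u}\<close>. An ear tip outside these three vertices is missed by
      \<open>T\<close>, or it is \<open>u\<close> and is missed by the other.\<close>
    ultimately have "\<not> (!) xs ` K \<subseteq> T - {u}" using card_mono[of "T - {u}" "(!) xs ` K"] finT by auto
    then obtain i where i: "i < length xs" "ear xs i" "xs ! i \<notin> T - {u}" unfolding K_def by blast
    obtain T' where T': "positive_relation T'" "T' \<subseteq> set xs" "xs ! i \<notin> T'"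
    proof (cases "xs ! i \<in> T")
      case True
      then have "xs ! i \<notin> insert x (T - {u})" using i(3) x by auto
      then show ?thesis using that[OF u(2)] x less.prems(5) by blast
    next
      case False
      then show ?thesis using that less.prems by blast
    qed
    have len: "length (rotate i xs) = length xs" by simp
    then obtain v ys where zs: "rotate i xs = v # ys" using n5 by (cases "rotate i xs") auto
    have v: "v = xs ! i" using nth_rotate[of 0 xs i] i(1) zs by (cases xs) auto
    have set: "set (v # ys) = set xs" using zs set_rotate[of i xs] by simp
    have m: "4 \<le> length ys" "length ys < length xs" using len n5 zs by auto
    have dist: "distinct (v # ys)" using zs less.prems(2) distinct_rotate by metis
    have gp': "general_position (set (v # ys))" using gp set by simp
    have simple: "simple_polygon (v # ys)"
      using less.prems(6) polygon_edges_rotate[of i xs] unfolding zs simple_polygon_def by simp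
    have ear: "ear (v # ys) 0" using ear_rotate[OF i(1,2)] zs by simp
    have "alternating (signs ys)"
    proof (rule less.hyps[OF m(2,1)])
      show "distinct ys" using dist by simp
      show "general_position (set ys)" using general_position_subset[OF gp'] by auto
      show "positive_relation T'" by fact
      have "T' \<subseteq> insert v (set ys)" "v \<notin> T'" using T'(2,3) v set by simp_all
      then show "T' \<subseteq> set ys" by blast
      show "simple_polygon ys" using simple_tail[OF refl m(1) dist gp' simple ear] .
    qed
    then have "alternating (signs (v # ys))" using alternating_tail[OF refl m(1) dist gp' simple ear] by blast
    then show ?thesis using alternating_rotate zs by metis
  qed
qed

section \<open>Perturbation into general position\<close>

text \<open>Pascal's rule. Three applications turn an alternating binomial sum into one over third
  differences.\<close>

lemma alternating_binomial_Suc: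
  fixes g :: "nat \<Rightarrow> real"
  shows "(\<Sum>i\<le>Suc N. (- 1) ^ i * real (Suc N choose i) * g i)
    = (\<Sum>i\<le>N. (- 1) ^ i * real (N choose i) * (g i - g (Suc i)))"
proof -
  have "(\<Sum>i\<le>Suc N. (- 1) ^ i * real (Suc N choose i) * g i)
      = g 0 + (\<Sum>i\<le>N. (- 1) ^ Suc i * real (Suc N choose Suc i) * g (Suc i))"
    by (subst sum.atMost_Suc_shift) simp
  also have "(\<Sum>i\<le>N. (- 1) ^ Suc i * real (Suc N choose Suc i) * g (Suc i))
      = (\<Sum>i\<le>N. (- 1) ^ Suc i * real (N choose Suc i) * g (Suc i)) - (\<Sum>i\<le>N. (- 1) ^ i * real (N choose i) * g (Suc i))"
    by (subst sum_subtractf[symmetric], intro sum.cong refl) (simp add: algebra_simps)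
  also have "g 0 + (\<Sum>i\<le>N. (- 1) ^ Suc i * real (N choose Suc i) * g (Suc i))
      = (\<Sum>i\<le>Suc N. (- 1) ^ i * real (N choose i) * g i)"
    by (subst sum.atMost_Suc_shift) simp
  then have "g 0 + ((\<Sum>i\<le>N. (- 1) ^ Suc i * real (N choose Suc i) * g (Suc i)) - (\<Sum>i\<le>N. (- 1) ^ i * real (N choose i) * g (Suc i)))
      = (\<Sum>i\<le>Suc N. (- 1) ^ i * real (N choose i) * g i) - (\<Sum>i\<le>N. (- 1) ^ i * real (N choose i) * g (Suc i))"
    by simp
  also have "\<dots> = (\<Sum>i\<le>N. (- 1) ^ i * real (N choose i) * (g i - g (Suc i)))"
    by (simp add: sum_subtractf right_diff_distrib)
  finally show ?thesis .
qed

text \<open>The weights of a third difference annihilate the moment curve.\<close>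

lemma zero_sum_general_position:
  assumes n: "4 \<le> n"
  obtains f :: "nat \<Rightarrow> real ^ 3" where "(\<Sum>i<n. f i) = 0"
    "\<And>i j k. i < n \<Longrightarrow> j < n \<Longrightarrow> k < n \<Longrightarrow> distinct [i, j, k] \<Longrightarrow> det3 (f i) (f j) (f k) \<noteq> 0"
proof -
  obtain N where "n = 4 + N" using n le_Suc_ex by blast
  then have N: "n = Suc (Suc (Suc (Suc N)))" by simp
  define c where "c = (\<lambda>i. (- 1) ^ i * real (n - 1 choose i))"
  have c0: "c i \<noteq> 0" if "i < n" for i using that unfolding c_def by simp
  define f :: "nat \<Rightarrow> real ^ 3" where "f = (\<lambda>i. c i *\<^sub>R vector [1, real i, (real i)\<^sup>2])"
  have comp: "f i $ 1 = c i * 1" "f i $ 2 = c i * real i" "f i $ 3 = c i * (real i)\<^sup>2" for i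
    unfolding f_def by simp_all
  have third: "(\<Sum>i<n. c i * g i) = 0" if "\<And>i. g i - 3 * g (Suc i) + 3 * g (Suc (Suc i)) - g (Suc (Suc (Suc i))) = 0" for g
  proof -
    have "{..<n} = {..n - 1}" using n by auto
    then have "(\<Sum>i<n. c i * g i) = (\<Sum>i\<le>Suc (Suc (Suc N)). (- 1) ^ i * real (Suc (Suc (Suc N)) choose i) * g i)"
      unfolding c_def N by simp
    also have "\<dots> = 0"
      unfolding alternating_binomial_Suc by (rule sum.neutral) (use that in \<open>simp add: algebra_simps\<close>)
    finally show ?thesis .
  qed
  have "(\<Sum>i<n. f i) $ k = 0" for k
  proof -
    have "k = 1 \<or> k = 2 \<or> k = 3" using exhaust_3 by blast
    moreover have "(\<Sum>i<n. c i * 1) = 0" by (rule third) simp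
    moreover have "(\<Sum>i<n. c i * real i) = 0" by (rule third) simp
    moreover have "(\<Sum>i<n. c i * (real i)\<^sup>2) = 0" by (rule third) (simp add: power2_eq_square algebra_simps)
    ultimately show ?thesis using comp by (auto simp: sum_component)
  qed
  then have "(\<Sum>i<n. f i) = 0" by (simp add: vec_eq_iff)
  moreover have "det3 (f i) (f j) (f k) \<noteq> 0" if "i < n" "j < n" "k < n" "distinct [i, j, k]" for i j k
  proof -
    \<comment> \<open>A Vandermonde determinant.\<close>
    have "det3 (f i) (f j) (f k) = c i * c j * c k * ((real j - real i) * (real k - real i) * (real k - real j))"
      unfolding det3_def comp by (simp add: power2_eq_square algebra_simps)
    then show ?thesis using c0 that by auto
  qed
  ultimately show ?thesis using that by blast
qed

text \<open>\<open>sep\<close> is the form of disjointness that tolerates perturbation: it says that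
  a plane through the origin strictly separates the two pairs of vectors. Nonzero turns also keep
  their signs, and since \<open>f\<close> has zero sum, the origin remains in the convex hull of the
  perturbed vectors.\<close>

theorem alternating_turns:
  fixes e :: "nat \<Rightarrow> real ^ 3"
  assumes n: "4 \<le> n" and sum: "(\<Sum>i<n. e i) = 0"
    and turn: "\<And>i. i < n \<Longrightarrow> det3 (e ((i + n - 1) mod n)) (e i) (e (Suc i mod n)) \<noteq> 0"
    and sep: "\<And>i j. i < n \<Longrightarrow> j < n \<Longrightarrow> distinct [i, Suc i mod n, j, Suc j mod n] \<Longrightarrow>
      0 \<notin> convex hull {e i, e (Suc i mod n), - e j, - e (Suc j mod n)}"
  shows "alternating (map (\<lambda>i. 0 < det3 (e ((i + n - 1) mod n)) (e i) (e (Suc i mod n))) [0..<n])"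
proof -
  obtain f :: "nat \<Rightarrow> real ^ 3" where f: "(\<Sum>i<n. f i) = 0"
    "\<And>i j k. i < n \<Longrightarrow> j < n \<Longrightarrow> k < n \<Longrightarrow> distinct [i, j, k] \<Longrightarrow> det3 (f i) (f j) (f k) \<noteq> 0"
    using zero_sum_general_position[OF n] by blast
  define d where "d = (\<lambda>\<epsilon> i. e i + \<epsilon> *\<^sub>R f i)"
  have dlim: "((\<lambda>\<epsilon>. d \<epsilon> i) \<longlongrightarrow> e i) (at_right 0)" for i
    unfolding d_def by (auto intro!: tendsto_eq_intros)
  have detlim: "((\<lambda>\<epsilon>. det3 (d \<epsilon> i) (d \<epsilon> j) (d \<epsilon> k)) \<longlongrightarrow> det3 (e i) (e j) (e k)) (at_right 0)" for i j k
    unfolding det3_def by (intro tendsto_intros dlim)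
  have gen: "\<forall>\<^sub>F \<epsilon> in at_right 0. det3 (d \<epsilon> i) (d \<epsilon> j) (d \<epsilon> k) \<noteq> 0"
    if ijk: "i < n" "j < n" "k < n" "distinct [i, j, k]" for i j k
  proof -
    \<comment> \<open>The perturbed determinant is a cubic in \<epsilon> whose leading coefficient,
      the determinant of the values of \<open>f\<close>, is nonzero. Hence it has no zeros for small
      positive \<epsilon>, even if it vanishes at 0.\<close>
    define p where "p = [:det3 (e i) (e j) (e k),
      det3 (f i) (e j) (e k) + det3 (e i) (f j) (e k) + det3 (e i) (e j) (f k),
      det3 (f i) (f j) (e k) + det3 (f i) (e j) (f k) + det3 (e i) (f j) (f k), det3 (f i) (f j) (f k):]"
    have p: "poly p \<epsilon> = det3 (d \<epsilon> i) (d \<epsilon> j) (d \<epsilon> k)" for \<epsilon>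
      unfolding p_def d_def by (simp add: algebra_simps)
    have "p \<noteq> 0" using f(2)[OF ijk] unfolding p_def by simp
    then have "finite ({x. poly p x = 0} - {0})" using poly_roots_finite by blast
    then have "open (- ({x. poly p x = 0} - {0}))" by (intro open_Compl finite_imp_closed)
    then have "\<forall>\<^sub>F x in nhds 0. x \<in> - ({x. poly p x = 0} - {0})"
      by (rule eventually_nhds_in_open) simp
    then show ?thesis unfolding eventually_at_filter by eventually_elim (auto simp: p[symmetric])
  qed
  have sgn: "\<forall>\<^sub>F \<epsilon> in at_right 0. (0 < det3 (d \<epsilon> i) (d \<epsilon> j) (d \<epsilon> k)) = (0 < det3 (e i) (e j) (e k))"
    if nz: "det3 (e i) (e j) (e k) \<noteq> 0" for i j k
  proof (cases "0 < det3 (e i) (e j) (e k)")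
    case True
    from order_tendstoD(1)[OF detlim this] show ?thesis by eventually_elim (use True in simp)
  next
    case False
    then have "det3 (e i) (e j) (e k) < 0" using nz by simp
    from order_tendstoD(2)[OF detlim this] show ?thesis by eventually_elim (use False in simp)
  qed
  have nocross: "\<forall>\<^sub>F \<epsilon> in at_right 0. \<not> crossing (d \<epsilon> i) (d \<epsilon> (Suc i mod n)) (d \<epsilon> j) (d \<epsilon> (Suc j mod n))"
    if ij: "i < n" "j < n" "distinct [i, Suc i mod n, j, Suc j mod n]" for i j
  proof -
    let ?S = "convex hull {e i, e (Suc i mod n), - e j, - e (Suc j mod n)}"
    have "closed ?S" by (intro compact_imp_closed finite_imp_compact_convex_hull) simp
    then obtain m b where m: "0 < b" "\<And>x. x \<in> ?S \<Longrightarrow> b < m \<bullet> x"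
      using separating_hyperplane_closed_0[OF convex_convex_hull _ sep[OF ij]] by blast
    have lim: "((\<lambda>\<epsilon>. m \<bullet> d \<epsilon> k) \<longlongrightarrow> m \<bullet> e k) (at_right 0)" for k by (intro tendsto_intros dlim)
    have x: "0 < m \<bullet> x" if "x \<in> {e i, e (Suc i mod n), - e j, - e (Suc j mod n)}" for x
      using m(1) m(2)[OF hull_inc[OF that]] by linarith
    have "0 < m \<bullet> e i" "0 < m \<bullet> e (Suc i mod n)" "m \<bullet> e j < 0" "m \<bullet> e (Suc j mod n) < 0"
      using x[of "e i"] x[of "e (Suc i mod n)"] x[of "- e j"] x[of "- e (Suc j mod n)"] by simp_all
    note ev = order_tendstoD(1)[OF lim this(1)] order_tendstoD(1)[OF lim this(2)]
      order_tendstoD(2)[OF lim this(3)] order_tendstoD(2)[OF lim this(4)]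
    from ev show ?thesis
    proof eventually_elim
      case (elim \<epsilon>)
      show ?case
      proof
        assume "crossing (d \<epsilon> i) (d \<epsilon> (Suc i mod n)) (d \<epsilon> j) (d \<epsilon> (Suc j mod n))"
        then obtain s t p q where st: "0 < s" "0 < t" "0 < p" "0 < q"
          "s *\<^sub>R d \<epsilon> i + t *\<^sub>R d \<epsilon> (Suc i mod n) = p *\<^sub>R d \<epsilon> j + q *\<^sub>R d \<epsilon> (Suc j mod n)"
          unfolding crossing_def by blast
        from arg_cong[OF st(5), of "\<lambda>x. m \<bullet> x"]
        have "s * (m \<bullet> d \<epsilon> i) + t * (m \<bullet> d \<epsilon> (Suc i mod n)) = p * (m \<bullet> d \<epsilon> j) + q * (m \<bullet> d \<epsilon> (Suc j mod n))"
          by (simp add: inner_add_right)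
        moreover have "0 < s * (m \<bullet> d \<epsilon> i)" "0 < t * (m \<bullet> d \<epsilon> (Suc i mod n))" using elim st by simp_all
        moreover have "p * (m \<bullet> d \<epsilon> j) < 0" "q * (m \<bullet> d \<epsilon> (Suc j mod n)) < 0"
          using elim st by (simp_all add: mult_pos_neg)
        ultimately show False by linarith
      qed
    qed
  qed
  have ev1: "\<forall>\<^sub>F \<epsilon> in at_right 0. (\<forall>i\<in>{..<n}. \<forall>j\<in>{..<n}. \<forall>k\<in>{..<n}. distinct [i, j, k] \<longrightarrow> det3 (d \<epsilon> i) (d \<epsilon> j) (d \<epsilon> k) \<noteq> 0)"
  proof (intro eventually_ball_finite ballI finite_lessThan)
    fix i j k assume "i \<in> {..<n}" "j \<in> {..<n}" "k \<in> {..<n}"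
    then show "\<forall>\<^sub>F \<epsilon> in at_right 0. distinct [i, j, k] \<longrightarrow> det3 (d \<epsilon> i) (d \<epsilon> j) (d \<epsilon> k) \<noteq> 0"
      using gen[of i j k] by (cases "distinct [i, j, k]") simp_all
  qed
  have ev2: "\<forall>\<^sub>F \<epsilon> in at_right 0. (\<forall>i\<in>{..<n}.
      (0 < det3 (d \<epsilon> ((i + n - 1) mod n)) (d \<epsilon> i) (d \<epsilon> (Suc i mod n)))
      = (0 < det3 (e ((i + n - 1) mod n)) (e i) (e (Suc i mod n))))"
    by (intro eventually_ball_finite ballI finite_lessThan) (use sgn turn in simp)
  have ev3: "\<forall>\<^sub>F \<epsilon> in at_right 0. (\<forall>i\<in>{..<n}. \<forall>j\<in>{..<n}. distinct [i, Suc i mod n, j, Suc j mod n] \<longrightarrow>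
      \<not> crossing (d \<epsilon> i) (d \<epsilon> (Suc i mod n)) (d \<epsilon> j) (d \<epsilon> (Suc j mod n)))"
  proof (intro eventually_ball_finite ballI finite_lessThan)
    fix i j assume "i \<in> {..<n}" "j \<in> {..<n}"
    then show "\<forall>\<^sub>F \<epsilon> in at_right 0. distinct [i, Suc i mod n, j, Suc j mod n] \<longrightarrow>
        \<not> crossing (d \<epsilon> i) (d \<epsilon> (Suc i mod n)) (d \<epsilon> j) (d \<epsilon> (Suc j mod n))"
      using nocross[of i j] by (cases "distinct [i, Suc i mod n, j, Suc j mod n]") simp_all
  qed
  note ex = eventually_happens'[OF trivial_limit_at_right_real
      eventually_conj[OF ev1 eventually_conj[OF ev2 ev3]]]
  obtain \<epsilon> where \<epsilon>:
    "\<forall>i\<in>{..<n}. \<forall>j\<in>{..<n}. \<forall>k\<in>{..<n}. distinct [i, j, k] \<longrightarrow> det3 (d \<epsilon> i) (d \<epsilon> j) (d \<epsilon> k) \<noteq> 0"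
    "\<forall>i\<in>{..<n}. (0 < det3 (d \<epsilon> ((i + n - 1) mod n)) (d \<epsilon> i) (d \<epsilon> (Suc i mod n)))
      = (0 < det3 (e ((i + n - 1) mod n)) (e i) (e (Suc i mod n)))"
    "\<forall>i\<in>{..<n}. \<forall>j\<in>{..<n}. distinct [i, Suc i mod n, j, Suc j mod n] \<longrightarrow>
      \<not> crossing (d \<epsilon> i) (d \<epsilon> (Suc i mod n)) (d \<epsilon> j) (d \<epsilon> (Suc j mod n))"
    using ex by (elim exE conjE)
  define u where "u = d \<epsilon>"
  define xs where "xs = map u [0..<n]"
  have len: "length xs = n" and nth: "\<And>i. i < n \<Longrightarrow> xs ! i = u i" unfolding xs_def by simp_all
  have neq: "u i \<noteq> u j" if "i < n" "j < n" "i \<noteq> j" for i j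
  proof
    assume eq: "u i = u j"
    \<comment> \<open>Only independence of triples is available, so a third index is supplied to
      separate two vectors.\<close>
    have "\<exists>k\<in>{0, 1, 2}. k \<noteq> i \<and> k \<noteq> j" by auto
    then obtain k where "k \<in> {0, 1, 2}" "k \<noteq> i" "k \<noteq> j" by blast
    moreover from this have "k < n" using n by auto
    ultimately have k: "k < n" "k \<noteq> i" "k \<noteq> j" by simp_all
    then show False using \<epsilon>(1)[rule_format, of i j k] k that eq unfolding u_def by simp
  qed
  have dist: "distinct xs" unfolding distinct_conv_nth len using nth neq by metis
  have set: "set xs = u ` {..<n}" unfolding xs_def by auto
  have "det3 (u a) (u b) (u c) \<noteq> 0" if abc: "a < n" "b < n" "c < n" "distinct [u a, u b, u c]" for a b c
  proof -
    have "distinct [a, b, c]" using abc(4) by auto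
    then show ?thesis using \<epsilon>(1)[rule_format, of a b c] abc unfolding u_def by simp
  qed
  then have gp: "general_position (set xs)" unfolding general_position_def set by blast
  have "simple_polygon xs" unfolding simple_polygon_def
  proof (intro allI impI)
    fix a b a' b' assume ab: "{a, b} \<in> polygon_edges xs" and ab': "{a', b'} \<in> polygon_edges xs"
      and dd: "distinct [a, b, a', b']"
    have m: "Suc i mod n < n" for i using n by simp
    obtain i where i: "i < n" "(a = u i \<and> b = u (Suc i mod n)) \<or> (b = u i \<and> a = u (Suc i mod n))"
      using polygon_edgesD[OF ab] nth m len by auto
    obtain j where j: "j < n" "(a' = u j \<and> b' = u (Suc j mod n)) \<or> (b' = u j \<and> a' = u (Suc j mod n))"
      using polygon_edgesD[OF ab'] nth m len by auto
    have "distinct [i, Suc i mod n, j, Suc j mod n]" using i j dd by auto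
    then have "\<not> crossing (u i) (u (Suc i mod n)) (u j) (u (Suc j mod n))"
      using \<epsilon>(3)[rule_format, of i j] i j unfolding u_def by simp
    then show "\<not> crossing a b a' b'" using i(2) j(2) crossing_commute crossing_commute2 by auto
  qed
  have "(\<Sum>i<n. u i) = 0"
    unfolding u_def d_def using sum f(1) by (simp add: sum.distrib scaleR_sum_right[symmetric])
  then have "(\<Sum>i<n. (1 / real n) *\<^sub>R u i) = 0" by (simp add: scaleR_sum_right[symmetric])
  moreover have "(\<Sum>i<n. (1 / real n) *\<^sub>R u i) \<in> convex hull (set xs)"
    by (rule convex_sum) (use n set hull_inc[of _ "set xs"] in auto)
  ultimately have hull: "0 \<in> convex hull (set xs)" by simp
  have "3 \<le> card (set xs)" using distinct_card[OF dist] len n by simp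
  then obtain T where T: "T \<subseteq> set xs" "positive_relation T"
    using positive_relation_exists[OF _ gp _ hull] by auto
  have "alternating (signs xs)"
    using simple_polygon_alternating[OF _ dist gp T(2,1)] \<open>simple_polygon xs\<close> n len by simp
  moreover have "signs xs = map (\<lambda>i. 0 < det3 (e ((i + n - 1) mod n)) (e i) (e (Suc i mod n))) [0..<n]"
  proof (rule nth_equalityI)
    fix i assume "i < length (signs xs)"
    then have i: "i < n" using len by simp
    have "(i + n - 1) mod n < n" "Suc i mod n < n" using n by simp_all
    then show "signs xs ! i = map (\<lambda>i. 0 < det3 (e ((i + n - 1) mod n)) (e i) (e (Suc i mod n))) [0..<n] ! i"
      using \<epsilon>(2)[rule_format, of i] i nth len by (simp add: nth_signs turn_def u_def)
  qed (simp add: len)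
  ultimately show ?thesis by simp
qed

section \<open>Flattenings\<close>

lemma det3_inner: "\<exists>m. \<forall>x. det3 a b x = m \<bullet> x"
proof
  show "\<forall>x. det3 a b x = vector [a$2 * b$3 - a$3 * b$2, a$3 * b$1 - a$1 * b$3, a$1 * b$2 - a$2 * b$1] \<bullet> x"
    by (simp add: det3_def inner_vec_def sum_3 algebra_simps)
qed

lemma det3_nonzero_extend:
  assumes "a \<noteq> 0"
  shows "\<exists>m n. det3 a m n \<noteq> 0"
proof (rule ccontr)
  assume *: "\<not> ?thesis"
  have "det3 a (vector [0, 1, 0]) (vector [0, 0, 1]) = a$1" "det3 a (vector [0, 0, 1]) (vector [1, 0, 0]) = a$2"
    "det3 a (vector [1, 0, 0]) (vector [0, 1, 0]) = a$3"
    by (simp_all add: det3_def)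
  then have "a$1 = 0" "a$2 = 0" "a$3 = 0" using * by metis+
  then show False using assms by (simp add: vec_eq_iff forall_3)
qed

lemma det3_eq_0_cases:
  assumes "det3 a b c = 0"
  shows "(\<exists>p q. c = p *\<^sub>R a + q *\<^sub>R b) \<or> (\<exists>t. b = t *\<^sub>R a) \<or> a = 0"
proof (cases "\<exists>d. det3 a b d \<noteq> 0")
  case True
  then obtain d where d: "det3 a b d \<noteq> 0" by blast
  obtain p q r where c: "c = p *\<^sub>R a + q *\<^sub>R b + r *\<^sub>R d" using coordinates_obtain[OF d] by blast
  have "det3 a b c = r * det3 a b d" unfolding c by simp
  then have "r = 0" using assms d by simp
  then show ?thesis using c by auto
next
  case False
  show ?thesis
  proof (cases "a = 0")
    case nz: False
    obtain m n where mn: "det3 a m n \<noteq> 0" using det3_nonzero_extend[OF nz] by blast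
    obtain p q r where b: "b = p *\<^sub>R a + q *\<^sub>R m + r *\<^sub>R n" using coordinates_obtain[OF mn] by blast
    have "det3 a b n = q * det3 a m n" "det3 a m b = r * det3 a m n" unfolding b by simp_all
    moreover have "det3 a b n = 0" "det3 a m b = 0" using False det3_swap(2)[of a b m] by auto
    ultimately have "q = 0" "r = 0" using mn by auto
    then show ?thesis using b by auto
  qed simp
qed

lemma affine_hull_3I:
  assumes "x = u *\<^sub>R a + v *\<^sub>R b + w *\<^sub>R c" "u + v + w = 1"
  shows "x \<in> affine hull {a, b, c}"
  unfolding affine_hull_3 mem_Collect_eq using assms by (intro exI conjI)

lemma noncoplanar_det3:
  assumes "\<not> coplanar {a, b, c, d}"
  shows "det3 (b - a) (c - a) (d - a) \<noteq> 0"
proof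
  assume 0: "det3 (b - a) (c - a) (d - a) = 0"
  have cop: False if "{a, b, c, d} \<subseteq> affine hull {x, y, z}" for x y z
    using that assms unfolding coplanar_def by metis
  from det3_eq_0_cases[OF 0] show False
  proof (elim disjE exE)
    fix p q assume "d - a = p *\<^sub>R (b - a) + q *\<^sub>R (c - a)"
    then have "d = (1 - p - q) *\<^sub>R a + p *\<^sub>R b + q *\<^sub>R c" by (simp add: algebra_simps)
    then have "d \<in> affine hull {a, b, c}" by (rule affine_hull_3I) simp
    then have "{a, b, c, d} \<subseteq> affine hull {a, b, c}" by (simp add: hull_inc)
    then show False by (rule cop)
  next
    fix t assume "c - a = t *\<^sub>R (b - a)"
    then have "c = (1 - t) *\<^sub>R a + t *\<^sub>R b + 0 *\<^sub>R d" by (simp add: algebra_simps)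
    then have "c \<in> affine hull {a, b, d}" by (rule affine_hull_3I) simp
    then have "{a, b, c, d} \<subseteq> affine hull {a, b, d}" by (simp add: hull_inc)
    then show False by (rule cop)
  next
    assume "b - a = 0"
    then have "{a, b, c, d} \<subseteq> affine hull {a, c, d}" by (simp add: hull_inc)
    then show False by (rule cop)
  qed
qed

text \<open>Measured by the normal of the plane, the outer vertices have heights
  \<open>- det3 d e f\<close> and \<open>det3 e f g\<close>, so opposite signs of consecutive
  determinants mean the same side.\<close>

lemma same_side_of_planeI:
  assumes "det3 e f g \<noteq> 0" and s: "det3 d e f * det3 e f g < 0"
  shows "same_side_of_plane a (a + e) (a + e + f) (a - d) (a + e + f + g)"
proof -
  obtain m where m: "\<And>x. det3 e f x = m \<bullet> x" using det3_inner by blast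
  have hull: "affine hull {a, a + e, a + e + f} = {x. m \<bullet> x = m \<bullet> a}"
  proof (intro set_eqI iffI)
    fix x assume "x \<in> affine hull {a, a + e, a + e + f}"
    then obtain u v w where x: "x = u *\<^sub>R a + v *\<^sub>R (a + e) + w *\<^sub>R (a + e + f)" "u + v + w = 1"
      unfolding affine_hull_3 mem_Collect_eq by (elim exE conjE)
    have "m \<bullet> x = (u + v + w) * det3 e f a" unfolding m[symmetric] x(1) by (simp add: algebra_simps)
    then show "x \<in> {x. m \<bullet> x = m \<bullet> a}" using x(2) m by simp
  next
    fix x assume "x \<in> {x. m \<bullet> x = m \<bullet> a}"
    then have 0: "det3 e f (x - a) = 0" by (simp add: m inner_diff_right)
    obtain p q r where x: "x - a = p *\<^sub>R e + q *\<^sub>R f + r *\<^sub>R g" using coordinates_obtain[OF assms(1)] by blast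
    have "r * det3 e f g = 0" using 0 unfolding x by simp
    then have "x - a = p *\<^sub>R e + q *\<^sub>R f" using x assms(1) by simp
    then have "x = (1 - p) *\<^sub>R a + (p - q) *\<^sub>R (a + e) + q *\<^sub>R (a + e + f)" by (simp add: algebra_simps)
    then show "x \<in> affine hull {a, a + e, a + e + f}" by (rule affine_hull_3I) simp
  qed
  have md: "m \<bullet> d = det3 d e f" using m[of d] det3_rotate[of e f d] by simp
  have mg: "m \<bullet> g = det3 e f g" using m by simp
  have mef: "m \<bullet> e = 0" "m \<bullet> f = 0" using m[of e] m[of f] by simp_all
  consider "det3 d e f < 0" "0 < det3 e f g" | "0 < det3 d e f" "det3 e f g < 0"
    using s by (auto simp: mult_less_0_iff)
  then show ?thesis
  proof cases
    case 1
    then show ?thesis unfolding same_side_of_plane_def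
      by (intro exI[of _ m] exI[of _ "m \<bullet> a"]) (simp add: hull md mg mef inner_simps)
  next
    case 2
    then show ?thesis unfolding same_side_of_plane_def
      by (intro exI[of _ "- m"] exI[of _ "- (m \<bullet> a)"]) (simp add: hull md mg mef inner_simps)
  qed
qed

lemma zero_in_hull4:
  fixes a b c d :: "real ^ 3"
  assumes "0 \<in> convex hull {a, b, - c, - d}"
  obtains s t p q where "0 \<le> s" "0 \<le> t" "0 \<le> p" "0 \<le> q" "s + t + p + q = 1"
    "s *\<^sub>R a + t *\<^sub>R b = p *\<^sub>R c + q *\<^sub>R d"
proof -
  obtain u w x where 1: "0 \<le> u" "0 \<le> w" "u + w = 1" "x \<in> convex hull {b, - c, - d}" "0 = u *\<^sub>R a + w *\<^sub>R x"
    using assms by (subst (asm) convex_hull_insert) auto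
  obtain t p q where 2: "0 \<le> t" "0 \<le> p" "0 \<le> q" "t + p + q = 1" "x = t *\<^sub>R b + p *\<^sub>R (- c) + q *\<^sub>R (- d)"
    using 1(4) unfolding convex_hull_3 mem_Collect_eq by (elim exE conjE)
  show ?thesis
  proof (rule that[of u "w * t" "w * p" "w * q"])
    have "u + w * t + w * p + w * q = u + w * (t + p + q)" by (simp add: algebra_simps)
    then show "u + w * t + w * p + w * q = 1" using 1 2 by simp
    show "u *\<^sub>R a + (w * t) *\<^sub>R b = (w * p) *\<^sub>R c + (w * q) *\<^sub>R d"
      using 1(5) unfolding 2(5) by (simp add: algebra_simps eq_neg_iff_add_eq_0)
  qed (use 1 2 in auto)
qed

lemma change_between:
  fixes a b :: int
  assumes "a < b" "g a \<noteq> (g b :: bool)"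
  shows "\<exists>c. a \<le> c \<and> c < b \<and> g c \<noteq> g (c + 1)"
proof (rule ccontr)
  assume *: "\<not> ?thesis"
  have "x \<le> b \<longrightarrow> g x = g a" if "a \<le> x" for x
    using that
  proof (induction x rule: int_ge_induct)
    case (step x)
    show ?case
    proof
      assume "x + 1 \<le> b"
      then have "g (x + 1) = g x" using * step.hyps by force
      then show "g (x + 1) = g a" using step.IH \<open>x + 1 \<le> b\<close> by simp
    qed
  qed simp
  from this[of b] show False using assms by simp
qed

section \<open>Edge vectors and flattenings of a generic polygon\<close>

context
  fixes P :: "(real ^ 3) list"
  assumes n4: "4 \<le> length P" and generic: "generic_polygon P"
begin

definition edge :: "int \<Rightarrow> real ^ 3" where
  "edge i = vertex P (i + 1) - vertex P i"

lemma vertex_cong: "i mod int (length P) = j mod int (length P) \<Longrightarrow> vertex P i = vertex P j"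
  by (simp add: vertex_def)

lemma edge_cong: "i mod int (length P) = j mod int (length P) \<Longrightarrow> edge i = edge j"
  unfolding edge_def by (intro arg_cong2[of _ _ _ _ minus] vertex_cong) (auto intro: mod_add_cong)

lemma mod_neq:
  assumes "i < j" "j < i + int (length P)"
  shows "i mod int (length P) \<noteq> j mod int (length P)"
proof
  assume "i mod int (length P) = j mod int (length P)"
  then have "int (length P) dvd j - i" using mod_eq_dvd_iff[of j "int (length P)" i] by simp
  then have "int (length P) \<le> j - i" by (rule zdvd_imp_le) (use assms in simp)
  then show False using assms by simp
qed

lemma index_bounds: "0 \<le> i mod int (length P)" "i mod int (length P) < int (length P)"
  using n4 by (auto intro!: pos_mod_sign pos_mod_bound)

lemma det3_vertices:
  assumes "distinct [i mod int (length P), j mod int (length P), k mod int (length P), l mod int (length P)]"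
  shows "det3 (vertex P j - vertex P i) (vertex P k - vertex P i) (vertex P l - vertex P i) \<noteq> 0"
proof (rule noncoplanar_det3)
  let ?m = "\<lambda>i. nat (i mod int (length P))"
  have m: "?m i < length P" for i using index_bounds[of i] by linarith
  have "?m x \<noteq> ?m y" if "x mod int (length P) \<noteq> y mod int (length P)" for x y
    using that index_bounds[of x] index_bounds[of y] by linarith
  then have "distinct [?m i, ?m j, ?m k, ?m l]" using assms by simp
  then show "\<not> coplanar {vertex P i, vertex P j, vertex P k, vertex P l}"
    using generic m unfolding generic_polygon_def vertex_def by blast
qed

text \<open>Genericity speaks of indices, so distinctness of vertices has to be derived: two equal
  vertices and any two further ones are coplanar. The cases merely pick the further indices.\<close>

lemma vertex_neq:
  assumes "i < j" "j < i + int (length P)"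
  shows "vertex P i \<noteq> vertex P j"
proof
  assume eq: "vertex P i = vertex P j"
  have neq: "x mod int (length P) \<noteq> y mod int (length P)"
    if "x < y \<and> y < x + int (length P) \<or> y < x \<and> x < y + int (length P)" for x y
    using that mod_neq[of x y] mod_neq[of y x] by argo
  have d: False if "distinct [i mod int (length P), j mod int (length P), k mod int (length P), l mod int (length P)]" for k l
    using det3_vertices[OF that] eq by simp
  consider "j = i + 1" | "j = i + 2" | "i + 2 < j" using assms by linarith
  then show False
  proof cases
    case 1
    show False by (rule d[of "i + 2" "i + 3"]) (use 1 n4 in \<open>simp add: neq\<close>)
  next
    case 2
    show False by (rule d[of "i + 1" "i + 3"]) (use 2 n4 in \<open>simp add: neq\<close>)
  next
    case 3
    show False by (rule d[of "i + 1" "i + 2"]) (use 3 assms n4 in \<open>simp add: neq\<close>)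
  qed
qed

lemma det3_edges: "det3 (edge (i - 1)) (edge i) (edge (i + 1)) \<noteq> 0"
proof -
  let ?n = "int (length P)"
  have "distinct [(i - 1) mod ?n, i mod ?n, (i + 1) mod ?n, (i + 2) mod ?n]" using n4 mod_neq by simp
  moreover have "vertex P i - vertex P (i - 1) = edge (i - 1)"
    "vertex P (i + 1) - vertex P (i - 1) = edge (i - 1) + edge i"
    "vertex P (i + 2) - vertex P (i - 1) = edge (i - 1) + edge i + edge (i + 1)"
    unfolding edge_def by (simp_all add: add.assoc)
  ultimately show ?thesis using det3_vertices[of "i - 1" i "i + 1" "i + 2"] by simp
qed

lemma edges_independent:
  assumes "s *\<^sub>R edge i + t *\<^sub>R edge (i + 1) = 0"
  shows "s = 0 \<and> t = 0"
proof -
  have "det3 (edge (i - 1)) (s *\<^sub>R edge i + t *\<^sub>R edge (i + 1)) (edge (i + 1)) = 0"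
    "det3 (edge (i - 1)) (edge i) (s *\<^sub>R edge i + t *\<^sub>R edge (i + 1)) = 0"
    unfolding assms by simp_all
  then show ?thesis using det3_edges[of i] by simp
qed

lemma length_tangent_indicatrix: "length (tangent_indicatrix P) = length P"
  by (simp add: tangent_indicatrix_def)

lemma vertex_tangent_indicatrix: "vertex (tangent_indicatrix P) i = edge i /\<^sub>R norm (edge i)"
proof -
  let ?n = "int (length P)"
  have "vertex (tangent_indicatrix P) i = tangent P (i mod ?n)"
    unfolding vertex_def length_tangent_indicatrix unfolding tangent_indicatrix_def
    using index_bounds[of i] by (subst nth_map) (simp_all add: nth_upto)
  moreover have "edge (i mod ?n) = edge i" by (rule edge_cong) simp
  ultimately show ?thesis unfolding tangent_def by (simp add: edge_def)
qed

lemma cone_in_arc: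
  assumes "z = s *\<^sub>R edge i + t *\<^sub>R edge (i + 1)" "0 \<le> s" "0 \<le> t" "z \<noteq> 0"
  shows "z /\<^sub>R norm z \<in> spherical_edge (tangent_indicatrix P) i"
proof -
  have ne: "edge k \<noteq> 0" for k using edges_independent[of 1 k 0] by auto
  have co: "(c * norm (edge k) / norm z) *\<^sub>R (edge k /\<^sub>R norm (edge k)) = (c / norm z) *\<^sub>R edge k" for c k
    using ne[of k] by simp
  have "z /\<^sub>R r = (s / r) *\<^sub>R edge i + (t / r) *\<^sub>R edge (i + 1)" for r
    unfolding assms(1) by (simp add: scaleR_add_right divide_inverse mult.commute)
  then have "z /\<^sub>R norm z = (s * norm (edge i) / norm z) *\<^sub>R (edge i /\<^sub>R norm (edge i))
      + (t * norm (edge (i + 1)) / norm z) *\<^sub>R (edge (i + 1) /\<^sub>R norm (edge (i + 1)))"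
    unfolding co .
  moreover have "0 \<le> s * norm (edge i) / norm z" "0 \<le> t * norm (edge (i + 1)) / norm z" using assms by simp_all
  ultimately have "z /\<^sub>R norm z \<in> {s *\<^sub>R (edge i /\<^sub>R norm (edge i)) + t *\<^sub>R (edge (i + 1) /\<^sub>R norm (edge (i + 1))) | s t.
      0 \<le> s \<and> 0 \<le> t}"
    unfolding mem_Collect_eq by (intro exI conjI)
  then show ?thesis using assms(4) unfolding spherical_edge_def great_arc_def vertex_tangent_indicatrix by simp
qed

text \<open>A zero of the hull yields a common vector \<open>z\<close> of the two cones.
  Independence of consecutive edges gives \<open>z \<noteq> 0\<close>, and then the direction of
  \<open>z\<close> lies on both arcs.\<close>

lemma cones_separated:
  assumes segre: "segre_polygon P" and ij: "(j - i) mod int (length P) \<notin> {0, 1, int (length P) - 1}"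
  shows "0 \<notin> convex hull {edge i, edge (i + 1), - edge j, - edge (j + 1)}"
proof
  assume "0 \<in> convex hull {edge i, edge (i + 1), - edge j, - edge (j + 1)}"
  then obtain s t p q where st: "0 \<le> s" "0 \<le> t" "0 \<le> p" "0 \<le> q" "s + t + p + q = 1"
    "s *\<^sub>R edge i + t *\<^sub>R edge (i + 1) = p *\<^sub>R edge j + q *\<^sub>R edge (j + 1)"
    by (rule zero_in_hull4)
  define z where "z = s *\<^sub>R edge i + t *\<^sub>R edge (i + 1)"
  show False
  proof (cases "z = 0")
    case True
    then have "s = 0 \<and> t = 0" "p = 0 \<and> q = 0"
      using edges_independent[of s i t] edges_independent[of p j q] st(6) unfolding z_def by auto
    then show False using st by simp
  next
    case False
    have "z /\<^sub>R norm z \<in> spherical_edge (tangent_indicatrix P) i"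
      "z /\<^sub>R norm z \<in> spherical_edge (tangent_indicatrix P) j"
      using cone_in_arc[of z s i t] cone_in_arc[of z p j q] st False unfolding z_def by auto
    moreover have "spherical_edge (tangent_indicatrix P) i \<inter> spherical_edge (tangent_indicatrix P) j = {}"
      using segre ij unfolding segre_polygon_def no_self_intersections_def length_tangent_indicatrix by blast
    ultimately show False by blast
  qed
qed

text \<open>Flattenings are counted as vertex sets, so different starting indices must give
  different sets. Vertex \<open>j\<close> tells them apart if \<open>j > i + 2\<close>, and vertex
  \<open>i + 3\<close> otherwise.\<close>

lemma flattening_triples_neq:
  assumes "i < j" "j < i + int (length P)"
  shows "{vertex P i, vertex P (i + 1), vertex P (i + 2)} \<noteq> {vertex P j, vertex P (j + 1), vertex P (j + 2)}"
proof
  assume eq: "{vertex P i, vertex P (i + 1), vertex P (i + 2)} = {vertex P j, vertex P (j + 1), vertex P (j + 2)}"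
  have neq: "vertex P x \<noteq> vertex P y" if "y < x" "x < y + int (length P)" for x y
    using vertex_neq[OF that] by simp
  have "j \<le> i + 2"
  proof (rule ccontr)
    assume "\<not> j \<le> i + 2"
    then have "vertex P j \<notin> {vertex P i, vertex P (i + 1), vertex P (i + 2)}"
      using assms neq[of i j] neq[of "i + 1" j] neq[of "i + 2" j] by simp
    then show False using eq by blast
  qed
  have "vertex P (i + 3) \<in> {vertex P j, vertex P (j + 1), vertex P (j + 2)}"
  proof -
    consider "j = i + 1" | "j = i + 2" using \<open>j \<le> i + 2\<close> assms by linarith
    then show ?thesis by cases (simp_all add: add.assoc)
  qed
  moreover have "vertex P (i + 3) \<notin> {vertex P i, vertex P (i + 1), vertex P (i + 2)}"
    using neq[of i "i + 3"] neq[of "i + 1" "i + 3"] neq[of "i + 2" "i + 3"] n4 by simp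
  ultimately show False using eq by blast
qed

lemma flatteningI:
  assumes "(0 < det3 (edge (i - 1)) (edge i) (edge (i + 1))) \<noteq> (0 < det3 (edge i) (edge (i + 1)) (edge (i + 2)))"
  shows "{vertex P i, vertex P (i + 1), vertex P (i + 2)} \<in> flattenings P"
proof -
  have nz: "det3 (edge (i - 1)) (edge i) (edge (i + 1)) \<noteq> 0" "det3 (edge i) (edge (i + 1)) (edge (i + 2)) \<noteq> 0"
    using det3_edges[of i] det3_edges[of "i + 1"] by (simp_all add: add.assoc)
  then have "det3 (edge (i - 1)) (edge i) (edge (i + 1)) * det3 (edge i) (edge (i + 1)) (edge (i + 2)) < 0"
    using assms by (auto simp: mult_less_0_iff)
  from same_side_of_planeI[OF nz(2) this, of "vertex P i"]
  have "same_side_of_plane (vertex P i) (vertex P (i + 1)) (vertex P (i + 2)) (vertex P (i - 1)) (vertex P (i + 3))"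
    unfolding edge_def by (simp add: add.assoc)
  then show ?thesis unfolding flattenings_def by blast
qed

lemma card_flattenings:
  assumes segre: "segre_polygon P"
  shows "4 \<le> card (flattenings P)"
proof -
  define n where "n = length P"
  have n: "4 \<le> n" using n4 unfolding n_def .
  define \<sigma> where "\<sigma> = (\<lambda>i. 0 < det3 (edge (i - 1)) (edge i) (edge (i + 1)))"
  have prev: "edge (int ((i + n - 1) mod n)) = edge (int i - 1)" for i
  proof (rule edge_cong)
    have "int ((i + n - 1) mod n) = (int i + int n - 1) mod int n"
      using n by (simp add: zmod_int of_nat_diff)
    also have "\<dots> = (int i - 1 + int n) mod int n" by (simp add: algebra_simps)
    finally show "int ((i + n - 1) mod n) mod int (length P) = (int i - 1) mod int (length P)"
      unfolding n_def by simp
  qed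
  have nxt: "edge (int (Suc i mod n)) = edge (int i + 1)" for i
    by (rule edge_cong) (simp add: n_def zmod_int add.commute)
  have "alternating (map (\<lambda>i. 0 < det3 (edge (int ((i + n - 1) mod n))) (edge (int i)) (edge (int (Suc i mod n)))) [0..<n])"
  proof (rule alternating_turns[OF n])
    have "(\<Sum>i<n. edge (int i)) = vertex P (int n) - vertex P (int 0)"
      using sum_lessThan_telescope[of "\<lambda>k. vertex P (int k)" n] by (simp add: edge_def add.commute)
    also have "vertex P (int n) = vertex P (int 0)" by (rule vertex_cong) (simp add: n_def)
    finally show "(\<Sum>i<n. edge (int i)) = 0" by simp
    show "det3 (edge (int ((i + n - 1) mod n))) (edge (int i)) (edge (int (Suc i mod n))) \<noteq> 0" for i
      unfolding prev nxt by (rule det3_edges)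
    show "0 \<notin> convex hull {edge (int i), edge (int (Suc i mod n)), - edge (int j), - edge (int (Suc j mod n))}"
      if ij: "i < n" "j < n" "distinct [i, Suc i mod n, j, Suc j mod n]" for i j
      unfolding nxt
    proof (rule cones_separated[OF segre])
      have ij': "i \<noteq> j" "j \<noteq> Suc i mod n" "i \<noteq> Suc j mod n" using ij(3) by auto
      have si: "Suc i mod n = (if Suc i = n then 0 else Suc i)" "Suc j mod n = (if Suc j = n then 0 else Suc j)"
        using ij by auto
      consider "i < j" | "j < i" using ij' by linarith
      then show "(int j - int i) mod int (length P) \<notin> {0, 1, int (length P) - 1}"
      proof cases
        case 1
        then have "(int j - int i) mod int n = int j - int i" using ij by simp
        then show ?thesis using 1 ij ij' si unfolding n_def[symmetric] by (auto split: if_splits)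
      next
        case 2
        have "(int j - int i) mod int n = (int j - int i + int n) mod int n" by simp
        also have "\<dots> = int j - int i + int n" by (rule mod_pos_pos_trivial) (use 2 ij in auto)
        finally show ?thesis using 2 ij ij' si unfolding n_def[symmetric] by (auto split: if_splits)
      qed
    qed
  qed
  then have "alternating (map (\<lambda>i. \<sigma> (int i)) [0..<n])" unfolding prev nxt \<sigma>_def .
  then obtain i j k l where "i < j" "j < k" "k < l" "l < length (map (\<lambda>i. \<sigma> (int i)) [0..<n])"
    "map (\<lambda>i. \<sigma> (int i)) [0..<n] ! i \<noteq> map (\<lambda>i. \<sigma> (int i)) [0..<n] ! j"
    "map (\<lambda>i. \<sigma> (int i)) [0..<n] ! j \<noteq> map (\<lambda>i. \<sigma> (int i)) [0..<n] ! k"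
    "map (\<lambda>i. \<sigma> (int i)) [0..<n] ! k \<noteq> map (\<lambda>i. \<sigma> (int i)) [0..<n] ! l"
    unfolding alternating_def by (elim exE conjE)
  then have *: "i < j" "j < k" "k < l" "l < n"
    "\<sigma> (int i) \<noteq> \<sigma> (int j)" "\<sigma> (int j) \<noteq> \<sigma> (int k)" "\<sigma> (int k) \<noteq> \<sigma> (int l)"
    by simp_all
  have "\<sigma> (int i + int n) = \<sigma> (int i)"
  proof -
    have "edge (int i + int n + x) = edge (int i + x)" for x
      using mod_add_self2[of "int i + x" "int n"] by (intro edge_cong) (simp add: n_def add_ac)
    from this[of "- 1"] this[of 0] this[of 1] show ?thesis unfolding \<sigma>_def by simp
  qed
  \<comment> \<open>After three changes the value at \<open>l\<close> differs from that at
    \<open>i\<close>, and periodicity yields the fourth change on the way back.\<close>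
  then have last: "\<sigma> (int l) \<noteq> \<sigma> (int i + int n)" using *(5-7) by auto
  obtain c1 where c1: "int i \<le> c1" "c1 < int j" "\<sigma> c1 \<noteq> \<sigma> (c1 + 1)"
    using change_between[of "int i" "int j" \<sigma>] * by auto
  obtain c2 where c2: "int j \<le> c2" "c2 < int k" "\<sigma> c2 \<noteq> \<sigma> (c2 + 1)"
    using change_between[of "int j" "int k" \<sigma>] * by auto
  obtain c3 where c3: "int k \<le> c3" "c3 < int l" "\<sigma> c3 \<noteq> \<sigma> (c3 + 1)"
    using change_between[of "int k" "int l" \<sigma>] * by auto
  obtain c4 where c4: "int l \<le> c4" "c4 < int i + int n" "\<sigma> c4 \<noteq> \<sigma> (c4 + 1)"
    using change_between[of "int l" "int i + int n" \<sigma>] * last by auto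
  define tri where "tri = (\<lambda>c. {vertex P c, vertex P (c + 1), vertex P (c + 2)})"
  have flat: "tri c \<in> flattenings P" if "\<sigma> c \<noteq> \<sigma> (c + 1)" for c
    unfolding tri_def using flatteningI[of c] that unfolding \<sigma>_def by (simp add: add.assoc)
  have neq: "tri c \<noteq> tri c'" if "c < c'" "c' < c + int n" for c c'
    using flattening_triples_neq[of c c'] that unfolding tri_def n_def by simp
  have lt: "c1 < c2" "c2 < c3" "c3 < c4" "c4 < c1 + int n" using c1 c2 c3 c4 by linarith+
  have "tri c1 \<noteq> tri c2" "tri c1 \<noteq> tri c3" "tri c1 \<noteq> tri c4" "tri c2 \<noteq> tri c3" "tri c2 \<noteq> tri c4" "tri c3 \<noteq> tri c4"
    by (rule neq; use lt in linarith)+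
  then have "card {tri c1, tri c2, tri c3, tri c4} = 4" by simp
  moreover have "{tri c1, tri c2, tri c3, tri c4} \<subseteq> flattenings P" using flat c1 c2 c3 c4 by blast
  \<comment> \<open>Finiteness matters because an infinite set has cardinality 0.\<close>
  moreover have "finite (flattenings P)"
  proof (rule finite_subset)
    have "vertex P i \<in> set P" for i
      unfolding vertex_def using index_bounds[of i] by (intro nth_mem) linarith
    then show "flattenings P \<subseteq> Pow (set P)" unfolding flattenings_def by auto
  qed simp
  ultimately show ?thesis using card_mono by metis
qed

end

theorem theorem2p3:
  fixes P :: "(real ^ 3) list"
  assumes "length P \<ge> 4"
    and "generic_polygon P"
    and "segre_polygon P"
  shows "card (flattenings P) \<ge> 4"
  using assms by (rule card_flattenings)

end
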